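(* Let $L>0$, $\alpha>0$, and let $H$ be the dissipative Schrödinger operator on the tadpole graph $\mathcal R$. The spectrum of $H$ is the disjoint union of $[0,+\infty[$ and $\Sigma_p^-(H)$, where $$\Sigma_p^-(H)=\left\{\lambda^2:\ \lambda\in\mathbb C_+^+\ \text{and}\ e^{i\lambda L}=3-\frac{4\alpha}{\lambda+\alpha}\right\},\qquad \mathbb C_+^+:=\{z\in\mathbb C:\ \Re z>0,\ \Im z>0\}.$$ Indeed, for all $k\in\mathbb N^*$, the number $\lambda_{2k}^2=\frac{4k^2\pi^2}{L^2}$ is an eigenvalue of $H$, with an associated eigenvector $\varphi^{(2k)}\in\mathcal D(H)$ given by $$\varphi^{(2k)}_1=0\ \text{ in }R_1,\qquad \varphi^{(2k)}_2(x)=\frac{\sqrt2}{\sqrt L}\sin(\lambda_{2k}x)\quad\forall x\in R_2,$$ where $\lambda_{2k}=\frac{2k\pi}{L}$. Furthermore, $\Sigma_p^-(H)$ is a discrete set of eigenvalues of $H$.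
   Context: Tadpole graph: $\mathcal R=\overline{R_1}\cup\overline{R_2}$, where $R_1$ is identified with $(0,+\infty)$ and $R_2$ is a closed path of length $L>0$, identified with $(0,L)$. Functions on $\mathcal R$ are pairs $f=(f_1,f_2)$ of complex-valued functions with $f_k$ defined on $R_k$. $\mathcal H=L^2(R_1)\oplus L^2(R_2)$. $H(u_1,u_2)=(-u_1'',-u_2'')$ on the domain $\mathcal D(H)$ of all $(u_1,u_2)\in H^2(R_1)\oplus H^2(R_2)$ satisfying $u_1(0)=u_2(0)=u_2(L)$ and $u_1'(0^+)+u_2'(0^+)-u_2'(L^-)=i\alpha u_1(0)$, with $\alpha>0$ a constant. $\mathbb N^*$ denotes the positive integers. *)

theory Defs
  imports "HOL-Analysis.Analysis"
begin

text \<open>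
  Elements of the Hilbert space are represented by pairs of functions; two pairs that agree
  almost everywhere on both edges represent the same element.
\<close>

type_synonym tadpole_fun = "(real \<Rightarrow> complex) \<times> (real \<Rightarrow> complex)"

definition R1 :: "real set" where
  "R1 = {0<..}"

definition R2 :: "real \<Rightarrow> real set" where
  "R2 L = {0<..<L}"

definition L2_on :: "real set \<Rightarrow> (real \<Rightarrow> complex) set" where
  "L2_on I = {f. f \<in> borel_measurable (lebesgue_on I) \<and>
                 integrable (lebesgue_on I) (\<lambda>x. (cmod (f x))\<^sup>2)}"

definition tadpole_space :: "real \<Rightarrow> tadpole_fun set" where
  "tadpole_space L = L2_on R1 \<times> L2_on (R2 L)"

definition tadpole_norm :: "real \<Rightarrow> tadpole_fun \<Rightarrow> real" where
  "tadpole_norm L u =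
     sqrt (integral\<^sup>L (lebesgue_on R1) (\<lambda>x. (cmod (fst u x))\<^sup>2) +
           integral\<^sup>L (lebesgue_on (R2 L)) (\<lambda>x. (cmod (snd u x))\<^sup>2))"

definition tadpole_eq :: "real \<Rightarrow> tadpole_fun \<Rightarrow> tadpole_fun \<Rightarrow> bool" where
  "tadpole_eq L u v \<longleftrightarrow>
     (AE x in lebesgue_on R1. fst u x = fst v x) \<and>
     (AE x in lebesgue_on (R2 L). snd u x = snd v x)"

text \<open>
  Weak derivatives on an open set \<open>I\<close> are tested against real-valued smooth functions with compact
  support in \<open>I\<close>; by linearity, complex-valued test functions give the same notion.
\<close>

definition test_functions :: "real set \<Rightarrow> (real \<Rightarrow> real) set" where
  "test_functions I = {\<phi>. (\<forall>n x. (deriv ^^ n) \<phi> differentiable (at x)) \<and>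
                          compact (closure {x. \<phi> x \<noteq> 0}) \<and> closure {x. \<phi> x \<noteq> 0} \<subseteq> I}"

definition has_weak_deriv ::
    "real set \<Rightarrow> (real \<Rightarrow> complex) \<Rightarrow> (real \<Rightarrow> complex) \<Rightarrow> bool" where
  "has_weak_deriv I f g \<longleftrightarrow>
     (\<forall>\<phi>\<in>test_functions I.
        integral\<^sup>L (lebesgue_on I) (\<lambda>x. f x * of_real (deriv \<phi> x)) =
        - integral\<^sup>L (lebesgue_on I) (\<lambda>x. g x * of_real (\<phi> x)))"

text \<open>A representative of the weak derivative in \<open>L\<^sup>2\<close>, which is unique almost everywhere.\<close>

definition weak_deriv :: "real set \<Rightarrow> (real \<Rightarrow> complex) \<Rightarrow> (real \<Rightarrow> complex)" where
  "weak_deriv I f = (SOME g. g \<in> L2_on I \<and> has_weak_deriv I f g)"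

definition sobolev_H1 :: "real set \<Rightarrow> (real \<Rightarrow> complex) set" where
  "sobolev_H1 I = {f \<in> L2_on I. \<exists>g\<in>L2_on I. has_weak_deriv I f g}"

definition sobolev_H2 :: "real set \<Rightarrow> (real \<Rightarrow> complex) set" where
  "sobolev_H2 I = {f \<in> sobolev_H1 I. weak_deriv I f \<in> sobolev_H1 I}"

text \<open>
  The value at a point \<open>a\<close> of the closure of \<open>I\<close> of the continuous representative of \<open>f\<close>.
  It exists and is unique for \<open>f\<close> in \<open>sobolev_H1 I\<close>, \<open>I\<close> a nonempty open interval, and does not
  depend on the values of \<open>f\<close> on a null set.
\<close>

definition boundary_value :: "real set \<Rightarrow> (real \<Rightarrow> complex) \<Rightarrow> real \<Rightarrow> complex" where
  "boundary_value I f a =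
     (THE c. \<exists>F. continuous_on (closure I) F \<and> (AE x in lebesgue_on I. f x = F x) \<and> F a = c)"

definition tadpole_dom :: "real \<Rightarrow> real \<Rightarrow> tadpole_fun set" where
  "tadpole_dom L \<alpha> =
     {(u1, u2). u1 \<in> sobolev_H2 R1 \<and> u2 \<in> sobolev_H2 (R2 L) \<and>
        boundary_value R1 u1 0 = boundary_value (R2 L) u2 0 \<and>
        boundary_value (R2 L) u2 0 = boundary_value (R2 L) u2 L \<and>
        boundary_value R1 (weak_deriv R1 u1) 0
          + boundary_value (R2 L) (weak_deriv (R2 L) u2) 0
          - boundary_value (R2 L) (weak_deriv (R2 L) u2) L
        = \<i> * of_real \<alpha> * boundary_value R1 u1 0}"

definition tadpole_H :: "real \<Rightarrow> tadpole_fun \<Rightarrow> tadpole_fun" where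
  "tadpole_H L u =
     ((\<lambda>x. - weak_deriv R1 (weak_deriv R1 (fst u)) x),
      (\<lambda>x. - weak_deriv (R2 L) (weak_deriv (R2 L) (snd u)) x))"

text \<open>
  Spectral notions for an operator \<open>T\<close> with domain \<open>D\<close> in \<open>tadpole_space L\<close>.
\<close>

definition minus_scalar ::
    "(tadpole_fun \<Rightarrow> tadpole_fun) \<Rightarrow> complex \<Rightarrow> tadpole_fun \<Rightarrow> tadpole_fun" where
  "minus_scalar T z u =
     ((\<lambda>x. fst (T u) x - z * fst u x), (\<lambda>x. snd (T u) x - z * snd u x))"

text \<open>
  The point \<open>z\<close> is in the resolvent set if \<open>T - z\<close> is a bijection from \<open>D\<close> onto the whole
  space (up to equality almost everywhere) with bounded inverse.
\<close>

definition resolvent_set ::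
    "real \<Rightarrow> tadpole_fun set \<Rightarrow> (tadpole_fun \<Rightarrow> tadpole_fun) \<Rightarrow> complex set" where
  "resolvent_set L D T =
     {z. (\<forall>u\<in>D. \<forall>v\<in>D. tadpole_eq L (minus_scalar T z u) (minus_scalar T z v) \<longrightarrow> tadpole_eq L u v) \<and>
         (\<forall>g\<in>tadpole_space L. \<exists>u\<in>D. tadpole_eq L (minus_scalar T z u) g) \<and>
         (\<exists>C. \<forall>u\<in>D. tadpole_norm L u \<le> C * tadpole_norm L (minus_scalar T z u))}"

definition op_spectrum ::
    "real \<Rightarrow> tadpole_fun set \<Rightarrow> (tadpole_fun \<Rightarrow> tadpole_fun) \<Rightarrow> complex set" where
  "op_spectrum L D T = - resolvent_set L D T"

definition is_eigenvector ::
    "real \<Rightarrow> tadpole_fun set \<Rightarrow> (tadpole_fun \<Rightarrow> tadpole_fun) \<Rightarrow> complex \<Rightarrow> tadpole_fun \<Rightarrow> bool" where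
  "is_eigenvector L D T z u \<longleftrightarrow>
     u \<in> D \<and> \<not> tadpole_eq L u ((\<lambda>x. 0), (\<lambda>x. 0)) \<and>
     tadpole_eq L (T u) ((\<lambda>x. z * fst u x), (\<lambda>x. z * snd u x))"

definition is_eigenvalue ::
    "real \<Rightarrow> tadpole_fun set \<Rightarrow> (tadpole_fun \<Rightarrow> tadpole_fun) \<Rightarrow> complex \<Rightarrow> bool" where
  "is_eigenvalue L D T z \<longleftrightarrow> (\<exists>u. is_eigenvector L D T z u)"

definition Sigma_p_minus :: "real \<Rightarrow> real \<Rightarrow> complex set" where
  "Sigma_p_minus L \<alpha> =
     {lam\<^sup>2 | lam. Re lam > 0 \<and> Im lam > 0 \<and>
       exp (\<i> * lam * of_real L) = 3 - 4 * of_real \<alpha> / (lam + of_real \<alpha>)}"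

end

theory Submission
  imports Defs "HOL-Complex_Analysis.Conformal_Mappings"
begin

text \<open>
  A number outside \<open>[0,\<infinity>)\<close> can be written \<open>\<kappa>\<^sup>2\<close> with \<open>Im \<kappa> > 0\<close>. A solution
  of \<open>-u'' = \<kappa>\<^sup>2 u\<close> that is square integrable on the half-line is a multiple of \<open>exp (\<i>\<kappa>x)\<close>, and on the
  loop it is \<open>A exp (\<i>\<kappa>x) + B exp (-\<i>\<kappa>x)\<close>. With \<open>E = exp (\<i>\<kappa>L)\<close>, so that \<open>\<bar>E\<bar> < 1\<close>, equality of the two
  values on the loop forces \<open>B = A E\<close>; continuity and the derivative condition at the junction then reduce to
  \<open>A (E (\<kappa> + \<alpha>) - (3 \<kappa> - \<alpha>)) = 0\<close>. The bracket is \<open>characteristic \<kappa>\<close> below, and its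
  vanishing is the equation that defines \<open>Sigma_p_minus\<close>. Its zeros in the upper half-plane satisfy
  \<open>Re \<kappa> > 0\<close>, because \<open>\<bar>E\<bar> < 1\<close> gives \<open>\<bar>3\<kappa> - \<alpha>\<bar> < \<bar>\<kappa> + \<alpha>\<bar>\<close>, that is \<open>\<bar>\<kappa>\<bar>\<^sup>2 < \<alpha> Re \<kappa>\<close>
  (\<open>characteristic_zero_Re_pos\<close>). In particular \<open>\<kappa>\<^sup>2\<close> is not real.

  If \<open>characteristic \<kappa> \<noteq> 0\<close> the kernel is trivial (\<open>kernel_trivial\<close>), and the equation
  \<open>-u'' - \<kappa>\<^sup>2 u = g\<close> is solved with bounds (\<open>resolvent_solution\<close>): the whole-line Green kernel
  \<open>\<i> exp (\<i>\<kappa>\<bar>x - y\<bar>) / (2\<kappa>)\<close> is applied to the data on each edge, the data being extended by zero, and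
  exponentials are added to repair the junction conditions; their coefficients solve a linear system whose
  determinant is the characteristic function up to nonvanishing factors (\<open>junction_system\<close>).
  So \<open>\<kappa>\<^sup>2\<close> is in the resolvent set.

  If \<open>characteristic \<kappa> = 0\<close> the solution above is an eigenvector
  (\<open>eigenvalue_if_characteristic_zero\<close>). For \<open>s = k\<^sup>2 \<ge> 0\<close> the inverse cannot be bounded: the functions
  equal to \<open>exp (\<i>(k + \<i>\<epsilon>)x)\<close> on the half-line, completed by a quadratic polynomial on the loop, have norms
  that tend to infinity as \<open>\<epsilon> \<rightarrow> 0\<close>, while \<open>H - s\<close> maps them to a bounded set (\<open>nonneg_in_spectrum\<close>).
  Finally \<open>Sigma_p_minus\<close> is discrete because it corresponds, through the square root, to zeros of an entire
  function that is not identically zero.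

  The domain of \<open>H\<close> is defined by weak derivatives, whereas the argument above is about
  differential equations. The bridge is the relation \<open>primitive_on J F f\<close>, which says that \<open>F\<close> is locally absolutely
  continuous on \<open>J\<close> with derivative \<open>f\<close> almost everywhere. On an open interval, an \<open>L\<^sup>2\<close> function has the \<open>L\<^sup>2\<close> weak
  derivative \<open>g\<close> precisely when it is almost everywhere equal to a primitive of \<open>g\<close>
  (\<open>weak_deriv_imp_primitive\<close>, \<open>primitive_imp_weak_deriv\<close>). One direction is integration by parts
  (\<open>primitive_on_mult_C1\<close>), the other is the lemma of du Bois-Reymond (\<open>weak_deriv_zero_imp_constant\<close>),
  which rests on smooth bump functions. After that, elements of the domain are triples of a function and its
  two derivatives (\<open>H2_rep\<close>, \<open>dom_rep\<close>), and boundary values are values of continuous functions.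
\<close>

section \<open>Smooth functions and bump functions\<close>

definition smooth :: "(real \<Rightarrow> real) \<Rightarrow> bool" where
  "smooth f \<longleftrightarrow> (\<forall>n x. (deriv ^^ n) f differentiable (at x))"

lemma smooth_iff_deriv: "smooth f \<longleftrightarrow> (\<forall>x. f differentiable (at x)) \<and> smooth (deriv f)"
proof
  assume f: "smooth f"
  have "(deriv ^^ n) (deriv f) differentiable (at x)" for n x
    using f[unfolded smooth_def, rule_format, of "Suc n" x] by (simp add: funpow_swap1)
  moreover have "f differentiable (at x)" for x
    using f[unfolded smooth_def, rule_format, of 0 x] by simp
  ultimately show "(\<forall>x. f differentiable (at x)) \<and> smooth (deriv f)"
    by (simp add: smooth_def)
next
  assume *: "(\<forall>x. f differentiable (at x)) \<and> smooth (deriv f)"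
  have "(deriv ^^ n) f differentiable (at x)" for n x
  proof (cases n)
    case (Suc m)
    then show ?thesis
      using * unfolding smooth_def by (simp add: funpow_swap1)
  qed (use * in simp)
  then show "smooth f" by (simp add: smooth_def)
qed

text \<open>
  Smoothness is proved by exhibiting a set of functions that contains the given one and is closed under
  differentiation; no formula for the higher derivatives is then needed.
\<close>
lemma smooth_coinduct:
  assumes "f \<in> C"
    and step: "\<And>f. f \<in> C \<Longrightarrow> \<exists>f'\<in>C. \<forall>x. (f has_real_derivative f' x) (at x)"
  shows "smooth f"
proof -
  have "(deriv ^^ n) f \<in> C" for n
  proof (induction n)
    case (Suc n)
    obtain f' where "f' \<in> C" "\<And>x. ((deriv ^^ n) f has_real_derivative f' x) (at x)"
      using step[OF Suc] by blast
    then show ?case by (simp add: DERIV_imp_deriv ext[of "deriv _" f'])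
  qed (use assms in auto)
  then show ?thesis unfolding smooth_def using step real_differentiable_def by blast
qed

lemma smooth_deriv: "smooth f \<Longrightarrow> smooth (deriv f)"
  using smooth_iff_deriv by blast

lemma smooth_has_deriv: "smooth f \<Longrightarrow> (f has_real_derivative deriv f x) (at x)"
  using smooth_iff_deriv DERIV_deriv_iff_real_differentiable by blast

lemma smooth_isCont: "smooth f \<Longrightarrow> isCont f x"
  using smooth_has_deriv DERIV_isCont by blast

lemma smooth_affine:
  assumes "smooth f"
  shows "smooth (\<lambda>x. f (c * x + d))"
proof (rule smooth_coinduct)
  show "(\<lambda>x. f (c * x + d)) \<in> {\<lambda>x. r * g (c * x + d) | r g. smooth g}"
    using assms by (intro CollectI exI[of _ 1] exI[of _ f]) auto
next
  fix u assume "u \<in> {\<lambda>x. r * g (c * x + d) | r g. smooth g}"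
  then obtain r g where u: "u = (\<lambda>x. r * g (c * x + d))" "smooth g" by blast
  show "\<exists>f'\<in>{\<lambda>x. r * g (c * x + d) | r g. smooth g}. \<forall>x. (u has_real_derivative f' x) (at x)"
  proof (intro bexI allI)
    show "(u has_real_derivative ((r * c) * deriv g (c * x + d))) (at x)" for x
      unfolding u by (rule derivative_eq_intros refl DERIV_chain2[OF smooth_has_deriv[OF u(2)]] | simp)+
    show "(\<lambda>x. (r * c) * deriv g (c * x + d)) \<in> {\<lambda>x. r * g (c * x + d) | r g. smooth g}"
      using u(2) smooth_deriv by blast
  qed
qed

text \<open>
  The functions produced from a product of smooth functions by repeated use of the Leibniz rule. The premises
  state the equation of the new function pointwise instead of putting a lambda term into the conclusion, which keeps
  the case analysis first order.
\<close>
inductive_set product_sums :: "(real \<Rightarrow> real) set" where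
  prod: "smooth f \<Longrightarrow> smooth g \<Longrightarrow> \<forall>x. h x = f x * g x \<Longrightarrow> h \<in> product_sums"
| add: "u \<in> product_sums \<Longrightarrow> v \<in> product_sums \<Longrightarrow> \<forall>x. h x = u x + v x \<Longrightarrow> h \<in> product_sums"

lemma smooth_product_sums:
  assumes "u \<in> product_sums"
  shows "smooth u"
proof (rule smooth_coinduct[OF assms])
  fix f assume "f \<in> product_sums"
  then show "\<exists>f'\<in>product_sums. \<forall>x. (f has_real_derivative f' x) (at x)"
  proof induction
    case (prod f g h)
    have h: "h = (\<lambda>x. f x * g x)"
      using prod(3) by blast
    have "(\<lambda>x. deriv f x * g x) \<in> product_sums" "(\<lambda>x. f x * deriv g x) \<in> product_sums"
      using prod(1,2) by (auto intro: product_sums.prod smooth_deriv)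
    then have "(\<lambda>x. deriv f x * g x + f x * deriv g x) \<in> product_sums"
      by (rule product_sums.add) simp
    moreover have "(h has_real_derivative deriv f x * g x + f x * deriv g x) (at x)" for x
      unfolding h using DERIV_mult'[OF smooth_has_deriv[OF prod(1)] smooth_has_deriv[OF prod(2)]]
      by (simp add: algebra_simps)
    ultimately show ?case by (intro bexI[of _ "\<lambda>x. deriv f x * g x + f x * deriv g x"]) auto
  next
    case (add u v h)
    have h: "h = (\<lambda>x. u x + v x)"
      using add(3) by blast
    obtain u' v' where *: "u' \<in> product_sums" "v' \<in> product_sums"
      "\<And>x. (u has_real_derivative u' x) (at x)" "\<And>x. (v has_real_derivative v' x) (at x)"
      using add(4,5) by blast
    then have "(h has_real_derivative u' x + v' x) (at x)" for x
      unfolding h by (intro DERIV_add)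
    moreover have "(\<lambda>x. u' x + v' x) \<in> product_sums"
      using *(1,2) by (rule product_sums.add) simp
    ultimately show ?case
      by (intro bexI[of _ "\<lambda>x. u' x + v' x"]) auto
  qed
qed

lemma smooth_mult: "smooth f \<Longrightarrow> smooth g \<Longrightarrow> smooth (\<lambda>x. f x * g x)"
  by (rule smooth_product_sums, rule product_sums.prod[of f g]) auto

lemma smooth_const: "smooth (\<lambda>x. c)"
proof (rule smooth_coinduct[of _ "range (\<lambda>c x. c)"])
  fix f :: "real \<Rightarrow> real" assume "f \<in> range (\<lambda>c x. c)"
  then obtain d where "f = (\<lambda>x. d)" by blast
  then show "\<exists>f'\<in>range (\<lambda>c x. c). \<forall>x. (f has_real_derivative f' x) (at x)"
    by (intro bexI[of _ "\<lambda>x. 0"]) auto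
qed blast

lemma smooth_add:
  assumes "smooth f" "smooth g"
  shows "smooth (\<lambda>x. f x + g x)"
proof -
  have "f \<in> product_sums"
    by (rule product_sums.prod[OF smooth_const[of 1] assms(1)]) simp
  moreover have "g \<in> product_sums"
    by (rule product_sums.prod[OF smooth_const[of 1] assms(2)]) simp
  ultimately show ?thesis
    by (intro smooth_product_sums, rule product_sums.add) auto
qed

text \<open>
  The functions \<open>p (1/x) exp (-1/x)\<close>, \<open>p\<close> a polynomial, extended by zero to \<open>x \<le> 0\<close>. They contain
  \<open>exp (-1/x)\<close> and, unlike this function alone, form a set that is closed under differentiation.
\<close>
definition flat_exp :: "real poly \<Rightarrow> real \<Rightarrow> real" where
  "flat_exp p x = (if x > 0 then poly p (1 / x) * exp (- (1 / x)) else 0)"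

text \<open>
  Substituting \<open>t = 1/x\<close> turns the limit at \<open>0\<close> from the right into \<open>p t exp (-t) \<rightarrow> 0\<close> at infinity.
\<close>
lemma flat_exp_tendsto_0: "(flat_exp p \<longlongrightarrow> 0) (at 0)"
proof -
  have *: "((\<lambda>t. poly p t * exp (- t)) \<longlongrightarrow> 0) at_top"
  proof -
    have "((\<lambda>t::real. \<Sum>i\<le>degree p. coeff p i * (t ^ i / exp t)) \<longlongrightarrow> (\<Sum>i\<le>degree p. coeff p i * 0)) at_top"
      by (intro tendsto_sum tendsto_mult tendsto_const tendsto_power_div_exp_0)
    then show ?thesis
      by (simp add: poly_altdef sum_distrib_right exp_minus divide_inverse mult.assoc)
  qed
  have "(flat_exp p \<longlongrightarrow> 0) (at_right 0)"
  proof (rule Lim_transform_eventually)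
    show "((\<lambda>x. poly p (inverse x) * exp (- inverse x)) \<longlongrightarrow> 0) (at_right 0)"
      using filterlim_compose[OF * filterlim_inverse_at_top_right] .
    show "\<forall>\<^sub>F x in at_right 0. poly p (inverse x) * exp (- inverse x) = flat_exp p x"
      unfolding eventually_at_right_field by (intro exI[of _ 1]) (auto simp: flat_exp_def inverse_eq_divide)
  qed
  moreover have "(flat_exp p \<longlongrightarrow> 0) (at_left 0)"
    by (rule Lim_transform_eventually[OF tendsto_const])
      (auto simp: eventually_at_left_field flat_exp_def intro!: exI[of _ "-1"])
  ultimately show ?thesis by (simp add: filterlim_split_at)
qed

text \<open>
  The derivative of \<open>p (1/x) exp (-1/x)\<close> is \<open>x\<^sup>-\<^sup>2 (p - p') (1/x) exp (-1/x)\<close>. At \<open>0\<close> the difference quotient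
  is again a function of the family, with polynomial \<open>X p\<close>, and tends to \<open>0\<close>.
\<close>
lemma flat_exp_has_derivative:
  "(flat_exp p has_real_derivative flat_exp (pCons 0 (pCons 0 (p - pderiv p))) x) (at x)"
proof (cases x "0::real" rule: linorder_cases)
  case less
  have "((\<lambda>x. 0) has_real_derivative 0) (at x)" by simp
  then have "(flat_exp p has_real_derivative 0) (at x)"
    by (rule has_field_derivative_transform_within_open[where S="{..<0}"])
      (use less in \<open>auto simp: flat_exp_def\<close>)
  then show ?thesis using less by (simp add: flat_exp_def)
next
  case equal
  have "((\<lambda>h. flat_exp (pCons 0 p) h) \<longlongrightarrow> 0) (at 0)"
    by (rule flat_exp_tendsto_0)
  then have "((\<lambda>h. flat_exp p h / h) \<longlongrightarrow> 0) (at 0)"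
    by (rule Lim_transform_eventually)
      (auto simp: flat_exp_def eventually_at_filter)
  then show ?thesis using equal by (simp add: DERIV_def flat_exp_def)
next
  case greater
  have "((\<lambda>x. poly p (1/x) * exp (- (1/x))) has_real_derivative
      (- (1/x^2) * poly (pderiv p) (1/x)) * exp (- (1/x)) + poly p (1/x) * (exp (- (1/x)) * (1/x^2))) (at x)"
    using greater by (auto intro!: derivative_eq_intros simp: power2_eq_square)
  then have "((\<lambda>x. poly p (1/x) * exp (- (1/x))) has_real_derivative
      flat_exp (pCons 0 (pCons 0 (p - pderiv p))) x) (at x)"
    using greater by (simp add: flat_exp_def algebra_simps power2_eq_square)
  then show ?thesis
    by (rule has_field_derivative_transform_within_open[where S="{0<..}"])
      (use greater in \<open>auto simp: flat_exp_def\<close>)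
qed

lemma smooth_flat_exp: "smooth (flat_exp p)"
  by (rule smooth_coinduct[of _ "range flat_exp"]) (use flat_exp_has_derivative in blast)+

text \<open>
  Rescaling \<open>exp (-1/x)\<close> by \<open>n\<close> keeps the support of the product equal to \<open>[a,b]\<close> and makes it increase to \<open>1\<close> on the
  interior, so that the bumps approximate the indicator function of \<open>(a,b)\<close>.
\<close>
definition bump :: "real \<Rightarrow> real \<Rightarrow> nat \<Rightarrow> real \<Rightarrow> real" where
  "bump a b n x = flat_exp 1 (real (Suc n) * (x - a)) * flat_exp 1 (real (Suc n) * (b - x))"

lemma smooth_bump: "smooth (bump a b n)"
proof -
  have *: "bump a b n = (\<lambda>x. flat_exp 1 (real (Suc n) * x + - (real (Suc n) * a)) * flat_exp 1 (- real (Suc n) * x + real (Suc n) * b))"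
    by (rule ext) (simp add: bump_def algebra_simps)
  show ?thesis
    unfolding * by (intro smooth_mult smooth_affine smooth_flat_exp)
qed

lemma bump_bounds: "0 \<le> bump a b n x" "bump a b n x \<le> 1"
  by (auto simp: bump_def flat_exp_def zero_less_mult_iff intro!: mult_le_one)

lemma bump_outside: "x \<notin> {a<..<b} \<Longrightarrow> bump a b n x = 0"
  by (auto simp: bump_def flat_exp_def zero_less_mult_iff)

lemma bump_positive: "x \<in> {a<..<b} \<Longrightarrow> bump a b n x > 0"
  by (auto simp: bump_def flat_exp_def zero_less_mult_iff)

lemma bump_tendsto: "(\<lambda>n. bump a b n x) \<longlonglongrightarrow> indicator {a<..<b} x"
proof (cases "x \<in> {a<..<b}")
  case True
  have *: "(\<lambda>n. exp (- (1 / (real (Suc n) * y)))) \<longlonglongrightarrow> 1" for y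
  proof -
    have "(\<lambda>n. exp (- (inverse (real (Suc n)) * inverse y))) \<longlonglongrightarrow> exp (- (0 * inverse y))"
      by (intro tendsto_intros LIMSEQ_inverse_real_of_nat)
    then show ?thesis by (simp add: divide_simps)
  qed
  have "(\<lambda>n. exp (- (1 / (real (Suc n) * (x - a)))) * exp (- (1 / (real (Suc n) * (b - x))))) \<longlonglongrightarrow> 1 * 1"
    by (intro tendsto_mult *)
  moreover have "bump a b n x = exp (- (1 / (real (Suc n) * (x - a)))) * exp (- (1 / (real (Suc n) * (b - x))))" for n
    using True by (simp add: bump_def flat_exp_def)
  ultimately show ?thesis using True by simp
qed (simp add: bump_outside)

lemma test_functions_iff:
  "\<phi> \<in> test_functions I \<longleftrightarrow> smooth \<phi> \<and> compact (closure {x. \<phi> x \<noteq> 0}) \<and> closure {x. \<phi> x \<noteq> 0} \<subseteq> I"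
  by (simp add: test_functions_def smooth_def)

lemma test_functionI:
  assumes "smooth \<phi>" "\<And>x. x \<notin> {a..b} \<Longrightarrow> \<phi> x = 0" "{a..b} \<subseteq> I"
  shows "\<phi> \<in> test_functions I"
proof -
  have "closure {x. \<phi> x \<noteq> 0} \<subseteq> {a..b}"
    by (rule closure_minimal) (use assms(2) in blast, simp)
  then show ?thesis
    using assms unfolding test_functions_iff
    by (meson bounded_closed_interval bounded_subset closed_closure compact_eq_bounded_closed order_trans)
qed

text \<open>
  The compact support is enclosed in a compact interval that is slightly larger, so that the test function
  vanishes at the end points.
\<close>
lemma test_functionE:
  assumes "\<phi> \<in> test_functions I" "open I" "is_interval I" "I \<noteq> {}"
  obtains a b where "a < b" "{a..b} \<subseteq> I" "\<And>x. x \<notin> {a<..<b} \<Longrightarrow> \<phi> x = 0"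
proof -
  define S where "S = closure {x. \<phi> x \<noteq> 0}"
  have S: "compact S" "S \<subseteq> I" "\<And>x. x \<notin> S \<Longrightarrow> \<phi> x = 0"
    using assms(1) closure_subset[of "{x. \<phi> x \<noteq> 0}"] unfolding test_functions_iff S_def by auto
  obtain m where m: "m \<in> I" using assms(4) by blast
  obtain l where l: "l \<in> insert m S" "\<And>x. x \<in> insert m S \<Longrightarrow> l \<le> x"
    using compact_attains_inf[of "insert m S"] S(1) by auto
  obtain r where r: "r \<in> insert m S" "\<And>x. x \<in> insert m S \<Longrightarrow> x \<le> r"
    using compact_attains_sup[of "insert m S"] S(1) by auto
  have "l \<in> I" "r \<in> I" using l r m S by auto
  then obtain e1 e2 where e: "e1 > 0" "cball l e1 \<subseteq> I" "e2 > 0" "cball r e2 \<subseteq> I"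
    using \<open>open I\<close> open_contains_cball by metis
  have ends: "l - e1 \<in> I" "r + e2 \<in> I"
    using e by (auto simp: subset_iff dist_real_def)
  show ?thesis
  proof
    show "l - e1 < r + e2" using e l(2)[OF r(1)] by simp
    show "{l - e1..r + e2} \<subseteq> I"
      using ends assms(3) unfolding is_interval_1 by (meson atLeastAtMost_iff subsetI)
    show "\<phi> x = 0" if "x \<notin> {l - e1<..<r + e2}" for x
      using that S(3)[of x] l(2)[of x] r(2)[of x] e by force
  qed
qed

text \<open>
  The antiderivative of a test function is constant on either side of the support; the two constants agree exactly
  when the integral vanishes. This is how test functions are recognised as derivatives of test functions.
\<close>
lemma antiderivative_test_function:
  assumes "smooth \<psi>" "\<And>x. x \<notin> {a..b} \<Longrightarrow> \<psi> x = 0" "{a..b} \<subseteq> I" "a \<le> b"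
    and "integral {a..b} \<psi> = 0"
  obtains \<phi> where "\<phi> \<in> test_functions I" "deriv \<phi> = \<psi>"
proof -
  obtain \<Psi> where \<Psi>: "\<And>x. (\<Psi> has_real_derivative \<psi> x) (at x)"
    using einterval_antiderivative[of "-\<infinity>" \<infinity> \<psi>] smooth_isCont[OF assms(1)]
    by (auto simp: has_real_derivative_iff_has_vector_derivative)
  have int: "(\<psi> has_integral (\<Psi> y - \<Psi> x)) {x..y}" if "x \<le> y" for x y
    using that \<Psi> by (intro fundamental_theorem_of_calculus)
      (auto simp: has_real_derivative_iff_has_vector_derivative intro: has_vector_derivative_at_within)
  define \<phi> where "\<phi> x = \<Psi> x - \<Psi> a" for x
  have d: "(\<phi> has_real_derivative \<psi> x) (at x)" for x
    unfolding \<phi>_def using \<Psi>[of x] by (auto intro!: derivative_eq_intros)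
  then have dd: "deriv \<phi> = \<psi>" by (intro ext DERIV_imp_deriv)
  have "smooth \<phi>"
  proof (subst smooth_iff_deriv, intro conjI allI)
    show "\<phi> differentiable (at x)" for x
      using d[of x] real_differentiable_def by blast
  qed (use dd assms(1) in simp)
  moreover have "\<phi> x = 0" if "x \<notin> {a..b}" for x
  proof (cases "x < a")
    case True
    have "(\<psi> has_integral 0) {x..a}"
      by (rule has_integral_spike_finite[of "{a}" _ _ "\<lambda>x. 0"]) (use assms(2) in auto)
    then have "\<Psi> a - \<Psi> x = 0"
      using True by (intro has_integral_unique[OF int[of x a]]) auto
    then show ?thesis by (simp add: \<phi>_def)
  next
    case False
    have "(\<psi> has_integral 0) {b..x}"
      by (rule has_integral_spike_finite[of "{b}" _ _ "\<lambda>x. 0"]) (use assms(2) \<open>a \<le> b\<close> in auto)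
    then have "\<Psi> x - \<Psi> b = 0"
      using False that by (intro has_integral_unique[OF int[of b x]]) auto
    moreover have "\<Psi> b - \<Psi> a = 0"
      using int[OF \<open>a \<le> b\<close>] assms(5) by (simp add: has_integral_iff)
    ultimately show ?thesis by (simp add: \<phi>_def)
  qed
  ultimately show ?thesis using that dd assms(3) by (blast intro: test_functionI)
qed

section \<open>Locally absolutely continuous functions\<close>

text \<open>
  The fundamental theorem of calculus taken as a definition: for an interval \<open>J\<close> this says that \<open>F\<close> is locally
  absolutely continuous with derivative \<open>f\<close>. Only compact subintervals are tested, so \<open>f\<close> need not be
  integrable on an unbounded \<open>J\<close>.
\<close>
definition primitive_on ::
    "real set \<Rightarrow> (real \<Rightarrow> 'a::{euclidean_space,real_normed_field}) \<Rightarrow> (real \<Rightarrow> 'a) \<Rightarrow> bool" where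
  "primitive_on J F f \<longleftrightarrow> (\<forall>a b. a \<le> b \<longrightarrow> {a..b} \<subseteq> J \<longrightarrow>
     f absolutely_integrable_on {a..b} \<and> integral {a..b} f = F b - F a)"

lemma primitive_onD:
  assumes "primitive_on J F f" "a \<le> b" "{a..b} \<subseteq> J"
  shows "f absolutely_integrable_on {a..b}" "f integrable_on {a..b}" "integral {a..b} f = F b - F a"
  using assms unfolding primitive_on_def absolutely_integrable_on_def by auto

lemma primitive_on_subset: "primitive_on J F f \<Longrightarrow> K \<subseteq> J \<Longrightarrow> primitive_on K F f"
  unfolding primitive_on_def by blast

lemma primitive_on_cong:
  assumes "primitive_on J F f" "\<And>x. x \<in> J \<Longrightarrow> F x = G x" "negligible N"
    "\<And>x. x \<in> J - N \<Longrightarrow> f x = g x"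
  shows "primitive_on J G g"
  unfolding primitive_on_def
proof (intro allI impI)
  fix a b :: real assume ab: "a \<le> b" "{a..b} \<subseteq> J"
  have fg: "\<And>x. x \<in> {a..b} - N \<Longrightarrow> g x = f x"
    using assms(4) ab(2) by auto
  have "g absolutely_integrable_on {a..b}"
    using absolutely_integrable_spike[OF primitive_onD(1)[OF assms(1) ab] assms(3) fg] .
  moreover have "integral {a..b} g = integral {a..b} f"
    by (rule integral_spike[OF assms(3), symmetric]) (rule fg)
  moreover have "a \<in> J" "b \<in> J"
    using ab by auto
  ultimately show "g absolutely_integrable_on {a..b} \<and> integral {a..b} g = G b - G a"
    using primitive_onD(3)[OF assms(1) ab] assms(2) by auto
qed

lemma primitive_on_eq:
  assumes "primitive_on J F f" "\<And>x. x \<in> J \<Longrightarrow> F x = G x" "\<And>x. x \<in> J \<Longrightarrow> f x = g x"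
  shows "primitive_on J G g"
  by (rule primitive_on_cong[OF assms(1,2), of "{}"]) (use assms(3) in auto)

lemma primitive_on_add:
  assumes "primitive_on J F f" "primitive_on J G g"
  shows "primitive_on J (\<lambda>x. F x + G x) (\<lambda>x. f x + g x)"
  unfolding primitive_on_def
  using primitive_onD[OF assms(1)] primitive_onD[OF assms(2)]
  by (auto simp: integral_add)

lemma primitive_on_cmult:
  assumes "primitive_on J F f"
  shows "primitive_on J (\<lambda>x. c * F x) (\<lambda>x. c * f x)"
  unfolding primitive_on_def
proof (intro allI impI conjI)
  fix a b :: real assume ab: "a \<le> b" "{a..b} \<subseteq> J"
  show "(\<lambda>x. c * f x) absolutely_integrable_on {a..b}"
    using primitive_onD(1)[OF assms ab] by (rule set_integrable_mult_right)
  show "integral {a..b} (\<lambda>x. c * f x) = c * F b - c * F a"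
    using primitive_onD(3)[OF assms ab] by (simp add: integral_mult_right flip: right_diff_distrib)
qed

lemma primitive_on_diff:
  assumes "primitive_on J F f" "primitive_on J G g"
  shows "primitive_on J (\<lambda>x. F x - G x) (\<lambda>x. f x - g x)"
  using primitive_on_add[OF assms(1) primitive_on_cmult[OF assms(2), of "-1"]] by simp

lemma primitive_on_const: "primitive_on J (\<lambda>x. c) (\<lambda>x. 0)"
  by (simp add: primitive_on_def)

lemma primitive_on_ftc:
  assumes "\<And>x. x \<in> J \<Longrightarrow> (F has_vector_derivative f x) (at x within J)" "continuous_on J f"
  shows "primitive_on J F f"
  unfolding primitive_on_def
proof (intro allI impI conjI)
  fix a b :: real assume ab: "a \<le> b" "{a..b} \<subseteq> J"
  show "f absolutely_integrable_on {a..b}"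
    using absolutely_integrable_continuous_real continuous_on_subset[OF assms(2) ab(2)] by blast
  have "(F has_vector_derivative f x) (at x within {a..b})" if "x \<in> {a..b}" for x
    using has_vector_derivative_within_subset[OF assms(1) ab(2)] ab(2) that by blast
  then have "(f has_integral F b - F a) {a..b}"
    using ab(1) by (intro fundamental_theorem_of_calculus)
  then show "integral {a..b} f = F b - F a" by blast
qed

text \<open>
  A point of a closed interval has a compact interval as a relative neighbourhood. Continuity on a possibly unbounded
  interval follows from continuity on compact ones.
\<close>
lemma closed_interval_nhd:
  assumes "is_interval J" "closed J" "x \<in> (J :: real set)"
  obtains a b where "a \<le> b" "{a..b} \<subseteq> J" "x \<in> {a..b}" "at x within {a..b} = at x within J"
proof -
  define K where "K = J \<inter> cball x 1"
  have "compact K" unfolding K_def using assms(2) by (intro closed_Int_compact) auto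
  moreover have "connected K"
    unfolding K_def using assms(1) by (metis is_interval_Int is_interval_cball_1 is_interval_connected_1)
  ultimately obtain a b where ab: "K = {a..b}"
    by (metis connected_compact_interval_1)
  have "at x within K = at x within J"
    by (rule at_within_nhd[of x "ball x 1"]) (auto simp: K_def)
  moreover have "x \<in> K" "K \<subseteq> J" using assms(3) by (auto simp: K_def)
  ultimately show ?thesis using that[of a b] ab by auto
qed

lemma primitive_on_continuous:
  assumes "primitive_on J F f" "is_interval J" "closed J"
  shows "continuous_on J F"
  unfolding continuous_on_eq_continuous_within
proof
  fix x assume "x \<in> J"
  then obtain a b where ab: "a \<le> b" "{a..b} \<subseteq> J" "x \<in> {a..b}" "at x within {a..b} = at x within J"
    using closed_interval_nhd[OF assms(2,3)] by blast
  have "continuous_on {a..b} (\<lambda>y. F a + integral {a..y} f)"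
    by (intro continuous_intros indefinite_integral_continuous_1 primitive_onD(2)[OF assms(1) ab(1,2)])
  moreover have "F a + integral {a..y} f = F y" if "y \<in> {a..b}" for y
    using primitive_onD(3)[OF assms(1), of a y] that ab(2) by force
  ultimately have "continuous_on {a..b} F"
    by (rule continuous_on_eq)
  then show "continuous (at x within J) F"
    using ab(3) unfolding continuous_on_eq_continuous_within continuous_within ab(4)[symmetric] by blast
qed

text \<open>
  Cut \<open>[a,b]\<close> into \<open>n\<close> equal pieces and add up the increments: the total increment is at most
  \<open>e (\<Phi> b - \<Phi> a)\<close> for every positive \<open>e\<close>. This replaces differentiation almost everywhere in the proof of the
  product rule.
\<close>
lemma constant_if_small_increments:
  fixes K :: "real \<Rightarrow> 'a::real_normed_vector" and \<Phi> :: "real \<Rightarrow> real"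
  assumes "a \<le> b"
    and small: "\<And>e. e > 0 \<Longrightarrow> \<exists>d>0. \<forall>x y. a \<le> x \<and> x \<le> y \<and> y \<le> b \<and> y - x < d \<longrightarrow>
        norm (K y - K x) \<le> e * (\<Phi> y - \<Phi> x)"
  shows "K b = K a"
proof (rule ccontr)
  assume "K b \<noteq> K a"
  define r where "r = norm (K b - K a)"
  have r: "r > 0" using \<open>K b \<noteq> K a\<close> by (simp add: r_def)
  define D where "D = \<bar>\<Phi> b - \<Phi> a\<bar> + 1"
  have D: "D > 0" unfolding D_def by linarith
  \<comment> \<open>chosen so that the summed estimate reads \<open>r \<le> r / 2\<close>; the \<open>+ 1\<close> in \<open>D\<close> makes the denominator positive\<close>
  define e where "e = r / (2 * D)"
  have e: "e > 0" unfolding e_def using r D by simp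
  obtain d where d: "d > 0" and small_d: "\<And>x y. a \<le> x \<Longrightarrow> x \<le> y \<Longrightarrow> y \<le> b \<Longrightarrow> y - x < d \<Longrightarrow>
        norm (K y - K x) \<le> e * (\<Phi> y - \<Phi> x)"
    using small[OF e] by blast
  obtain n where n: "(b - a) / d < real n"
    using reals_Archimedean2 by blast
  then have n0: "n > 0" using d \<open>a \<le> b\<close> by (metis divide_nonneg_pos diff_ge_0_iff_ge gr0I not_le of_nat_0)
  define h where "h = (b - a) / n"
  have h: "0 \<le> h" "h < d"
    using n n0 d \<open>a \<le> b\<close> by (auto simp: h_def field_simps)
  have hn: "a + real n * h = b" using n0 by (simp add: h_def)
  have "norm (K (a + real j * h) - K a) \<le> e * (\<Phi> (a + real j * h) - \<Phi> a)" if "j \<le> n" for j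
    using that
  proof (induction j)
    case (Suc j)
    have "real (Suc j) * h \<le> real n * h"
      using Suc.prems h by (intro mult_right_mono) auto
    then have "norm (K (a + real (Suc j) * h) - K (a + real j * h))
        \<le> e * (\<Phi> (a + real (Suc j) * h) - \<Phi> (a + real j * h))"
      using h hn by (intro small_d) (auto simp: algebra_simps)
    moreover have "norm (K (a + real j * h) - K a) \<le> e * (\<Phi> (a + real j * h) - \<Phi> a)"
      using Suc by simp
    ultimately have "norm (K (a + real (Suc j) * h) - K (a + real j * h)) + norm (K (a + real j * h) - K a)
        \<le> e * (\<Phi> (a + real (Suc j) * h) - \<Phi> a)"
      by (simp add: algebra_simps)
    moreover have "norm (K (a + real (Suc j) * h) - K a)
        \<le> norm (K (a + real (Suc j) * h) - K (a + real j * h)) + norm (K (a + real j * h) - K a)"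
      by (metis diff_add_cancel add_diff_eq norm_triangle_ineq)
    ultimately show ?case by linarith
  qed simp
  from this[of n] have "r \<le> e * (\<Phi> b - \<Phi> a)"
    by (simp add: hn r_def)
  also have "\<dots> \<le> e * D"
    using e unfolding D_def by (intro mult_left_mono) auto
  also have "\<dots> = r / 2"
    using D by (simp add: e_def)
  finally show False using r by simp
qed

lemma absolutely_integrable_mult_continuous:
  fixes f g :: "real \<Rightarrow> 'a::{euclidean_space,real_normed_field}"
  assumes "continuous_on {a..b} f" "g absolutely_integrable_on {a..b}"
  shows "(\<lambda>x. f x * g x) absolutely_integrable_on {a..b}"
  by (rule absolutely_integrable_bounded_measurable_product[OF bilinear_times _ _ _ assms(2)])
    (use assms(1) in \<open>auto intro: continuous_imp_measurable_on_sets_lebesgue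
        intro!: compact_imp_bounded[OF compact_continuous_image[OF assms(1) compact_Icc]]\<close>)

text \<open>
  The product rule, equivalently integration by parts, when one factor is only absolutely continuous. The function
  \<open>K x = e x F x - \<integral>\<^sub>a\<^sup>x (e' F + e f)\<close> satisfies
  \<open>K y - K x = \<integral>\<^sub>x\<^sup>y (e' t (F y - F t) + (e x - e t) f t) dt\<close>,
  which is small relative to \<open>\<integral>\<^sub>x\<^sup>y (M + \<bar>f\<bar>)\<close> by uniform continuity of \<open>e\<close> and \<open>F\<close>; hence \<open>K\<close> is constant.
\<close>
lemma primitive_on_mult_C1:
  fixes e e' :: "real \<Rightarrow> 'a::{euclidean_space,real_normed_field}"
  assumes F: "primitive_on J F f" and "is_interval J" "closed J"
    and e: "\<And>x. x \<in> J \<Longrightarrow> (e has_vector_derivative e' x) (at x within J)" and "continuous_on J e'"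
  shows "primitive_on J (\<lambda>x. e x * F x) (\<lambda>x. e' x * F x + e x * f x)"
  unfolding primitive_on_def
proof (intro allI impI)
  fix a b :: real assume ab: "a \<le> b" "{a..b} \<subseteq> J"
  have contF: "continuous_on {a..b} F"
    using primitive_on_continuous[OF assms(1-3)] continuous_on_subset ab(2) by blast
  have cont_e': "continuous_on {a..b} e'"
    using assms(5) continuous_on_subset ab(2) by blast
  have e_prim: "primitive_on {a..b} e e'"
    using primitive_on_subset[OF primitive_on_ftc[OF e assms(5)] ab(2)] .
  have cont_e: "continuous_on {a..b} e"
    by (rule primitive_on_continuous[OF e_prim]) (auto simp: is_interval_cc)
  have f: "f absolutely_integrable_on {a..b}"
    using primitive_onD(1)[OF F ab] .
  let ?g = "\<lambda>x. e' x * F x + e x * f x"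
  have "(\<lambda>x. e x * f x) absolutely_integrable_on {a..b}"
    by (rule absolutely_integrable_mult_continuous[OF cont_e f])
  moreover have "(\<lambda>x. e' x * F x) absolutely_integrable_on {a..b}"
    using cont_e' contF by (intro absolutely_integrable_continuous_real continuous_intros)
  ultimately have g: "?g absolutely_integrable_on {a..b}"
    by (rule set_integral_add(1)[rotated])
  have sub: "h integrable_on {x..y}" if "h absolutely_integrable_on {a..b}" "a \<le> x" "y \<le> b" 
    for h :: "real \<Rightarrow> 'a" and x y
    using that integrable_subinterval_real[of h a b x y] by (auto simp: absolutely_integrable_on_def)
  have "bounded (e' ` {a..b})"
    using compact_continuous_image[OF cont_e'] by (simp add: compact_imp_bounded)
  then obtain M where M: "\<And>x. x \<in> {a..b} \<Longrightarrow> norm (e' x) \<le> M"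
    unfolding bounded_iff by blast
  define \<Phi> where "\<Phi> x = integral {a..x} (\<lambda>t. M + norm (f t))" for x
  have \<Phi>_int: "(\<lambda>t. M + norm (f t)) integrable_on {a..b}"
    using f by (intro integrable_add) (auto simp: absolutely_integrable_on_def)
  define K where "K x = e x * F x - integral {a..x} ?g" for x
  have "K b = K a"
  proof (rule constant_if_small_increments[OF ab(1), of K \<Phi>])
    fix \<epsilon> :: real assume "\<epsilon> > 0"
    have "uniformly_continuous_on {a..b} F" "uniformly_continuous_on {a..b} e"
      using contF cont_e by (auto intro: compact_uniformly_continuous)
    then obtain d1 d2 where d: "d1 > 0" "d2 > 0"
      "\<And>x y. x \<in> {a..b} \<Longrightarrow> y \<in> {a..b} \<Longrightarrow> dist y x < d1 \<Longrightarrow> dist (F y) (F x) < \<epsilon>"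
      "\<And>x y. x \<in> {a..b} \<Longrightarrow> y \<in> {a..b} \<Longrightarrow> dist y x < d2 \<Longrightarrow> dist (e y) (e x) < \<epsilon>"
      unfolding uniformly_continuous_on_def using \<open>\<epsilon> > 0\<close> by metis
    show "\<exists>d>0. \<forall>x y. a \<le> x \<and> x \<le> y \<and> y \<le> b \<and> y - x < d \<longrightarrow> norm (K y - K x) \<le> \<epsilon> * (\<Phi> y - \<Phi> x)"
    proof (intro exI[of _ "min d1 d2"] conjI allI impI)
      fix x y assume xy: "a \<le> x \<and> x \<le> y \<and> y \<le> b \<and> y - x < min d1 d2"
      then have xyJ: "{x..y} \<subseteq> J" "{x..y} \<subseteq> {a..b}" using ab(2) by auto
      have eq: "integral {x..y} (\<lambda>t. e' t * F y + e x * f t) = (e y - e x) * F y + e x * (F y - F x)"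
        using primitive_onD(2,3)[OF F _ xyJ(1)] primitive_onD(2,3)[OF e_prim _ xyJ(2)] xy
        by (subst integral_add) (auto intro: integrable_on_mult_left integrable_on_mult_right)
      have "integral {a..x} ?g + integral {x..y} ?g = integral {a..y} ?g"
        using xy by (intro Henstock_Kurzweil_Integration.integral_combine sub[OF g]) auto
      then have "K y - K x = integral {x..y} (\<lambda>t. e' t * F y + e x * f t) - integral {x..y} ?g"
        unfolding eq K_def by (simp add: algebra_simps)
      also have "\<dots> = integral {x..y} (\<lambda>t. (e' t * F y + e x * f t) - ?g t)"
        using xy primitive_onD(2)[OF F _ xyJ(1)] primitive_onD(2)[OF e_prim _ xyJ(2)]
        by (intro integral_diff[symmetric] sub[OF g] integrable_add integrable_on_mult_left integrable_on_mult_right) auto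
      also have "norm \<dots> \<le> integral {x..y} (\<lambda>t. \<epsilon> * (M + norm (f t)))"
      proof (rule integral_norm_bound_integral)
        show "(\<lambda>t. e' t * F y + e x * f t - (e' t * F t + e t * f t)) integrable_on {x..y}"
          using xy primitive_onD(2)[OF F _ xyJ(1)] primitive_onD(2)[OF e_prim _ xyJ(2)]
          by (intro integrable_diff sub[OF g] integrable_add integrable_on_mult_left integrable_on_mult_right) auto
        show "(\<lambda>t. \<epsilon> * (M + norm (f t))) integrable_on {x..y}"
          using xy by (intro integrable_on_mult_right integrable_subinterval_real[OF \<Phi>_int]) auto
        fix t assume t: "t \<in> {x..y}"
        have "norm (F y - F t) \<le> \<epsilon>" "norm (e x - e t) \<le> \<epsilon>"
          using d(3)[of t y] d(4)[of t x] t xy by (auto simp: dist_norm less_imp_le)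
        then have "norm (e' t) * norm (F y - F t) \<le> M * \<epsilon>" "norm (e x - e t) * norm (f t) \<le> \<epsilon> * norm (f t)"
          using M[of t] t xy \<open>\<epsilon> > 0\<close> by (auto intro!: mult_mono order_trans[OF norm_ge_zero M])
        moreover have "e' t * F y + e x * f t - (e' t * F t + e t * f t) = e' t * (F y - F t) + (e x - e t) * f t"
          by (simp add: algebra_simps)
        moreover have "norm (e' t * (F y - F t) + (e x - e t) * f t)
            \<le> norm (e' t) * norm (F y - F t) + norm (e x - e t) * norm (f t)"
          using norm_triangle_ineq[of "e' t * (F y - F t)" "(e x - e t) * f t"] by (simp only: norm_mult)
        moreover have "\<epsilon> * (M + norm (f t)) = M * \<epsilon> + \<epsilon> * norm (f t)"
          by (simp add: algebra_simps)
        ultimately show "norm (e' t * F y + e x * f t - (e' t * F t + e t * f t)) \<le> \<epsilon> * (M + norm (f t))"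
          by simp
      qed
      also have "\<dots> = \<epsilon> * (\<Phi> y - \<Phi> x)"
      proof -
        have "integral {a..x} (\<lambda>t. M + norm (f t)) + integral {x..y} (\<lambda>t. M + norm (f t)) = integral {a..y} (\<lambda>t. M + norm (f t))"
          using xy by (intro Henstock_Kurzweil_Integration.integral_combine integrable_subinterval_real[OF \<Phi>_int]) auto
        then have "integral {x..y} (\<lambda>t. M + norm (f t)) = \<Phi> y - \<Phi> x"
          by (simp add: \<Phi>_def algebra_simps)
        then show ?thesis by (simp only: integral_mult_right)
      qed
      finally show "norm (K y - K x) \<le> \<epsilon> * (\<Phi> y - \<Phi> x)" .
    qed (use d in auto)
  qed
  then show "?g absolutely_integrable_on {a..b} \<and> integral {a..b} ?g = e b * F b - e a * F a"
    using g by (simp add: K_def eq_diff_eq diff_eq_eq add.commute)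
qed

section \<open>Square integrable functions on a set\<close>

lemma AE_lebesgue_on_iff_negligible:
  assumes "S \<in> sets lebesgue"
  shows "(AE x in lebesgue_on S. P x) \<longleftrightarrow> negligible {x\<in>S. \<not> P x}"
  using assms
  by (simp add: AE_restrict_space_iff completion.AE_iff_null_sets negligible_iff_null_sets)

lemma integrable_lebesgue_on_iff:
  fixes f :: "real \<Rightarrow> 'a::euclidean_space"
  assumes "S \<in> sets lebesgue"
  shows "integrable (lebesgue_on S) f \<longleftrightarrow> f absolutely_integrable_on S"
  using assms by (simp add: integrable_restrict_space set_integrable_def)

lemma integral_lebesgue_on_eq:
  fixes f :: "real \<Rightarrow> 'a::euclidean_space"
  assumes "S \<in> sets lebesgue" "f absolutely_integrable_on S"
  shows "integral\<^sup>L (lebesgue_on S) f = integral S f"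
  using assms by (intro lebesgue_integral_eq_integral) (auto simp: integrable_lebesgue_on_iff)

text \<open>
  The square of the \<open>L\<^sup>2\<close> norm, as a Henstock-Kurzweil integral so that it can be combined with \<open>primitive_on\<close>.
\<close>
definition sq_norm :: "real set \<Rightarrow> (real \<Rightarrow> complex) \<Rightarrow> real" where
  "sq_norm I f = integral I (\<lambda>x. (cmod (f x))\<^sup>2)"

lemma L2_on_iff:
  assumes "I \<in> sets lebesgue"
  shows "f \<in> L2_on I \<longleftrightarrow> f \<in> borel_measurable (lebesgue_on I) \<and> (\<lambda>x. (cmod (f x))\<^sup>2) absolutely_integrable_on I"
  by (simp add: L2_on_def integrable_lebesgue_on_iff assms)

lemma L2_on_integrable:
  assumes "I \<in> sets lebesgue" "f \<in> L2_on I"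
  shows "(\<lambda>x. (cmod (f x))\<^sup>2) integrable_on I"
  using assms by (auto simp: L2_on_iff absolutely_integrable_on_def)

lemma sq_norm_eq:
  assumes "I \<in> sets lebesgue" "f \<in> L2_on I"
  shows "integral\<^sup>L (lebesgue_on I) (\<lambda>x. (cmod (f x))\<^sup>2) = sq_norm I f"
  using assms by (auto simp: L2_on_iff sq_norm_def integral_lebesgue_on_eq)

lemma sq_norm_nonneg: "sq_norm I f \<ge> 0"
  unfolding sq_norm_def by (cases "(\<lambda>x. (cmod (f x))\<^sup>2) integrable_on I")
    (auto simp: not_integrable_integral intro: integral_nonneg)

lemma L2_on_bound:
  assumes I: "I \<in> sets lebesgue" and "f \<in> borel_measurable (lebesgue_on I)"
    and h: "h integrable_on I" "\<And>x. x \<in> I \<Longrightarrow> (cmod (f x))\<^sup>2 \<le> h x"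
  shows "f \<in> L2_on I" "sq_norm I f \<le> integral I h"
proof -
  have [measurable]: "f \<in> borel_measurable (lebesgue_on I)" by fact
  have "(\<lambda>x. (cmod (f x))\<^sup>2) absolutely_integrable_on I"
    by (rule measurable_bounded_by_integrable_imp_absolutely_integrable[OF _ I h(1)])
      (use h(2) in auto)
  then show "f \<in> L2_on I" "sq_norm I f \<le> integral I h"
    using assms by (auto simp: L2_on_iff sq_norm_def absolutely_integrable_on_def intro!: integral_le)
qed

lemma cmod_add_square_le: "(cmod (x + y))\<^sup>2 \<le> 2 * (cmod x)\<^sup>2 + 2 * (cmod y)\<^sup>2"
proof -
  have "(cmod (x + y))\<^sup>2 \<le> (cmod x + cmod y)\<^sup>2"
    by (intro power_mono norm_triangle_ineq) auto
  then show ?thesis using sum_squares_bound[of "cmod x" "cmod y"] by (simp add: power2_sum)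
qed

lemma L2_on_add:
  assumes I: "I \<in> sets lebesgue" and f: "f \<in> L2_on I" and g: "g \<in> L2_on I"
  shows "(\<lambda>x. f x + g x) \<in> L2_on I" "sq_norm I (\<lambda>x. f x + g x) \<le> 2 * sq_norm I f + 2 * sq_norm I g"
proof -
  have m: "(\<lambda>x. f x + g x) \<in> borel_measurable (lebesgue_on I)"
    using f g I by (auto simp: L2_on_iff)
  have int: "(\<lambda>x. 2 * (cmod (f x))\<^sup>2 + 2 * (cmod (g x))\<^sup>2) integrable_on I"
    using L2_on_integrable[OF I f] L2_on_integrable[OF I g]
    by (intro integrable_add integrable_on_mult_right)
  have eq: "integral I (\<lambda>x. 2 * (cmod (f x))\<^sup>2 + 2 * (cmod (g x))\<^sup>2) = 2 * sq_norm I f + 2 * sq_norm I g"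
    using L2_on_integrable[OF I f] L2_on_integrable[OF I g]
    by (simp add: integral_add sq_norm_def)
  show "(\<lambda>x. f x + g x) \<in> L2_on I" "sq_norm I (\<lambda>x. f x + g x) \<le> 2 * sq_norm I f + 2 * sq_norm I g"
    using L2_on_bound[OF I m int] cmod_add_square_le by (auto simp: eq)
qed

lemma L2_on_bounded_mult:
  assumes I: "I \<in> sets lebesgue" and f: "f \<in> L2_on I" and h: "h \<in> borel_measurable (lebesgue_on I)"
    and B: "\<And>x. x \<in> I \<Longrightarrow> cmod (h x) \<le> B"
  shows "(\<lambda>x. h x * f x) \<in> L2_on I" "sq_norm I (\<lambda>x. h x * f x) \<le> B\<^sup>2 * sq_norm I f"
proof -
  have m: "(\<lambda>x. h x * f x) \<in> borel_measurable (lebesgue_on I)"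
    using f h I by (auto simp: L2_on_iff)
  have int: "(\<lambda>x. B\<^sup>2 * (cmod (f x))\<^sup>2) integrable_on I"
    using L2_on_integrable[OF I f] by (intro integrable_on_mult_right)
  have "(cmod (h x * f x))\<^sup>2 \<le> B\<^sup>2 * (cmod (f x))\<^sup>2" if "x \<in> I" for x
    unfolding norm_mult power_mult_distrib
    using B[OF that] by (intro mult_right_mono power_mono) auto
  from L2_on_bound[OF I m int this]
  show "(\<lambda>x. h x * f x) \<in> L2_on I" "sq_norm I (\<lambda>x. h x * f x) \<le> B\<^sup>2 * sq_norm I f"
    by (auto simp: sq_norm_def)
qed

lemma L2_on_cmult:
  assumes "I \<in> sets lebesgue" "f \<in> L2_on I"
  shows "(\<lambda>x. c * f x) \<in> L2_on I" "sq_norm I (\<lambda>x. c * f x) \<le> (cmod c)\<^sup>2 * sq_norm I f"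
  using L2_on_bounded_mult[OF assms, of "\<lambda>x. c" "cmod c"] by auto

lemma L2_on_diff:
  assumes I: "I \<in> sets lebesgue" and f: "f \<in> L2_on I" and g: "g \<in> L2_on I"
  shows "(\<lambda>x. f x - g x) \<in> L2_on I"
  using L2_on_add(1)[OF I f L2_on_cmult(1)[OF I g, of "-1"]] by simp

lemma L2_on_cong_AE:
  assumes I: "I \<in> sets lebesgue" and f: "f \<in> L2_on I"
    and g: "AE x in lebesgue_on I. f x = g x"
  shows "g \<in> L2_on I"
proof -
  have "(\<lambda>x. if x \<in> I then f x else 0) \<in> borel_measurable lebesgue"
    using f I by (auto simp: L2_on_iff borel_measurable_if)
  moreover have "AE x in lebesgue. (if x \<in> I then f x else 0) = (if x \<in> I then g x else 0)"
    using g I by (auto simp: AE_restrict_space_iff)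
  ultimately have "(\<lambda>x. if x \<in> I then g x else 0) \<in> borel_measurable lebesgue"
    by (rule borel_measurable_AE)
  then have m: "g \<in> borel_measurable (lebesgue_on I)"
    using I by (auto simp: borel_measurable_if)
  have N: "negligible {x\<in>I. f x \<noteq> g x}"
    using g I by (simp add: AE_lebesgue_on_iff_negligible)
  have "(\<lambda>x. (cmod (f x))\<^sup>2) absolutely_integrable_on I"
    using f I by (simp add: L2_on_iff)
  from absolutely_integrable_spike[OF this N]
  have "(\<lambda>x. (cmod (g x))\<^sup>2) absolutely_integrable_on I"
    by auto
  then show ?thesis using m I by (simp add: L2_on_iff)
qed

lemma sq_norm_cong_AE:
  assumes I: "I \<in> sets lebesgue" and g: "AE x in lebesgue_on I. f x = g x"
  shows "sq_norm I f = sq_norm I g"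
proof -
  have N: "negligible {x\<in>I. f x \<noteq> g x}"
    using g I by (simp add: AE_lebesgue_on_iff_negligible)
  show ?thesis unfolding sq_norm_def
    by (rule integral_spike[OF N]) auto
qed

text \<open>
  On a bounded interval the pointwise bound \<open>\<bar>f\<bar> \<le> 1 + \<bar>f\<bar>\<^sup>2\<close> makes a square integrable function integrable. End points
  of the interval may lie outside \<open>I\<close>; they form a null set.
\<close>
lemma L2_on_absolutely_integrable:
  assumes I: "I \<in> sets lebesgue" and f: "f \<in> L2_on I"
    and ab: "negligible ({a..b} - I)"
  shows "f absolutely_integrable_on {a..b}"
proof -
  let ?S = "{a..b} \<inter> I"
  have S: "?S \<in> sets lebesgue" using I by auto
  have "{a..b} \<in> lmeasurable" by simp
  then have S': "?S \<in> lmeasurable" using I fmeasurable_Int_fmeasurable by blast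
  have "f \<in> borel_measurable (lebesgue_on ?S)"
    using f I by (auto simp: L2_on_iff intro: measurable_restrict_mono)
  moreover have "(\<lambda>x. (cmod (f x))\<^sup>2) absolutely_integrable_on ?S"
    using f I S by (auto simp: L2_on_iff intro: set_integrable_subset)
  then have "(\<lambda>x. 1 + (cmod (f x))\<^sup>2) integrable_on ?S"
    using S' by (intro integrable_add) (auto simp: absolutely_integrable_on_def integrable_on_const)
  moreover have "cmod (f x) \<le> 1 + (cmod (f x))\<^sup>2" for x
    using sum_squares_bound[of 1 "cmod (f x)"] norm_ge_zero[of "f x"]
    by (simp del: norm_ge_zero)
  ultimately have "f absolutely_integrable_on ?S"
    using measurable_bounded_by_integrable_imp_absolutely_integrable[OF _ S] by blast
  moreover have "negligible {x \<in> ?S - {a..b}. f x \<noteq> 0}" "negligible {x \<in> {a..b} - ?S. f x \<noteq> 0}"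
    by (rule negligible_subset[OF ab]; auto)+
  ultimately show ?thesis
    using absolutely_integrable_spike_set_eq by blast
qed

section \<open>Weak derivatives and Sobolev functions on an open interval\<close>

locale open_interval =
  fixes I :: "real set"
  assumes open_I: "open I" and is_interval_I: "is_interval I" and nonempty_I: "I \<noteq> {}"
begin

lemma lebesgue_I: "I \<in> sets lebesgue"
  using open_I by (simp add: borel_open sets_completionI_sets)

lemma AE_in_I: "AE x in lebesgue_on I. x \<in> I"
  using AE_space[of "lebesgue_on I"] by (simp add: space_restrict_space)

lemma is_interval_closure_I: "is_interval (closure I)"
  using is_interval_I by (metis is_interval_convex_1 convex_closure)

lemma negligible_boundary: "negligible (closure I - I)"
proof -
  have "convex I" using is_interval_I by (simp add: is_interval_convex_1)
  moreover have "closure I - I = frontier I"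
    using open_I by (simp add: frontier_def interior_open)
  ultimately show ?thesis by (simp add: negligible_convex_frontier)
qed

lemma negligible_Icc_minus: "{a..b} \<subseteq> closure I \<Longrightarrow> negligible ({a..b} - I)"
  by (rule negligible_subset[OF negligible_boundary]) auto

lemma Icc_subset: "a \<in> I \<Longrightarrow> b \<in> I \<Longrightarrow> {a..b} \<subseteq> I"
  using is_interval_I unfolding is_interval_1 by (meson atLeastAtMost_iff subsetI)

lemma Icc_subset_closure: "a \<in> closure I \<Longrightarrow> b \<in> closure I \<Longrightarrow> {a..b} \<subseteq> closure I"
  using is_interval_closure_I unfolding is_interval_1 by (meson atLeastAtMost_iff subsetI)

lemma primitive_on_continuous_closure: "primitive_on (closure I) F f \<Longrightarrow> continuous_on (closure I) F"
  using primitive_on_continuous is_interval_closure_I by blast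

lemma L2_on_local:
  "f \<in> L2_on I \<Longrightarrow> {a..b} \<subseteq> closure I \<Longrightarrow> f absolutely_integrable_on {a..b}"
  using L2_on_absolutely_integrable lebesgue_I negligible_Icc_minus by blast

text \<open>
  The set where the two functions differ is relatively open in the open set \<open>I\<close>, and a nonempty open set is not null.
  Equality extends to the closure by continuity.
\<close>
lemma continuous_AE_eq:
  fixes F G :: "real \<Rightarrow> complex"
  assumes "continuous_on (closure I) F" "continuous_on (closure I) G"
    and "AE x in lebesgue_on I. F x = G x" "x \<in> closure I"
  shows "F x = G x"
proof -
  have N: "negligible {x\<in>I. F x \<noteq> G x}"
    using assms(3) lebesgue_I by (simp add: AE_lebesgue_on_iff_negligible)
  have "continuous_on I (\<lambda>x. F x - G x)"
    using assms(1,2) closure_subset by (intro continuous_intros) (auto intro: continuous_on_subset)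
  then have "open (I \<inter> (\<lambda>x. F x - G x) -` (- {0}))"
    using open_I by (intro continuous_open_preimage) auto
  moreover have "I \<inter> (\<lambda>x. F x - G x) -` (- {0}) = {x\<in>I. F x \<noteq> G x}" by auto
  ultimately have "{x\<in>I. F x \<noteq> G x} = {}"
    using N open_not_negligible by metis
  then have "F y - G y = 0" if "y \<in> I" for y using that by auto
  from continuous_constant_on_closure[OF continuous_on_diff[OF assms(1,2)] this assms(4)]
  show ?thesis by simp
qed

lemma boundary_value_eq:
  assumes "continuous_on (closure I) F" "AE x in lebesgue_on I. f x = F x" "a \<in> closure I"
  shows "boundary_value I f a = F a"
  unfolding boundary_value_def
proof (rule the_equality)
  show "\<exists>F'. continuous_on (closure I) F' \<and> (AE x in lebesgue_on I. f x = F' x) \<and> F' a = F a"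
    using assms by blast
next
  fix c assume "\<exists>F'. continuous_on (closure I) F' \<and> (AE x in lebesgue_on I. f x = F' x) \<and> F' a = c"
  then obtain F' where F': "continuous_on (closure I) F'" "AE x in lebesgue_on I. f x = F' x" "F' a = c"
    by blast
  have "AE x in lebesgue_on I. F' x = F x"
    using assms(2) F'(2) by eventually_elim simp
  then show "c = F a"
    using continuous_AE_eq[OF F'(1) assms(1)] assms(3) F'(3) by blast
qed

lemma test_integral:
  fixes f :: "real \<Rightarrow> complex" and \<phi> :: "real \<Rightarrow> real"
  assumes "f absolutely_integrable_on {a..b}" "{a..b} \<subseteq> I" "continuous_on UNIV \<phi>"
    "\<And>x. x \<notin> {a..b} \<Longrightarrow> \<phi> x = 0"
  shows "(\<lambda>x. f x * of_real (\<phi> x)) absolutely_integrable_on {a..b}"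
    "(\<lambda>x. f x * of_real (\<phi> x)) absolutely_integrable_on I"
    "integral\<^sup>L (lebesgue_on I) (\<lambda>x. f x * of_real (\<phi> x)) = integral {a..b} (\<lambda>x. f x * of_real (\<phi> x))"
proof -
  have c: "continuous_on {a..b} (\<lambda>x. complex_of_real (\<phi> x))"
    using assms(3) by (intro continuous_intros) (auto intro: continuous_on_subset)
  have "(\<lambda>x. of_real (\<phi> x) * f x) absolutely_integrable_on {a..b}"
    by (rule absolutely_integrable_mult_continuous[OF c assms(1)])
  then show 1: "(\<lambda>x. f x * of_real (\<phi> x)) absolutely_integrable_on {a..b}"
    by (simp add: mult.commute)
  have sp: "{x \<in> {a..b} - I. f x * of_real (\<phi> x) \<noteq> 0} = {}" "{x \<in> I - {a..b}. f x * of_real (\<phi> x) \<noteq> 0} = {}"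
    using assms(2,4) by auto
  show 2: "(\<lambda>x. f x * of_real (\<phi> x)) absolutely_integrable_on I"
    using 1 absolutely_integrable_spike_set_eq[of "{a..b}" I "\<lambda>x. f x * of_real (\<phi> x)", unfolded sp]
    by simp
  have "integral I (\<lambda>x. f x * of_real (\<phi> x)) = integral {a..b} (\<lambda>x. f x * of_real (\<phi> x))"
    by (rule integral_spike_set) (simp_all only: sp negligible_empty)
  then show "integral\<^sup>L (lebesgue_on I) (\<lambda>x. f x * of_real (\<phi> x)) = integral {a..b} (\<lambda>x. f x * of_real (\<phi> x))"
    using 2 by (simp add: integral_lebesgue_on_eq lebesgue_I)
qed

lemma test_function_continuous:
  assumes "\<phi> \<in> test_functions I"
  shows "continuous_on UNIV \<phi>" "continuous_on UNIV (deriv \<phi>)"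
  using assms smooth_isCont smooth_deriv
  by (auto simp: test_functions_iff continuous_at_imp_continuous_on)

lemma test_function_support:
  assumes "\<phi> \<in> test_functions I"
  obtains a b where "a < b" "{a..b} \<subseteq> I" "\<And>x. x \<notin> {a<..<b} \<Longrightarrow> \<phi> x = 0" "\<And>x. x \<notin> {a..b} \<Longrightarrow> deriv \<phi> x = 0"
proof -
  obtain a b where ab: "a < b" "{a..b} \<subseteq> I" "\<And>x. x \<notin> {a<..<b} \<Longrightarrow> \<phi> x = 0"
    using test_functionE[OF assms open_I is_interval_I nonempty_I] by metis
  have "deriv \<phi> x = 0" if "x \<notin> {a..b}" for x
  proof (rule DERIV_imp_deriv)
    show "(\<phi> has_real_derivative 0) (at x)"
    proof (rule has_field_derivative_transform_within_open[where S="- {a..b}"])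
      show "((\<lambda>x. 0) has_real_derivative 0) (at x)" by simp
    qed (use that ab(3) in auto)
  qed
  with ab that show ?thesis by blast
qed

text \<open>
  Almost every point is a limit of averages over small intervals to its right, and these averages vanish. This is
  applied on compact subintervals, which suffices since being null is a local property.
\<close>
lemma zero_if_integrals_zero:
  fixes h :: "real \<Rightarrow> complex"
  assumes int: "\<And>a b. {a..b} \<subseteq> I \<Longrightarrow> h absolutely_integrable_on {a..b}"
    and zero: "\<And>a b. {a..b} \<subseteq> I \<Longrightarrow> integral {a..b} h = 0"
  shows "AE x in lebesgue_on I. h x = 0"
proof -
  have loc: "negligible {x \<in> {c<..<d}. h x \<noteq> 0}" if cd: "{c..d} \<subseteq> I" for c d
  proof -
    \<comment> \<open>the theorem on averages needs a function that is integrable on all intervals\<close>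
    define f where "f x = (if x \<in> {c..d} then h x else 0)" for x
    have "h integrable_on {c..d}"
      using int[OF cd] by (simp add: absolutely_integrable_on_def)
    then have "f integrable_on cbox a b" for a b
      unfolding f_def by (subst integrable_restrict_Int)
        (auto intro: integrable_subinterval_real simp: cbox_interval)
    then obtain N where N: "negligible N" "\<And>x e. \<lbrakk>x \<notin> N; 0 < e\<rbrakk> \<Longrightarrow>
               \<exists>d>0. \<forall>h. 0 < h \<and> h < d \<longrightarrow>
                         norm (integral (cbox x (x + h *\<^sub>R One)) f /\<^sub>R h ^ DIM(real) - f x) < e"
      using integrable_ccontinuous_explicit by blast
    have "h x = 0" if x: "x \<in> {c<..<d}" "x \<notin> N" for x
    proof (rule ccontr)
      assume "h x \<noteq> 0"
      then obtain e where e: "e > 0" "\<And>t. 0 < t \<Longrightarrow> t < e \<Longrightarrow>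
          norm (integral (cbox x (x + t *\<^sub>R One)) f /\<^sub>R t ^ DIM(real) - f x) < norm (h x)"
        using N(2)[OF x(2), of "norm (h x)"] by auto
      \<comment> \<open>small enough for the average to be close to \<open>h x\<close> and for \<open>[x, x + t]\<close> to stay inside \<open>[c,d]\<close>\<close>
      define t where "t = min (e / 2) ((d - x) / 2)"
      have t: "0 < t" "t < e" "x + t \<le> d"
        using e(1) x(1) by (auto simp: t_def min_def field_simps)
      have "integral {x..x + t} f = integral {x..x + t} h"
        using t x(1) by (intro integral_cong) (auto simp: f_def)
      also have "\<dots> = 0"
        using t x(1) cd by (intro zero) auto
      finally show False
        using e(2)[OF t(1,2)] x(1) by (simp add: f_def)
    qed
    then show ?thesis
      by (intro negligible_subset[OF N(1)]) auto
  qed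
  have "negligible {x\<in>I. h x \<noteq> 0}"
  proof (rule locally_negligible_alt[THEN iffD2], rule ballI)
    fix x assume x: "x \<in> {x\<in>I. h x \<noteq> 0}"
    then obtain e where e: "e > 0" "cball x e \<subseteq> I"
      using open_I unfolding open_contains_cball by auto
    have sub: "{x - e..x + e} \<subseteq> I"
      using e by (simp add: cball_eq_atLeastAtMost)
    show "\<exists>U. openin (top_of_set {x\<in>I. h x \<noteq> 0}) U \<and> x \<in> U \<and> negligible U"
    proof (intro exI conjI)
      show "openin (top_of_set {x\<in>I. h x \<noteq> 0}) ({x\<in>I. h x \<noteq> 0} \<inter> {x - e<..<x + e})"
        by (rule openin_open_Int) simp
      show "negligible ({x\<in>I. h x \<noteq> 0} \<inter> {x - e<..<x + e})"
        by (rule negligible_subset[OF loc[OF sub]]) auto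
    qed (use x e in auto)
  qed
  then show ?thesis by (simp add: AE_lebesgue_on_iff_negligible lebesgue_I)
qed

text \<open>
  The fundamental lemma of the calculus of variations: testing against the bumps of \<open>[a,b]\<close> and passing to the limit by
  dominated convergence gives \<open>\<integral>\<^sub>a\<^sup>b h = 0\<close>.
\<close>
lemma fundamental_lemma:
  fixes h :: "real \<Rightarrow> complex"
  assumes int: "\<And>a b. {a..b} \<subseteq> I \<Longrightarrow> h absolutely_integrable_on {a..b}"
    and zero: "\<And>\<phi>. \<phi> \<in> test_functions I \<Longrightarrow> integral\<^sup>L (lebesgue_on I) (\<lambda>x. h x * of_real (\<phi> x)) = 0"
  shows "AE x in lebesgue_on I. h x = 0"
proof (rule zero_if_integrals_zero[OF int])
  fix a b assume ab: "{a..b} \<subseteq> I"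
  let ?f = "\<lambda>n x. h x * of_real (bump a b n x)"
  have c: "continuous_on UNIV (bump a b n)" for n
    using smooth_isCont[OF smooth_bump] by (simp add: continuous_at_imp_continuous_on)
  have z: "x \<notin> {a..b} \<Longrightarrow> bump a b n x = 0" for x n
    by (rule bump_outside) auto
  have 0: "integral {a..b} (?f n) = 0" for n
    using test_integral(3)[OF int[OF ab] ab c z] zero[OF test_functionI[OF smooth_bump z ab]] by simp
  have "(\<lambda>n. integral {a..b} (?f n)) \<longlonglongrightarrow> integral {a..b} (\<lambda>x. h x * of_real (indicator {a<..<b} x))"
  proof (rule dominated_convergence)
    show "?f n integrable_on {a..b}" for n
      using test_integral(1)[OF int[OF ab] ab c z] by (simp add: absolutely_integrable_on_def)
    show "(\<lambda>x. norm (h x)) integrable_on {a..b}"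
      using int[OF ab] by (simp add: absolutely_integrable_on_def)
    show "norm (?f n x) \<le> norm (h x)" for n x
      using bump_bounds[of a b n x] by (simp add: norm_mult mult_left_le)
    show "(\<lambda>n. ?f n x) \<longlonglongrightarrow> h x * of_real (indicator {a<..<b} x)" for x
      by (intro tendsto_intros bump_tendsto)
  qed
  then have "integral {a..b} (\<lambda>x. h x * of_real (indicator {a<..<b} x)) = 0"
    unfolding 0 by (rule LIMSEQ_unique[OF _ tendsto_const])
  moreover have "integral {a..b} (\<lambda>x. h x * of_real (indicator {a<..<b} x)) = integral {a..b} h"
    by (rule integral_spike[of "{a, b}"]) (auto simp: indicator_def)
  ultimately show "integral {a..b} h = 0" by simp
qed

text \<open>
  Integration by parts against a test function; the boundary terms vanish because the test function does.
\<close>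
lemma primitive_imp_weak_deriv:
  assumes F: "primitive_on (closure I) F f"
  shows "has_weak_deriv I F f"
  unfolding has_weak_deriv_def
proof
  fix \<phi> assume \<phi>: "\<phi> \<in> test_functions I"
  obtain a b where ab: "a < b" "{a..b} \<subseteq> I" "\<And>x. x \<notin> {a<..<b} \<Longrightarrow> \<phi> x = 0"
    "\<And>x. x \<notin> {a..b} \<Longrightarrow> deriv \<phi> x = 0"
    using test_function_support[OF \<phi>] by metis
  have z: "\<And>x. x \<notin> {a..b} \<Longrightarrow> \<phi> x = 0" using ab(3) by auto
  have Fab: "primitive_on {a..b} F f"
    using F ab(2) closure_subset by (blast intro: primitive_on_subset)
  have cF: "continuous_on {a..b} F"
    using primitive_on_continuous[OF Fab] by (simp add: is_interval_cc)
  have f: "f absolutely_integrable_on {a..b}"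
    using primitive_onD(1)[OF Fab] ab(1) by simp
  have F': "F absolutely_integrable_on {a..b}"
    using cF absolutely_integrable_continuous_real by blast
  have "primitive_on {a..b} (\<lambda>x. of_real (\<phi> x) * F x) (\<lambda>x. of_real (deriv \<phi> x) * F x + of_real (\<phi> x) * f x)"
  proof (rule primitive_on_mult_C1[OF Fab])
    show "((\<lambda>x. complex_of_real (\<phi> x)) has_vector_derivative of_real (deriv \<phi> x)) (at x within {a..b})" for x
      using smooth_has_deriv[of \<phi> x] \<phi>
      by (intro has_vector_derivative_of_real)
        (auto simp: test_functions_iff has_real_derivative_iff_has_vector_derivative intro: has_vector_derivative_at_within)
    show "continuous_on {a..b} (\<lambda>x. complex_of_real (deriv \<phi> x))"
      using test_function_continuous(2)[OF \<phi>] by (intro continuous_intros) (auto intro: continuous_on_subset)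
  qed (auto simp: is_interval_cc)
  from primitive_onD(3)[OF this, of a b] ab
  have "integral {a..b} (\<lambda>x. F x * of_real (deriv \<phi> x) + f x * of_real (\<phi> x)) = 0"
    by (simp add: mult.commute)
  moreover have "integral {a..b} (\<lambda>x. F x * of_real (deriv \<phi> x) + f x * of_real (\<phi> x))
      = integral {a..b} (\<lambda>x. F x * of_real (deriv \<phi> x)) + integral {a..b} (\<lambda>x. f x * of_real (\<phi> x))"
    using test_integral(1)[OF F' ab(2) test_function_continuous(2)[OF \<phi>] ab(4)]
      test_integral(1)[OF f ab(2) test_function_continuous(1)[OF \<phi>] z]
    by (intro integral_add) (auto simp: absolutely_integrable_on_def)
  ultimately show "integral\<^sup>L (lebesgue_on I) (\<lambda>x. F x * of_real (deriv \<phi> x)) =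
      - integral\<^sup>L (lebesgue_on I) (\<lambda>x. f x * of_real (\<phi> x))"
    using test_integral(3)[OF F' ab(2) test_function_continuous(2)[OF \<phi>] ab(4)]
      test_integral(3)[OF f ab(2) test_function_continuous(1)[OF \<phi>] z]
    by (simp add: eq_neg_iff_add_eq_0)
qed

lemma test_integral_diff:
  assumes f: "\<And>a b. {a..b} \<subseteq> I \<Longrightarrow> f absolutely_integrable_on {a..b}"
    and g: "\<And>a b. {a..b} \<subseteq> I \<Longrightarrow> g absolutely_integrable_on {a..b}"
    and \<phi>: "continuous_on UNIV \<phi>" "\<And>x. x \<notin> {a..b} \<Longrightarrow> \<phi> x = (0::real)" "{a..b} \<subseteq> I"
  shows "integral\<^sup>L (lebesgue_on I) (\<lambda>x. (f x - g x) * complex_of_real (\<phi> x)) =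
    integral\<^sup>L (lebesgue_on I) (\<lambda>x. f x * of_real (\<phi> x)) - integral\<^sup>L (lebesgue_on I) (\<lambda>x. g x * of_real (\<phi> x))"
  unfolding left_diff_distrib
  using test_integral(2)[OF f[OF \<phi>(3)] \<phi>(3,1,2)] test_integral(2)[OF g[OF \<phi>(3)] \<phi>(3,1,2)]
  by (intro Bochner_Integration.integral_diff) (simp_all add: integrable_lebesgue_on_iff lebesgue_I)

lemma weak_deriv_unique:
  assumes "has_weak_deriv I f g1" "has_weak_deriv I f g2"
    and g1: "\<And>a b. {a..b} \<subseteq> I \<Longrightarrow> g1 absolutely_integrable_on {a..b}"
    and g2: "\<And>a b. {a..b} \<subseteq> I \<Longrightarrow> g2 absolutely_integrable_on {a..b}"
  shows "AE x in lebesgue_on I. g1 x = g2 x"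
proof -
  have "AE x in lebesgue_on I. g1 x - g2 x = 0"
  proof (rule fundamental_lemma)
    show "{a..b} \<subseteq> I \<Longrightarrow> (\<lambda>x. g1 x - g2 x) absolutely_integrable_on {a..b}" for a b
      using g1 g2 by (intro set_integral_diff) auto
    fix \<phi> assume \<phi>: "\<phi> \<in> test_functions I"
    obtain a b where ab: "a < b" "{a..b} \<subseteq> I" "\<And>x. x \<notin> {a<..<b} \<Longrightarrow> \<phi> x = 0"
      using test_function_support[OF \<phi>] by metis
    then have z: "\<And>x. x \<notin> {a..b} \<Longrightarrow> \<phi> x = 0" by auto
    show "integral\<^sup>L (lebesgue_on I) (\<lambda>x. (g1 x - g2 x) * of_real (\<phi> x)) = 0"
      using assms(1,2) \<phi> unfolding has_weak_deriv_def
      by (subst test_integral_diff[OF g1 g2 test_function_continuous(1)[OF \<phi>] z ab(2)]) auto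
  qed
  then show ?thesis by simp
qed

text \<open>
  The lemma of du Bois-Reymond. Fix a test function \<open>\<theta>\<close> of integral \<open>1\<close> and let \<open>c = \<integral> h \<theta>\<close>. For a test
  function \<open>\<psi>\<close> of integral \<open>r\<close> the difference \<open>\<psi> - r \<theta>\<close> has integral zero, hence is the derivative of a test
  function, so \<open>\<integral> h \<psi> = r c = \<integral> c \<psi>\<close>. Now the fundamental lemma applies to \<open>h - c\<close>.
\<close>
lemma weak_deriv_zero_imp_constant:
  fixes h :: "real \<Rightarrow> complex"
  assumes h: "\<And>a b. {a..b} \<subseteq> I \<Longrightarrow> h absolutely_integrable_on {a..b}"
    and zero: "\<And>\<phi>. \<phi> \<in> test_functions I \<Longrightarrow> integral\<^sup>L (lebesgue_on I) (\<lambda>x. h x * of_real (deriv \<phi> x)) = 0"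
  obtains c where "AE x in lebesgue_on I. h x = c"
proof -
  obtain m where m: "m \<in> I" using nonempty_I by blast
  then obtain e where e: "e > 0" "cball m e \<subseteq> I"
    using open_I unfolding open_contains_cball by auto
  define p q where "p = m - e" and "q = m + e"
  have pq: "p < q" "{p..q} \<subseteq> I"
    using e by (auto simp: p_def q_def cball_eq_atLeastAtMost)
  define B where "B = bump p q 0"
  have cB: "continuous_on S B" for S
    unfolding B_def using smooth_isCont[OF smooth_bump] by (simp add: continuous_at_imp_continuous_on)
  have zB: "\<And>x. x \<notin> {p..q} \<Longrightarrow> B x = 0"
    unfolding B_def by (rule bump_outside) auto
  have "integral {p..q} B \<noteq> 0"
  proof
    assume "integral {p..q} B = 0"
    moreover have "B integrable_on {p..q}" using cB by (rule integrable_continuous_real)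
    ultimately have "(B has_integral 0) {p..q}" by (simp add: has_integral_iff)
    then have "B m = 0"
      using has_integral_0_cbox_imp_0[of p q B m] cB bump_bounds[of p q 0] e 
      by (auto simp: B_def p_def q_def cbox_interval box_real)
    moreover have "B m > 0"
      unfolding B_def by (rule bump_positive) (use e in \<open>simp add: p_def q_def\<close>)
    ultimately show False by simp
  qed
  define \<theta> where "\<theta> x = B x / integral {p..q} B" for x
  have s\<theta>: "smooth \<theta>"
    unfolding \<theta>_def using smooth_mult[OF smooth_bump smooth_const[of "1 / integral {p..q} B"]] B_def by simp
  have z\<theta>: "\<And>x. x \<notin> {p..q} \<Longrightarrow> \<theta> x = 0"
    using zB by (simp add: \<theta>_def)
  have i\<theta>: "integral {p..q} \<theta> = 1"
    unfolding \<theta>_def using \<open>integral {p..q} B \<noteq> 0\<close> by simp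
  have c\<theta>: "continuous_on S \<theta>" for S
    using smooth_isCont[OF s\<theta>] by (simp add: continuous_at_imp_continuous_on)
  define c where "c = integral\<^sup>L (lebesgue_on I) (\<lambda>x. h x * of_real (\<theta> x))"
  have "AE x in lebesgue_on I. h x - c = 0"
  proof (rule fundamental_lemma)
    have const: "(\<lambda>x. c) absolutely_integrable_on {a..b}" for a b :: real
      by (rule absolutely_integrable_continuous_real) simp
    show "{a..b} \<subseteq> I \<Longrightarrow> (\<lambda>x. h x - c) absolutely_integrable_on {a..b}" for a b
      using h const by (intro set_integral_diff) auto
    fix \<psi> assume \<psi>: "\<psi> \<in> test_functions I"
    obtain a0 b0 where ab0: "a0 < b0" "{a0..b0} \<subseteq> I" "\<And>x. x \<notin> {a0<..<b0} \<Longrightarrow> \<psi> x = 0"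
      using test_function_support[OF \<psi>] by metis
    define a b where "a = min a0 p" and "b = max b0 q"
    have "a0 \<in> I" "b0 \<in> I" "p \<in> I" "q \<in> I"
      using ab0(1,2) pq by auto
    then have "a \<in> I" "b \<in> I" by (auto simp: a_def b_def min_def max_def)
    then have ab: "a \<le> b" "{a..b} \<subseteq> I" "{p..q} \<subseteq> {a..b}"
      using ab0(1) pq(1) Icc_subset by (auto simp: a_def b_def)
    have z\<psi>: "\<And>x. x \<notin> {a..b} \<Longrightarrow> \<psi> x = 0"
      by (rule ab0(3)) (auto simp: a_def b_def)
    have z\<theta>': "\<And>x. x \<notin> {a..b} \<Longrightarrow> \<theta> x = 0"
      using z\<theta> ab(3) by blast
    have c\<psi>: "continuous_on S \<psi>" for S
      using test_function_continuous(1)[OF \<psi>] continuous_on_subset by blast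
    have empty: "{x \<in> {a..b} - {p..q}. \<theta> x \<noteq> 0} = {}" "{x \<in> {p..q} - {a..b}. \<theta> x \<noteq> 0} = {}"
      using z\<theta> z\<theta>' by blast+
    have "integral {a..b} \<theta> = integral {p..q} \<theta>"
      by (rule integral_spike_set) (simp_all only: empty negligible_empty)
    then have i\<theta>': "integral {a..b} \<theta> = 1"
      using i\<theta> by simp
    define r where "r = integral {a..b} \<psi>"
    have s: "smooth (\<lambda>x. \<psi> x + (- r) * \<theta> x)"
      using \<psi> s\<theta> by (intro smooth_add smooth_mult smooth_const) (auto simp: test_functions_iff)
    have i: "integral {a..b} (\<lambda>x. \<psi> x + (- r) * \<theta> x) = 0"
      using c\<psi> c\<theta> by (subst integral_add) (auto intro!: integrable_continuous_real continuous_intros simp: r_def i\<theta>')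
    obtain \<phi> where \<phi>: "\<phi> \<in> test_functions I" "deriv \<phi> = (\<lambda>x. \<psi> x + (- r) * \<theta> x)"
      by (rule antiderivative_test_function[OF s _ ab(2,1) i]) (use z\<psi> z\<theta>' in auto)
    note ih = test_integral[OF h[OF ab(2)] ab(2)]
    have "0 = integral\<^sup>L (lebesgue_on I) (\<lambda>x. h x * of_real (\<psi> x + (- r) * \<theta> x))"
      using zero[OF \<phi>(1)] by (simp add: \<phi>(2))
    also have "\<dots> = integral\<^sup>L (lebesgue_on I) (\<lambda>x. h x * of_real (\<psi> x) + (- of_real r) * (h x * of_real (\<theta> x)))"
      by (simp add: algebra_simps)
    also have "\<dots> = integral\<^sup>L (lebesgue_on I) (\<lambda>x. h x * of_real (\<psi> x)) + 
        integral\<^sup>L (lebesgue_on I) (\<lambda>x. (- of_real r) * (h x * of_real (\<theta> x)))"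
      using ih(2)[OF c\<psi> z\<psi>] ih(2)[OF c\<theta> z\<theta>']
      by (intro Bochner_Integration.integral_add integrable_mult_right) (simp_all add: integrable_lebesgue_on_iff lebesgue_I)
    also have "\<dots> = integral\<^sup>L (lebesgue_on I) (\<lambda>x. h x * of_real (\<psi> x)) - of_real r * c"
      by (simp add: c_def)
    finally have 1: "integral\<^sup>L (lebesgue_on I) (\<lambda>x. h x * of_real (\<psi> x)) = of_real r * c" by simp
    have "integral\<^sup>L (lebesgue_on I) (\<lambda>x. c * of_real (\<psi> x)) = integral {a..b} (\<lambda>x. c * of_real (\<psi> x))"
      by (rule test_integral(3)[OF const ab(2) c\<psi> z\<psi>])
    also have "\<dots> = c * of_real r"
      using integral_linear[OF integrable_continuous_real[OF c\<psi>, of a b]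
          bounded_linear_of_real[where ?'a=complex]]
      by (simp add: r_def o_def)
    finally have 2: "integral\<^sup>L (lebesgue_on I) (\<lambda>x. c * of_real (\<psi> x)) = c * of_real r" .
    show "integral\<^sup>L (lebesgue_on I) (\<lambda>x. (h x - c) * of_real (\<psi> x)) = 0"
      by (subst test_integral_diff[OF h const c\<psi> z\<psi> ab(2)]) (simp_all only: 1 2 mult.commute diff_self not_False_eq_True)
  qed
  then show ?thesis using that[of c] by simp
qed

text \<open>
  The base point is chosen in the closure because \<open>f\<close> is integrable up to the end points.
\<close>
lemma primitive_exists:
  assumes "\<And>a b. {a..b} \<subseteq> closure I \<Longrightarrow> f absolutely_integrable_on {a..b}"
  obtains F where "primitive_on (closure I) F f"
proof -
  obtain m where m: "m \<in> closure I" using nonempty_I closure_subset by blast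
  define F where "F x = (if m \<le> x then integral {m..x} f else - integral {x..m} f)" for x
  have int: "f integrable_on {a..b}" if "{a..b} \<subseteq> closure I" for a b
    using assms[OF that] by (simp add: absolutely_integrable_on_def)
  have comb: "integral {a..b} f + integral {b..c} f = integral {a..c} f" 
    if "a \<in> closure I" "c \<in> closure I" "a \<le> b" "b \<le> c" for a b c
    using that Icc_subset_closure[of a c] 
    by (intro Henstock_Kurzweil_Integration.integral_combine int) auto
  have "primitive_on (closure I) F f"
    unfolding primitive_on_def
  proof (intro allI impI conjI assms)
    fix a b :: real assume ab: "a \<le> b" "{a..b} \<subseteq> closure I"
    then have J: "a \<in> closure I" "b \<in> closure I" by auto
    show "integral {a..b} f = F b - F a"
      using comb[of m b a] comb[of a b m] comb[of a m b] J m ab(1)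
      by (auto simp: F_def algebra_simps)
  qed
  then show ?thesis using that by blast
qed

text \<open>
  The difference of \<open>f\<close> and any primitive of \<open>g\<close> has weak derivative zero, hence is constant.
\<close>
lemma weak_deriv_imp_primitive:
  assumes "f \<in> L2_on I" "g \<in> L2_on I" "has_weak_deriv I f g"
  obtains F where "primitive_on (closure I) F g" "AE x in lebesgue_on I. f x = F x"
proof -
  obtain G where G: "primitive_on (closure I) G g"
    using primitive_exists[of g] L2_on_local[OF assms(2)] by blast
  have f: "f absolutely_integrable_on {a..b}" if "{a..b} \<subseteq> I" for a b
    using L2_on_local[OF assms(1)] that closure_subset by blast
  have cG: "G absolutely_integrable_on {a..b}" if "{a..b} \<subseteq> I" for a b
    using primitive_on_continuous_closure[OF G] that closure_subset
    by (intro absolutely_integrable_continuous_real) (blast intro: continuous_on_subset)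
  obtain c where c: "AE x in lebesgue_on I. f x - G x = c"
  proof (rule weak_deriv_zero_imp_constant)
    show "{a..b} \<subseteq> I \<Longrightarrow> (\<lambda>x. f x - G x) absolutely_integrable_on {a..b}" for a b
      using f cG by (intro set_integral_diff) auto
    fix \<phi> assume \<phi>: "\<phi> \<in> test_functions I"
    obtain a b where ab: "{a..b} \<subseteq> I" "\<And>x. x \<notin> {a..b} \<Longrightarrow> deriv \<phi> x = 0"
      using test_function_support[OF \<phi>] by metis
    show "integral\<^sup>L (lebesgue_on I) (\<lambda>x. (f x - G x) * of_real (deriv \<phi> x)) = 0"
      using assms(3) primitive_imp_weak_deriv[OF G] \<phi> unfolding has_weak_deriv_def
      by (subst test_integral_diff[OF f cG test_function_continuous(2)[OF \<phi>] ab(2,1)]) auto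
  qed
  have "primitive_on (closure I) (\<lambda>x. G x + c) g"
    using primitive_on_add[OF G primitive_on_const[of _ c]] by simp
  moreover have "AE x in lebesgue_on I. f x = G x + c"
    using c by eventually_elim (simp add: algebra_simps)
  ultimately show ?thesis using that by blast
qed

lemma has_weak_deriv_cong_AE:
  assumes "f \<in> L2_on I" "g \<in> L2_on I"
    and "AE x in lebesgue_on I. f x = f' x" "AE x in lebesgue_on I. g x = g' x"
    and "has_weak_deriv I f g"
  shows "has_weak_deriv I f' g'"
proof -
  have f'g': "f' \<in> L2_on I" "g' \<in> L2_on I"
    using L2_on_cong_AE[OF lebesgue_I] assms by blast+
  have m: "u \<in> borel_measurable (lebesgue_on I)" if "u \<in> L2_on I" for u
    using that lebesgue_I by (simp add: L2_on_iff)
  have cong: "integral\<^sup>L (lebesgue_on I) (\<lambda>x. u x * of_real (\<phi> x)) = integral\<^sup>L (lebesgue_on I) (\<lambda>x. v x * of_real (\<phi> x))"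
    if "u \<in> L2_on I" "v \<in> L2_on I" "AE x in lebesgue_on I. u x = v x" "continuous_on UNIV \<phi>" for u v and \<phi> :: "real \<Rightarrow> real"
  proof (rule integral_cong_AE)
    have "continuous_on I (\<lambda>x. complex_of_real (\<phi> x))"
      using that(4) by (intro continuous_intros) (auto intro: continuous_on_subset)
    then have "(\<lambda>x. complex_of_real (\<phi> x)) \<in> borel_measurable (lebesgue_on I)"
      using lebesgue_I by (rule continuous_imp_measurable_on_sets_lebesgue)
    then show "(\<lambda>x. u x * of_real (\<phi> x)) \<in> borel_measurable (lebesgue_on I)"
      "(\<lambda>x. v x * of_real (\<phi> x)) \<in> borel_measurable (lebesgue_on I)"
      using m that(1,2) by auto
    show "AE x in lebesgue_on I. u x * of_real (\<phi> x) = v x * of_real (\<phi> x)"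
      using that(3) by eventually_elim simp
  qed
  show ?thesis
    unfolding has_weak_deriv_def
  proof
    fix \<phi> assume \<phi>: "\<phi> \<in> test_functions I"
    show "integral\<^sup>L (lebesgue_on I) (\<lambda>x. f' x * of_real (deriv \<phi> x)) = - integral\<^sup>L (lebesgue_on I) (\<lambda>x. g' x * of_real (\<phi> x))"
      using cong[OF assms(1) f'g'(1) assms(3) test_function_continuous(2)[OF \<phi>]]
        cong[OF assms(2) f'g'(2) assms(4) test_function_continuous(1)[OF \<phi>]]
        assms(5) \<phi> unfolding has_weak_deriv_def by auto
  qed
qed

text \<open>
  The chosen representative \<open>weak_deriv I f\<close> is identified, up to null sets, by uniqueness of weak derivatives.
\<close>
lemma weak_deriv_primitive:
  assumes "primitive_on (closure I) F g" "g \<in> L2_on I" "f \<in> L2_on I" "AE x in lebesgue_on I. f x = F x"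
  shows "f \<in> sobolev_H1 I" "AE x in lebesgue_on I. weak_deriv I f x = g x" "weak_deriv I f \<in> L2_on I"
proof -
  have F2: "F \<in> L2_on I"
    using L2_on_cong_AE[OF lebesgue_I assms(3,4)] .
  have AE': "AE x in lebesgue_on I. F x = f x"
    using assms(4) by eventually_elim simp
  have w: "has_weak_deriv I f g"
    by (rule has_weak_deriv_cong_AE[OF F2 assms(2) AE' _ primitive_imp_weak_deriv[OF assms(1)]]) simp
  then show "f \<in> sobolev_H1 I" using assms(2,3) by (auto simp: sobolev_H1_def)
  have "weak_deriv I f \<in> L2_on I \<and> has_weak_deriv I f (weak_deriv I f)"
    unfolding weak_deriv_def by (rule someI[of _ g]) (use w assms(2) in auto)
  then have wd: "weak_deriv I f \<in> L2_on I" "has_weak_deriv I f (weak_deriv I f)" by auto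
  then show "weak_deriv I f \<in> L2_on I" by simp
  show "AE x in lebesgue_on I. weak_deriv I f x = g x"
    using closure_subset by (intro weak_deriv_unique[OF wd(2) w] L2_on_local[OF wd(1)] L2_on_local[OF assms(2)]) auto
qed

lemma sobolev_H1_primitive:
  assumes "f \<in> sobolev_H1 I"
  obtains F g where "primitive_on (closure I) F g" "AE x in lebesgue_on I. f x = F x" "f \<in> L2_on I"
    "F \<in> L2_on I" "g \<in> L2_on I" 
proof -
  obtain g where g: "f \<in> L2_on I" "g \<in> L2_on I" "has_weak_deriv I f g"
    using assms by (auto simp: sobolev_H1_def)
  obtain F where F: "primitive_on (closure I) F g" "AE x in lebesgue_on I. f x = F x"
    using weak_deriv_imp_primitive[OF g] .
  then show ?thesis using that[OF F g(1) _ g(2)] L2_on_cong_AE[OF lebesgue_I g(1)] by blast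
qed

text \<open>
  The working description of \<open>H\<^sup>2(I)\<close>: \<open>U\<close> is the continuously differentiable representative of \<open>u\<close>, \<open>V\<close> its derivative up
  to the boundary, and \<open>w\<close> the second derivative, defined almost everywhere.
\<close>
definition H2_rep :: "(real \<Rightarrow> complex) \<Rightarrow> (real \<Rightarrow> complex) \<Rightarrow> (real \<Rightarrow> complex) \<Rightarrow> (real \<Rightarrow> complex) \<Rightarrow> bool" where
  "H2_rep u U V w \<longleftrightarrow> primitive_on (closure I) U V \<and> primitive_on (closure I) V w \<and>
     U \<in> L2_on I \<and> V \<in> L2_on I \<and> w \<in> L2_on I \<and> u \<in> L2_on I \<and> (AE x in lebesgue_on I. u x = U x)"

text \<open>
  Everything that the definition of the operator extracts from \<open>u\<close> can be read off from such a triple.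
\<close>
lemma H2_repD:
  assumes "H2_rep u U V w"
  shows "u \<in> sobolev_H2 I" "AE x in lebesgue_on I. weak_deriv I u x = V x"
    "AE x in lebesgue_on I. weak_deriv I (weak_deriv I u) x = w x"
    "\<And>a. a \<in> closure I \<Longrightarrow> boundary_value I u a = U a"
    "\<And>a. a \<in> closure I \<Longrightarrow> boundary_value I (weak_deriv I u) a = V a"
    "weak_deriv I (weak_deriv I u) \<in> L2_on I"
proof -
  have as: "primitive_on (closure I) U V" "primitive_on (closure I) V w" "V \<in> L2_on I" "w \<in> L2_on I"
    "u \<in> L2_on I" "AE x in lebesgue_on I. u x = U x"
    using assms by (auto simp: H2_rep_def)
  note 1 = weak_deriv_primitive[OF as(1,3,5,6)]
  note 2 = weak_deriv_primitive[OF as(2,4) 1(3,2)]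
  show "u \<in> sobolev_H2 I" using 1(1) 2(1) by (simp add: sobolev_H2_def)
  show "AE x in lebesgue_on I. weak_deriv I u x = V x"
    "AE x in lebesgue_on I. weak_deriv I (weak_deriv I u) x = w x"
    "weak_deriv I (weak_deriv I u) \<in> L2_on I"
    using 1(2) 2(2,3) by auto
  show "boundary_value I u a = U a" "boundary_value I (weak_deriv I u) a = V a" if "a \<in> closure I" for a
    using that boundary_value_eq[OF primitive_on_continuous_closure[OF as(1)] as(6)] 
      boundary_value_eq[OF primitive_on_continuous_closure[OF as(2)] 1(2)] by auto
qed

text \<open>
  The function \<open>U\<close> is first obtained as a primitive of some weak derivative \<open>g\<close>; the continuous representative \<open>V\<close> of
  \<open>g\<close> differs from it on a null set only, so \<open>U\<close> is also a primitive of \<open>V\<close>.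
\<close>
lemma sobolev_H2_rep:
  assumes "u \<in> sobolev_H2 I"
  obtains U V w where "H2_rep u U V w"
proof -
  have "u \<in> sobolev_H1 I" and d: "weak_deriv I u \<in> sobolev_H1 I"
    using assms by (auto simp: sobolev_H2_def)
  then obtain U g where U: "primitive_on (closure I) U g" "AE x in lebesgue_on I. u x = U x" "u \<in> L2_on I"
    "U \<in> L2_on I" "g \<in> L2_on I" using sobolev_H1_primitive by blast
  note dU = weak_deriv_primitive[OF U(1,5,3,2)]
  obtain V w where V: "primitive_on (closure I) V w" "AE x in lebesgue_on I. weak_deriv I u x = V x"
    "weak_deriv I u \<in> L2_on I" "V \<in> L2_on I" "w \<in> L2_on I"
    using sobolev_H1_primitive[OF d] by blast
  have "AE x in lebesgue_on I. g x = V x"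
    using dU(2) V(2) by eventually_elim simp
  then have "negligible {x\<in>I. g x \<noteq> V x}"
    by (simp add: AE_lebesgue_on_iff_negligible lebesgue_I)
  then have "negligible ({x\<in>I. g x \<noteq> V x} \<union> (closure I - I))"
    using negligible_boundary by (rule negligible_Un)
  then have "primitive_on (closure I) U V"
    by (rule primitive_on_cong[OF U(1) refl]) auto
  then show ?thesis using that U V by (auto simp: H2_rep_def)
qed


lemma H2_rep_diff:
  assumes "H2_rep u U V w" "H2_rep u' U' V' w'"
  shows "H2_rep (\<lambda>x. u x - u' x) (\<lambda>x. U x - U' x) (\<lambda>x. V x - V' x) (\<lambda>x. w x - w' x)"
proof -
  have "AE x in lebesgue_on I. u x = U x" "AE x in lebesgue_on I. u' x = U' x"
    using assms by (auto simp: H2_rep_def)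
  then have "AE x in lebesgue_on I. u x - u' x = U x - U' x"
    by eventually_elim simp
  with assms show ?thesis
    unfolding H2_rep_def by (auto intro!: primitive_on_diff L2_on_diff lebesgue_I)
qed

end

section \<open>First-order equations and the Green kernel on the half-line\<close>

lemma closure_R1: "closure R1 = {0..}"
  by (simp add: R1_def closure_greaterThan)

lemma open_interval_R1: "open_interval R1"
  by standard (auto simp: R1_def is_interval_def intro!: gt_ex)

interpretation R1: open_interval R1
  by (rule open_interval_R1)

lemma closure_R2: "L > 0 \<Longrightarrow> closure (R2 L) = {0..L}"
  by (simp add: R2_def)

lemma open_interval_R2: "L > 0 \<Longrightarrow> open_interval (R2 L)"
  unfolding R2_def by standard (auto intro: is_interval_oo)

lemma integral_R1_eq: "integral R1 f = integral {0..} f"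
  for f :: "real \<Rightarrow> 'a::euclidean_space"
  by (rule integral_subset_negligible)
    (auto simp: R1_def intro: negligible_subset[OF negligible_sing[of "0::real"]])

lemma integrable_R1_iff: "f integrable_on R1 \<longleftrightarrow> f integrable_on {0..}"
  for f :: "real \<Rightarrow> 'a::euclidean_space"
proof -
  have "negligible {x \<in> R1 - {0..}. f x \<noteq> 0}" "negligible {x \<in> {0..} - R1. f x \<noteq> 0}"
    by (auto simp: R1_def intro: negligible_subset[OF negligible_sing[of "0::real"]])
  then show ?thesis by (auto intro: integrable_spike_set)
qed

lemma primitive_on_integral:
  fixes f :: "real \<Rightarrow> 'a::{euclidean_space,real_normed_field}"
  assumes "\<And>x. f absolutely_integrable_on {a..x}"
  shows "primitive_on {a..} (\<lambda>x. integral {a..x} f) f"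
  unfolding primitive_on_def
proof (intro allI impI conjI)
  fix c d :: real assume cd: "c \<le> d" "{c..d} \<subseteq> {a..}"
  have int: "f integrable_on {a..d}"
    using assms by (simp add: absolutely_integrable_on_def)
  show "f absolutely_integrable_on {c..d}"
    using set_integrable_subset[OF assms[of d]] cd by auto
  have "integral {a..c} f + integral {c..d} f = integral {a..d} f"
    using cd int by (intro Henstock_Kurzweil_Integration.integral_combine) auto
  then show "integral {c..d} f = integral {a..d} f - integral {a..c} f"
    by (simp add: algebra_simps)
qed

lemma has_vector_derivative_exp_linear:
  "((\<lambda>x. exp (c * of_real x)) has_vector_derivative c * exp (c * of_real x)) (at x within S)"
  for c :: "'a::{euclidean_space,real_normed_field,banach}"
proof -
  have "((\<lambda>z. exp (c * z)) has_field_derivative c * exp (c * of_real x)) (at (of_real x))"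
    by (auto intro!: derivative_eq_intros)
  then have "((\<lambda>x. exp (c * of_real x)) has_vector_derivative c * exp (c * of_real x)) (at x)"
    by (rule has_vector_derivative_real_field)
  then show ?thesis by (rule has_vector_derivative_at_within)
qed

lemma continuous_on_exp_linear:
  "continuous_on S (\<lambda>x. exp (c * of_real x))" for c :: "'a::{euclidean_space,real_normed_field,banach}"
  by (intro continuous_intros)

lemma exp_shift:
  fixes c :: "'a::{euclidean_space,real_normed_field,banach}"
  shows "exp (c * of_real x) * (exp (- c * of_real t) * y) = exp (c * of_real (x - t)) * y"
proof -
  have "c * of_real (x - t) = c * of_real x + - c * of_real t" by (simp add: algebra_simps)
  then show ?thesis by (simp only: exp_add mult.assoc)
qed

lemma primitive_on_exp: "primitive_on S (\<lambda>x. exp (c * of_real x)) (\<lambda>x. c * exp (c * of_real x))"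
  for c :: "'a::{euclidean_space,real_normed_field,banach}"
  by (intro primitive_on_ftc has_vector_derivative_exp_linear continuous_intros)

text \<open>
  Variation of constants for the equation \<open>y' = c y + f\<close>.
\<close>
lemma primitive_on_exp_mult:
  fixes c :: "'a::{euclidean_space,real_normed_field,banach}"
  assumes "primitive_on J F (\<lambda>x. exp (- c * of_real x) * f x)" "is_interval J" "closed J"
  shows "primitive_on J (\<lambda>x. exp (c * of_real x) * F x) (\<lambda>x. c * (exp (c * of_real x) * F x) + f x)"
proof (rule primitive_on_eq[OF primitive_on_mult_C1[OF assms has_vector_derivative_exp_linear, of c]])
  show "continuous_on J (\<lambda>x. c * exp (c * of_real x))"
    by (intro continuous_intros)
  show "c * exp (c * of_real x) * F x + exp (c * of_real x) * (exp (- c * of_real x) * f x) 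
      = c * (exp (c * of_real x) * F x) + f x" for x
    by (simp add: exp_minus field_simps)
qed auto

text \<open>
  Optimise over the weight: \<open>s = p / K\<close> gives the claim, and when \<open>K = 0\<close> large weights force \<open>p = 0\<close>.
\<close>
lemma square_le_if_weighted_bounds:
  fixes p K H :: real
  assumes "p \<ge> 0" "K \<ge> 0" "H \<ge> 0" and bound: "\<And>s. s > 0 \<Longrightarrow> 2 * p \<le> s * K + H / s"
  shows "p\<^sup>2 \<le> K * H"
proof (cases "p = 0")
  case False
  then have p: "p > 0" using assms by simp
  show ?thesis
  proof (cases "K = 0")
    case True
    define s where "s = H / p + 1"
    have s: "s > 0" using assms p by (simp add: s_def add_nonneg_pos)
    have "2 * p * s \<le> H" using bound[OF s] True s by (simp add: field_simps)
    moreover have "p * s = H + p" using p by (simp add: s_def field_simps)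
    ultimately show ?thesis using assms p by linarith
  next
    case False
    then have K: "K > 0" using assms by simp
    have "2 * p \<le> p / K * K + H / (p / K)"
      using p K by (intro bound) auto
    then have "p \<le> H * K / p" using K by simp
    then show ?thesis using p by (simp add: field_simps power2_eq_square)
  qed
qed (use assms in auto)

text \<open>
  The Cauchy-Schwarz inequality for \<open>f\<close> dominated by the geometric mean of \<open>k\<close> and \<open>h\<close>. It follows from
  \<open>2 \<bar>f\<bar> \<le> s k + h / s\<close> for all positive \<open>s\<close>.
\<close>
lemma cauchy_schwarz_weighted:
  fixes f :: "real \<Rightarrow> complex"
  assumes f: "f integrable_on S" and k: "k integrable_on S" and h: "h integrable_on S"
    and nonneg: "\<And>x. x \<in> S \<Longrightarrow> k x \<ge> 0" "\<And>x. x \<in> S \<Longrightarrow> h x \<ge> 0"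
    and bound: "\<And>x. x \<in> S \<Longrightarrow> (cmod (f x))\<^sup>2 \<le> k x * h x"
  shows "(cmod (integral S f))\<^sup>2 \<le> integral S k * integral S h"
proof (rule square_le_if_weighted_bounds)
  have amgm: "4 * (u * v) \<le> (u + v)\<^sup>2" for u v :: real
    using sum_squares_bound[of u v] by (simp add: power2_sum)
  fix s :: real assume s: "s > 0"
  have "cmod (integral S f) \<le> integral S (\<lambda>x. (s * k x + h x / s) / 2)"
  proof (rule integral_norm_bound_integral[OF f])
    show "(\<lambda>x. (s * k x + h x / s) / 2) integrable_on S"
      using k h by (intro integrable_on_divide integrable_add integrable_on_mult_right)
    fix x assume x: "x \<in> S"
    have "(2 * cmod (f x))\<^sup>2 \<le> 4 * ((s * k x) * (h x / s))"
      using bound[OF x] s by (simp add: power2_eq_square)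
    also have "\<dots> \<le> (s * k x + h x / s)\<^sup>2"
      by (rule amgm)
    finally have "2 * cmod (f x) \<le> s * k x + h x / s"
      using nonneg[OF x] s by (auto intro: power2_le_imp_le)
    then show "cmod (f x) \<le> (s * k x + h x / s) / 2" by simp
  qed
  also have "\<dots> = (s * integral S k + integral S h / s) / 2"
    using k h by (simp add: integral_add integrable_on_mult_right integrable_on_divide)
  finally show "2 * cmod (integral S f) \<le> s * integral S k + integral S h / s" by simp
qed (use k h nonneg in \<open>auto intro: integral_nonneg\<close>)

lemma integrable_atLeast_if_bounded:
  fixes q :: "real \<Rightarrow> real"
  assumes "\<And>T. T \<ge> 0 \<Longrightarrow> q integrable_on {0..T}" "\<And>x. x \<ge> 0 \<Longrightarrow> q x \<ge> 0"
    and bound: "\<And>T. T \<ge> 0 \<Longrightarrow> integral {0..T} q \<le> M"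
  shows "q integrable_on {0..}" "integral {0..} q \<le> M"
proof -
  define f where "f n x = (if x \<in> {0..real n} then q x else 0)" for n x
  have fint: "f n integrable_on {0..}" "integral {0..} (f n) = integral {0..real n} q" for n
  proof -
    have eq: "{0..real n} \<inter> {0..} = {0..real n}" by auto
    show "f n integrable_on {0..}" "integral {0..} (f n) = integral {0..real n} q"
      unfolding f_def integrable_restrict_Int Henstock_Kurzweil_Integration.integral_restrict_Int eq
      using assms(1)[of "real n"] by simp_all
  qed
  have "q integrable_on {0..} \<and> (\<lambda>n. integral {0..} (f n)) \<longlonglongrightarrow> integral {0..} q"
  proof (rule monotone_convergence_increasing)
    show "f n x \<le> f (Suc n) x" if "x \<in> {0..}" for n x
      using that assms(2) by (auto simp: f_def)
    show "(\<lambda>n. f n x) \<longlonglongrightarrow> q x" if "x \<in> {0..}" for x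
    proof (rule tendsto_eventually)
      show "\<forall>\<^sub>F n in sequentially. f n x = q x"
        using eventually_ge_at_top[of "nat \<lceil>x\<rceil>"]
        by eventually_elim (use that in \<open>auto simp: f_def nat_le_iff ceiling_le_iff\<close>)
    qed
    have "norm (integral {0..} (f n)) \<le> M" for n
      using fint(2)[of n] bound[of "real n"] integral_nonneg[OF assms(1)[of "real n"]] assms(2) by simp
    then show "bounded (range (\<lambda>n. integral {0..} (f n)))"
      unfolding bounded_iff by auto
  qed (rule fint)
  then show "q integrable_on {0..}" "integral {0..} q \<le> M"
    using LIMSEQ_le_const2[of "\<lambda>n. integral {0..} (f n)"] fint(2) bound by auto
qed

text \<open>
  The form in which the energy estimates below are turned into \<open>L\<^sup>2\<close> bounds: \<open>G\<close> is a pointwise majorant whose integrals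
  over \<open>[0,T]\<close> are controlled by a differential equation.
\<close>
lemma L2_on_R1_if_decay:
  assumes y: "continuous_on {0..} y" and G: "continuous_on {0..} G" and "b > 0"
    and le: "\<And>x. x \<ge> 0 \<Longrightarrow> (cmod (y x))\<^sup>2 \<le> G x / b"
    and bound: "\<And>T. T \<ge> 0 \<Longrightarrow> b * integral {0..T} G \<le> N"
  shows "y \<in> L2_on R1" "sq_norm R1 y \<le> N / b\<^sup>2"
proof -
  have G0: "G x \<ge> 0" if "x \<ge> 0" for x
    using order_trans[OF zero_le_power2 le[OF that]] \<open>b > 0\<close> by (simp add: zero_le_divide_iff)
  have Gi: "G integrable_on {0..T}" for T
    using G by (intro integrable_continuous_real) (auto intro: continuous_on_subset)
  have Gb: "integral {0..T} G \<le> N / b" if "T \<ge> 0" for T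
    using bound[OF that] \<open>b > 0\<close> by (simp add: field_simps)
  note Gint = integrable_atLeast_if_bounded[OF Gi G0 Gb]
  have m: "y \<in> borel_measurable (lebesgue_on R1)"
    using y R1.lebesgue_I by (intro continuous_imp_measurable_on_sets_lebesgue)
      (auto simp: R1_def intro: continuous_on_subset)
  have int: "(\<lambda>x. G x / b) integrable_on R1"
    using Gint(1) by (simp add: integrable_R1_iff integrable_on_divide)
  have "(cmod (y x))\<^sup>2 \<le> G x / b" if "x \<in> R1" for x
    using le that by (simp add: R1_def)
  note * = L2_on_bound[OF R1.lebesgue_I m int this]
  then show "y \<in> L2_on R1" by simp
  have "integral R1 (\<lambda>x. G x / b) = integral {0..} G / b"
    by (simp add: integral_R1_eq)
  also have "\<dots> \<le> N / b / b"
    using Gint(2) \<open>b > 0\<close> by (intro divide_right_mono) auto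
  finally show "sq_norm R1 y \<le> N / b\<^sup>2" using * by (simp add: power2_eq_square)
qed

lemma L2_on_R1_local: "g \<in> L2_on R1 \<Longrightarrow> g absolutely_integrable_on {0..x}"
  by (rule R1.L2_on_local) (auto simp: closure_R1)

lemma L2_on_R1_square:
  assumes "g \<in> L2_on R1"
  shows "(\<lambda>t. (cmod (g t))\<^sup>2) integrable_on {0..}" "sq_norm R1 g = integral {0..} (\<lambda>t. (cmod (g t))\<^sup>2)"
    "(\<lambda>t. (cmod (g t))\<^sup>2) absolutely_integrable_on {0..}"
    "(\<lambda>t. (cmod (g t))\<^sup>2) absolutely_integrable_on {0..x}"
proof -
  show 1: "(\<lambda>t. (cmod (g t))\<^sup>2) integrable_on {0..}" "sq_norm R1 g = integral {0..} (\<lambda>t. (cmod (g t))\<^sup>2)"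
    using L2_on_integrable[OF R1.lebesgue_I assms] by (auto simp: integrable_R1_iff sq_norm_def integral_R1_eq)
  then show 2: "(\<lambda>t. (cmod (g t))\<^sup>2) absolutely_integrable_on {0..}"
    by (intro nonnegative_absolutely_integrable_1) auto
  show "(\<lambda>t. (cmod (g t))\<^sup>2) absolutely_integrable_on {0..x}"
    by (rule set_integrable_subset[OF 2]) auto
qed

text \<open>
  The first half of the Green kernel, \<open>P x = \<integral>\<^sub>0\<^sup>x exp (\<i>\<kappa>(x - t)) g t dt\<close>. Put \<open>b = Im \<kappa>\<close>. By Cauchy-Schwarz
  \<open>\<bar>P\<bar>\<^sup>2 \<le> G / b\<close> with \<open>G x = \<integral>\<^sub>0\<^sup>x exp (-b (x - t)) \<bar>g t\<bar>\<^sup>2 dt\<close>, and \<open>G\<close> is nonnegative and solves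
  \<open>G' = - b G + \<bar>g\<bar>\<^sup>2\<close>, \<open>G 0 = 0\<close>. Integrating this equation gives \<open>b \<integral>\<^sub>0\<^sup>T G \<le> \<integral> \<bar>g\<bar>\<^sup>2\<close>. The equation
  takes the place of an exchange of integrals.
\<close>
lemma forward_solution:
  assumes g: "g \<in> L2_on R1" and b: "Im \<kappa> > 0"
  obtains P where "primitive_on {0..} P (\<lambda>x. \<i> * \<kappa> * P x + g x)" "P \<in> L2_on R1"
    "sq_norm R1 P \<le> sq_norm R1 g / (Im \<kappa>)\<^sup>2" "\<And>x. x \<ge> 0 \<Longrightarrow> (cmod (P x))\<^sup>2 \<le> sq_norm R1 g / Im \<kappa>"
proof -
  define b where "b = Im \<kappa>"
  have b: "b > 0" using assms by (simp add: b_def)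
  define q where "q t = (cmod (g t))\<^sup>2" for t
  have q0: "q t \<ge> 0" for t by (simp add: q_def)
  note q = L2_on_R1_square[OF g, folded q_def[abs_def]]
  have qint: "q integrable_on {0..x}" for x using q(4) by (simp add: absolutely_integrable_on_def)
  have qle: "integral {0..x} q \<le> sq_norm R1 g" for x
    unfolding q(2) using qint q(1) q0 by (intro integral_subset_le) auto
  define P where "P x = exp (\<i> * \<kappa> * of_real x) * integral {0..x} (\<lambda>t. exp (- (\<i> * \<kappa>) * of_real t) * g t)" for x
  have egint: "(\<lambda>t. exp (- (\<i> * \<kappa>) * of_real t) * g t) absolutely_integrable_on {0..x}" for x
    by (intro absolutely_integrable_mult_continuous L2_on_R1_local[OF g] continuous_on_exp_linear)
  have P: "primitive_on {0..} P (\<lambda>x. \<i> * \<kappa> * P x + g x)"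
    unfolding P_def by (intro primitive_on_exp_mult primitive_on_integral egint) (auto simp: is_interval_ci)
  define G where "G x = exp (- b * of_real x) * integral {0..x} (\<lambda>t. exp (- (- b) * of_real t) * q t)" for x
  have eqint: "(\<lambda>t. exp (- (- b) * of_real t) * q t) absolutely_integrable_on {0..x}" for x
    by (intro absolutely_integrable_mult_continuous q(4) continuous_on_exp_linear)
  have G: "primitive_on {0..} G (\<lambda>x. - b * G x + q x)"
    unfolding G_def by (intro primitive_on_exp_mult primitive_on_integral eqint) (auto simp: is_interval_ci)
  have contG: "continuous_on {0..} G"
    by (rule primitive_on_continuous[OF G]) (auto simp: is_interval_ci)
  have contP: "continuous_on {0..} P"
    by (rule primitive_on_continuous[OF P]) (auto simp: is_interval_ci)
  have Gi: "G integrable_on {0..T}" for T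
    using contG by (intro integrable_continuous_real) (auto intro: continuous_on_subset)
  have G0: "G x \<ge> 0" for x
    unfolding G_def using eqint[of x] q0
    by (intro mult_nonneg_nonneg integral_nonneg) (auto simp: absolutely_integrable_on_def)
  have Gint: "b * integral {0..T} G = integral {0..T} q - G T" if "T \<ge> 0" for T
  proof -
    have "integral {0..T} (\<lambda>x. - b * G x + q x) = G T - G 0"
      using that by (intro primitive_onD(3)[OF G]) auto
    moreover have "integral {0..T} (\<lambda>x. - b * G x + q x) = - b * integral {0..T} G + integral {0..T} q"
      using qint integrable_on_mult_right[OF Gi, of "- b"] by (subst integral_add) auto
    ultimately show ?thesis by (simp add: G_def)
  qed
  have Gle: "G x \<le> sq_norm R1 g" if "x \<ge> 0" for x
    using Gint[OF that] qle[of x] integral_nonneg[OF Gi, of x] G0 b 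
    by (smt (verit, best) mult_nonneg_nonneg)
  have PG: "(cmod (P x))\<^sup>2 \<le> G x / b" if x: "x \<ge> 0" for x
  proof -
    have Px: "P x = integral {0..x} (\<lambda>t. exp (\<i> * \<kappa> * of_real (x - t)) * g t)"
      unfolding P_def integral_mult_right[symmetric] exp_shift ..
    have Gx: "G x = integral {0..x} (\<lambda>t. exp (- b * (x - t)) * q t)"
      unfolding G_def integral_mult_right[symmetric] exp_shift by simp
    have K: "((\<lambda>t. exp (- b * (x - t))) has_integral (exp (- b * (x - x)) / b - exp (- b * (x - 0)) / b)) {0..x}"
      using x b by (intro fundamental_theorem_of_calculus)
        (auto intro!: derivative_eq_intros simp: has_real_derivative_iff_has_vector_derivative[symmetric])
    have "(cmod (P x))\<^sup>2 \<le> integral {0..x} (\<lambda>t. exp (- b * (x - t))) * integral {0..x} (\<lambda>t. exp (- b * (x - t)) * q t)"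
      unfolding Px
    proof (rule cauchy_schwarz_weighted)
      show "(\<lambda>t. exp (\<i> * \<kappa> * of_real (x - t)) * g t) integrable_on {0..x}"
        by (rule set_lebesgue_integral_eq_integral(1)[OF absolutely_integrable_mult_continuous] |
            intro continuous_intros L2_on_R1_local[OF g])+
      show "(\<lambda>t. exp (- b * (x - t)) * q t) integrable_on {0..x}"
        by (rule set_lebesgue_integral_eq_integral(1)[OF absolutely_integrable_mult_continuous] |
            intro continuous_intros q(4))+
      show "(\<lambda>t. exp (- b * (x - t))) integrable_on {0..x}" using K by blast
      show "(cmod (exp (\<i> * \<kappa> * of_real (x - t)) * g t))\<^sup>2 \<le> exp (- b * (x - t)) * (exp (- b * (x - t)) * q t)" for t
        by (simp add: norm_mult power_mult_distrib q_def b_def power2_eq_square)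
    qed (auto simp: q0)
    also have "\<dots> \<le> (1 / b) * G x"
      unfolding Gx[symmetric] integral_unique[OF K] using b G0[of x] by (intro mult_right_mono) auto
    finally show ?thesis by simp
  qed
  have bound: "b * integral {0..T} G \<le> sq_norm R1 g" if "T \<ge> 0" for T
    using Gint[OF that] qle[of T] G0[of T] by simp
  note L2 = L2_on_R1_if_decay[OF contP contG b PG bound]
  have "(cmod (P x))\<^sup>2 \<le> sq_norm R1 g / b" if "x \<ge> 0" for x
    using PG[OF that] divide_right_mono[OF Gle[OF that], of b] b by simp
  with that P L2 show ?thesis by (simp add: b_def)
qed

lemma primitive_on_tail:
  fixes f :: "real \<Rightarrow> 'a::{euclidean_space,real_normed_field}"
  assumes f: "f absolutely_integrable_on {a..}"
  shows "primitive_on {a..} (\<lambda>x. integral {x..} f) (\<lambda>x. - f x)"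
proof -
  have sub: "f absolutely_integrable_on {a..x}" for x
    by (rule set_integrable_subset[OF f]) auto
  have tail: "f integrable_on {x..}" if "x \<ge> a" for x
    by (rule set_lebesgue_integral_eq_integral(1), rule set_integrable_subset[OF f]) (use that in auto)
  have "primitive_on {a..} (\<lambda>x. integral {a..} f - integral {a..x} f) (\<lambda>x. 0 - f x)"
    by (intro primitive_on_diff primitive_on_const primitive_on_integral sub)
  then show ?thesis
  proof (rule primitive_on_eq)
    fix x assume x: "x \<in> {a..}"
    have "integral ({a..x} \<union> {x..}) f = integral {a..x} f + integral {x..} f"
      using x sub[of x] tail[of x] by (intro integral_Un) (auto simp: absolutely_integrable_on_def
          intro: negligible_subset[OF negligible_sing[of x]])
    moreover have "{a..x} \<union> {x..} = {a..}" using x by auto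
    ultimately show "integral {a..} f - integral {a..x} f = integral {x..} f"
      by simp
  qed simp
qed

text \<open>
  The second half of the Green kernel, \<open>Q x = \<integral>\<^sub>x\<^sup>\<infinity> exp (\<i>\<kappa>(t - x)) g t dt\<close>, estimated in the same way with
  \<open>G x = \<integral>\<^sub>x\<^sup>\<infinity> exp (-b (t - x)) \<bar>g t\<bar>\<^sup>2 dt\<close>, which solves \<open>G' = b G - \<bar>g\<bar>\<^sup>2\<close>. The boundary term \<open>G T\<close> is at most
  \<open>\<integral>\<^sub>T\<^sup>\<infinity> \<bar>g\<bar>\<^sup>2\<close>, which is the part of the norm missing from \<open>\<integral>\<^sub>0\<^sup>T \<bar>g\<bar>\<^sup>2\<close>.
\<close>
lemma backward_solution:
  assumes g: "g \<in> L2_on R1" and b: "Im \<kappa> > 0"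
  obtains Q where "primitive_on {0..} Q (\<lambda>x. - (\<i> * \<kappa>) * Q x - g x)" "Q \<in> L2_on R1"
    "sq_norm R1 Q \<le> sq_norm R1 g / (Im \<kappa>)\<^sup>2" "\<And>x. x \<ge> 0 \<Longrightarrow> (cmod (Q x))\<^sup>2 \<le> sq_norm R1 g / Im \<kappa>"
proof -
  define b where "b = Im \<kappa>"
  have b: "b > 0" using assms by (simp add: b_def)
  define q where "q t = (cmod (g t))\<^sup>2" for t
  have q0: "q t \<ge> 0" for t by (simp add: q_def)
  note q = L2_on_R1_square[OF g, folded q_def[abs_def]]
  have qint: "q integrable_on {0..x}" for x using q(4) by (simp add: absolutely_integrable_on_def)
  have qint': "q integrable_on {x..}" if "x \<ge> 0" for x
    by (rule set_lebesgue_integral_eq_integral(1), rule set_integrable_subset[OF q(3)]) (use that in auto)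
  define f where "f t = exp (- (- (\<i> * \<kappa>)) * of_real t) * g t" for t
  define h where "h t = exp (- b * of_real t) * q t" for t
  have nf: "cmod (f t) = exp (- b * t) * cmod (g t)" for t
    by (simp add: f_def norm_mult b_def)
  have expint: "(\<lambda>t. exp (- c * t)) integrable_on {x..}" if "c > 0" for c x :: real
    using has_integral_exp_minus_to_infinity[OF that, of x] by blast
  have f: "f absolutely_integrable_on {0..}"
  proof -
    have "f absolutely_integrable_on R1"
    proof (rule measurable_bounded_by_integrable_imp_absolutely_integrable[OF _ R1.lebesgue_I])
      have "(\<lambda>t. exp (- (- (\<i> * \<kappa>)) * of_real t)) \<in> borel_measurable (lebesgue_on R1)"
        by (rule continuous_imp_measurable_on_sets_lebesgue[OF continuous_on_exp_linear R1.lebesgue_I])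
      then show "f \<in> borel_measurable (lebesgue_on R1)"
        using g R1.lebesgue_I unfolding f_def by (intro borel_measurable_times) (auto simp: L2_on_iff)
      show "(\<lambda>t. exp (- (2 * b) * t) + q t) integrable_on R1"
        using expint[of "2 * b" 0] q(1) b by (simp add: integrable_R1_iff integrable_add)
      fix t
      have "exp (- (2 * b) * t) = (exp (- b * t))\<^sup>2"
        by (simp add: power2_eq_square exp_add[symmetric])
      then show "cmod (f t) \<le> exp (- (2 * b) * t) + q t"
        using sum_squares_bound[of "exp (- b * t)" "cmod (g t)"]
          mult_nonneg_nonneg[of "exp (- b * t)" "cmod (g t)"] unfolding nf q_def
        by (simp del: mult_nonneg_nonneg zero_le_mult_iff)
    qed
    then show ?thesis
      by (simp add: absolutely_integrable_on_def integrable_R1_iff)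
  qed
  have h: "h absolutely_integrable_on {0..}"
  proof (rule nonnegative_absolutely_integrable_1)
    have "h absolutely_integrable_on R1"
    proof (rule measurable_bounded_by_integrable_imp_absolutely_integrable[OF _ R1.lebesgue_I])
      have "(\<lambda>t. exp (- b * of_real t)) \<in> borel_measurable (lebesgue_on R1)"
        by (rule continuous_imp_measurable_on_sets_lebesgue[OF continuous_on_exp_linear R1.lebesgue_I])
      moreover have "q \<in> borel_measurable (lebesgue_on R1)"
        using g R1.lebesgue_I unfolding q_def by (auto simp: L2_on_iff)
      ultimately show "h \<in> borel_measurable (lebesgue_on R1)"
        unfolding h_def by (intro borel_measurable_times)
      show "q integrable_on R1" using q(1) by (simp add: integrable_R1_iff)
      show "norm (h t) \<le> q t" if "t \<in> R1" for t
        using that b q0[of t] mult_right_mono[of "exp (- (b * t))" 1 "q t"]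
        by (auto simp: h_def R1_def abs_mult)
    qed
    then show "h integrable_on {0..}"
      by (simp add: absolutely_integrable_on_def integrable_R1_iff)
  qed (simp add: h_def q0)
  define Q where "Q x = exp (- (\<i> * \<kappa>) * of_real x) * integral {x..} f" for x
  define G where "G x = exp (b * of_real x) * integral {x..} h" for x
  have "primitive_on {0..} (\<lambda>x. integral {x..} f) (\<lambda>x. exp (- (- (\<i> * \<kappa>)) * of_real x) * (- g x))"
    using primitive_on_tail[OF f] by (simp add: f_def)
  from primitive_on_exp_mult[OF this]
  have Q: "primitive_on {0..} Q (\<lambda>x. - (\<i> * \<kappa>) * Q x - g x)"
    by (simp add: Q_def[abs_def] is_interval_ci)
  have "primitive_on {0..} (\<lambda>x. integral {x..} h) (\<lambda>x. exp (- b * of_real x) * (- q x))"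
    using primitive_on_tail[OF h] by (simp add: h_def)
  from primitive_on_exp_mult[OF this]
  have G: "primitive_on {0..} G (\<lambda>x. b * G x - q x)"
    by (simp add: G_def[abs_def] is_interval_ci)
  have contG: "continuous_on {0..} G"
    by (rule primitive_on_continuous[OF G]) (auto simp: is_interval_ci)
  have contQ: "continuous_on {0..} Q"
    by (rule primitive_on_continuous[OF Q]) (auto simp: is_interval_ci)
  have Gi: "G integrable_on {0..T}" for T
    using contG by (intro integrable_continuous_real) (auto intro: continuous_on_subset)
  have hint: "h integrable_on {x..}" if "x \<ge> 0" for x
    by (rule set_lebesgue_integral_eq_integral(1), rule set_integrable_subset[OF h]) (use that in auto)
  have fint: "f integrable_on {x..}" if "x \<ge> 0" for x
    by (rule set_lebesgue_integral_eq_integral(1), rule set_integrable_subset[OF f]) (use that in auto)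
  have G0: "G x \<ge> 0" if "x \<ge> 0" for x
    unfolding G_def using hint[OF that] q0
    by (intro mult_nonneg_nonneg integral_nonneg) (auto simp: h_def)
  have Gx: "G x = integral {x..} (\<lambda>t. exp (b * (x - t)) * q t)" for x
    unfolding G_def h_def integral_mult_right[symmetric] exp_shift by simp
  have Gxi: "(\<lambda>t. exp (b * (x - t)) * q t) integrable_on {x..}" if "x \<ge> 0" for x
  proof -
    have "(\<lambda>t. exp (b * of_real x) * (exp (- b * of_real t) * q t)) integrable_on {x..}"
      using integrable_on_mult_right[OF hint[OF that], of "exp (b * of_real x)"] by (simp add: h_def)
    then show ?thesis unfolding exp_shift by simp
  qed
  have Gtail: "G x \<le> integral {x..} q" if "x \<ge> 0" for x
    unfolding Gx
  proof (intro integral_le Gxi qint' that)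
    fix t assume "t \<in> {x..}"
    then have "exp (b * (x - t)) \<le> 1" using b by (simp add: mult_le_0_iff)
    then have "exp (b * (x - t)) * q t \<le> 1 * q t"
      by (rule mult_right_mono) (rule q0)
    then show "exp (b * (x - t)) * q t \<le> q t" by simp
  qed
  have qsplit: "integral {0..T} q + integral {T..} q = sq_norm R1 g" if "T \<ge> 0" for T
  proof -
    have "integral ({0..T} \<union> {T..}) q = integral {0..T} q + integral {T..} q"
      using qint qint'[OF that] by (intro integral_Un) (auto intro: negligible_subset[OF negligible_sing[of T]])
    moreover have "{0..T} \<union> {T..} = {0..}" using that by auto
    ultimately show ?thesis using q(2) by simp
  qed
  have Gle: "G x \<le> sq_norm R1 g" if "x \<ge> 0" for x
    using Gtail[OF that] qsplit[OF that] integral_nonneg[OF qint[of x]] q0 by simp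
  have bound: "b * integral {0..T} G \<le> sq_norm R1 g" if "T \<ge> 0" for T
  proof -
    have "integral {0..T} (\<lambda>x. b * G x - q x) = G T - G 0"
      using that by (intro primitive_onD(3)[OF G]) auto
    moreover have "integral {0..T} (\<lambda>x. b * G x - q x) = b * integral {0..T} G - integral {0..T} q"
      using qint integrable_on_mult_right[OF Gi, of b] by (subst integral_diff) auto
    ultimately show ?thesis using Gtail[OF that] qsplit[OF that] G0[of 0] by simp
  qed
  have QG: "(cmod (Q x))\<^sup>2 \<le> G x / b" if x: "x \<ge> 0" for x
  proof -
    have Qx: "Q x = integral {x..} (\<lambda>t. exp (- (\<i> * \<kappa>) * of_real (x - t)) * g t)"
      unfolding Q_def f_def integral_mult_right[symmetric] exp_shift ..
    have "((\<lambda>t. exp (b * x) * exp (- b * t)) has_integral exp (b * x) * (exp (- b * x) / b)) {x..}"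
      by (intro has_integral_mult_right has_integral_exp_minus_to_infinity b)
    then have K: "((\<lambda>t. exp (b * (x - t))) has_integral 1 / b) {x..}"
      by (simp add: algebra_simps exp_diff exp_minus field_simps)
    have "(cmod (Q x))\<^sup>2 \<le> integral {x..} (\<lambda>t. exp (b * (x - t))) * integral {x..} (\<lambda>t. exp (b * (x - t)) * q t)"
      unfolding Qx
    proof (rule cauchy_schwarz_weighted)
      have "(\<lambda>t. exp (- (\<i> * \<kappa>) * of_real x) * (exp (- (- (\<i> * \<kappa>)) * of_real t) * g t)) integrable_on {x..}"
        using integrable_on_mult_right[OF fint[OF x], of "exp (- (\<i> * \<kappa>) * of_real x)"] by (simp add: f_def)
      then show "(\<lambda>t. exp (- (\<i> * \<kappa>) * of_real (x - t)) * g t) integrable_on {x..}"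
        unfolding exp_shift .
      show "(\<lambda>t. exp (b * (x - t)) * q t) integrable_on {x..}" by (rule Gxi[OF x])
      show "(\<lambda>t. exp (b * (x - t))) integrable_on {x..}" using K by blast
      show "(cmod (exp (- (\<i> * \<kappa>) * of_real (x - t)) * g t))\<^sup>2 \<le> exp (b * (x - t)) * (exp (b * (x - t)) * q t)" for t
        by (simp add: norm_mult power_mult_distrib q_def b_def power2_eq_square)
    qed (auto simp: q0)
    then show ?thesis
      unfolding Gx[symmetric] integral_unique[OF K] by simp
  qed
  note L2 = L2_on_R1_if_decay[OF contQ contG b QG bound]
  have "(cmod (Q x))\<^sup>2 \<le> sq_norm R1 g / b" if "x \<ge> 0" for x
    using QG[OF that] divide_right_mono[OF Gle[OF that], of b] b by simp
  with that Q L2 show ?thesis by (simp add: b_def)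
qed

text \<open>
  A particular solution \<open>v = \<i> (P + Q) / (2\<kappa>)\<close> of \<open>- v'' - \<kappa>\<^sup>2 v = g\<close> on the half-line. Besides the \<open>L\<^sup>2\<close> bound
  it needs pointwise bounds on \<open>v\<close> and its derivative \<open>V\<close>, because their boundary values enter the junction conditions.
\<close>
lemma green_solution:
  assumes \<kappa>: "Im \<kappa> > 0"
  obtains C where "C \<ge> 0" "\<And>g. g \<in> L2_on R1 \<Longrightarrow> \<exists>v V. v \<in> L2_on R1 \<and> V \<in> L2_on R1 \<and>
      primitive_on {0..} v V \<and> primitive_on {0..} V (\<lambda>x. - \<kappa>\<^sup>2 * v x - g x) \<and>
      sq_norm R1 v \<le> C * sq_norm R1 g \<and>
      (\<forall>x\<ge>0. (cmod (v x))\<^sup>2 \<le> C * sq_norm R1 g \<and> (cmod (V x))\<^sup>2 \<le> C * sq_norm R1 g)"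
proof -
  define b where "b = Im \<kappa>"
  have b: "b > 0" using \<kappa> by (simp add: b_def)
  have k0: "\<kappa> \<noteq> 0" using \<kappa> by auto
  define c where "c = \<i> / (2 * \<kappa>)"
  have c: "2 * (c * \<kappa>) = \<i>" using k0 by (simp add: c_def)
  define M where "M = (cmod c)\<^sup>2 * 4 * (1 / b\<^sup>2 + 1 / b)"
  define C where "C = M * (1 + (cmod \<kappa>)\<^sup>2)"
  have M0: "M \<ge> 0" using b by (simp add: M_def)
  show ?thesis
  proof (rule that[of C])
    show "C \<ge> 0" using M0 by (simp add: C_def)
    fix g assume g: "g \<in> L2_on R1"
    obtain P where P: "primitive_on {0..} P (\<lambda>x. \<i> * \<kappa> * P x + g x)" "P \<in> L2_on R1"
      "sq_norm R1 P \<le> sq_norm R1 g / b\<^sup>2" "\<And>x. x \<ge> 0 \<Longrightarrow> (cmod (P x))\<^sup>2 \<le> sq_norm R1 g / b"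
      using forward_solution[OF g \<kappa>] unfolding b_def by metis
    obtain Q where Q: "primitive_on {0..} Q (\<lambda>x. - (\<i> * \<kappa>) * Q x - g x)" "Q \<in> L2_on R1"
      "sq_norm R1 Q \<le> sq_norm R1 g / b\<^sup>2" "\<And>x. x \<ge> 0 \<Longrightarrow> (cmod (Q x))\<^sup>2 \<le> sq_norm R1 g / b"
      using backward_solution[OF g \<kappa>] unfolding b_def by metis
    define v where "v x = c * (P x + Q x)" for x
    define V where "V x = (\<i> * \<kappa> * c) * (P x - Q x)" for x
    have N0: "sq_norm R1 g \<ge> 0" by (rule sq_norm_nonneg)
    have v: "primitive_on {0..} v V"
      unfolding v_def[abs_def]
      by (rule primitive_on_eq[OF primitive_on_cmult[OF primitive_on_add[OF P(1) Q(1)], of c]])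
        (auto simp: V_def algebra_simps)
    have V: "primitive_on {0..} V (\<lambda>x. - \<kappa>\<^sup>2 * v x - g x)"
      unfolding V_def[abs_def]
    proof (rule primitive_on_eq[OF primitive_on_cmult[OF primitive_on_diff[OF P(1) Q(1)], of "\<i> * \<kappa> * c"]])
      fix x
      have "\<i> * \<kappa> * c * (\<i> * \<kappa> * P x + g x - (- (\<i> * \<kappa>) * Q x - g x))
          = (\<i> * \<i>) * \<kappa>\<^sup>2 * v x + \<i> * (2 * (c * \<kappa>)) * g x"
        by (simp add: v_def algebra_simps power2_eq_square)
      then show "\<i> * \<kappa> * c * (\<i> * \<kappa> * P x + g x - (- (\<i> * \<kappa>) * Q x - g x)) = - \<kappa>\<^sup>2 * v x - g x"
        by (simp add: c)
    qed auto
    have v2: "v \<in> L2_on R1" and V2: "V \<in> L2_on R1"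
      unfolding v_def[abs_def] V_def[abs_def]
      using P(2) Q(2) by (auto intro!: L2_on_cmult(1) L2_on_add(1) L2_on_diff R1.lebesgue_I)
    have MN: "(cmod c)\<^sup>2 * (4 * (sq_norm R1 g / b\<^sup>2)) \<le> M * sq_norm R1 g"
      "(cmod c)\<^sup>2 * (4 * (sq_norm R1 g / b)) \<le> M * sq_norm R1 g"
    proof -
      have "M * sq_norm R1 g = (cmod c)\<^sup>2 * (4 * (sq_norm R1 g / b\<^sup>2)) + (cmod c)\<^sup>2 * (4 * (sq_norm R1 g / b))"
        by (simp add: M_def algebra_simps)
      moreover have "0 \<le> (cmod c)\<^sup>2 * (4 * (sq_norm R1 g / b\<^sup>2))" "0 \<le> (cmod c)\<^sup>2 * (4 * (sq_norm R1 g / b))"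
        using b N0 by simp_all
      ultimately show "(cmod c)\<^sup>2 * (4 * (sq_norm R1 g / b\<^sup>2)) \<le> M * sq_norm R1 g"
        "(cmod c)\<^sup>2 * (4 * (sq_norm R1 g / b)) \<le> M * sq_norm R1 g" by linarith+
    qed
    have CM: "M * sq_norm R1 g \<le> C * sq_norm R1 g" "(cmod \<kappa>)\<^sup>2 * (M * sq_norm R1 g) \<le> C * sq_norm R1 g"
      using M0 N0 by (simp_all add: C_def algebra_simps)
    have "sq_norm R1 v \<le> (cmod c)\<^sup>2 * sq_norm R1 (\<lambda>x. P x + Q x)"
      unfolding v_def[abs_def] using P(2) Q(2) by (intro L2_on_cmult L2_on_add R1.lebesgue_I)
    also have "\<dots> \<le> (cmod c)\<^sup>2 * (4 * (sq_norm R1 g / b\<^sup>2))"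
      using L2_on_add(2)[OF R1.lebesgue_I P(2) Q(2)] P(3) Q(3) by (intro mult_left_mono) auto
    finally have vN: "sq_norm R1 v \<le> C * sq_norm R1 g" using MN CM by linarith
    have pt: "(cmod (v x))\<^sup>2 \<le> C * sq_norm R1 g \<and> (cmod (V x))\<^sup>2 \<le> C * sq_norm R1 g" if "x \<ge> 0" for x
    proof
      have "(cmod (v x))\<^sup>2 = (cmod c)\<^sup>2 * (cmod (P x + Q x))\<^sup>2"
        by (simp add: v_def norm_mult power_mult_distrib)
      also have "\<dots> \<le> (cmod c)\<^sup>2 * (4 * (sq_norm R1 g / b))"
        using cmod_add_square_le[of "P x" "Q x"] P(4)[OF that] Q(4)[OF that] by (intro mult_left_mono) auto
      finally show "(cmod (v x))\<^sup>2 \<le> C * sq_norm R1 g" using MN CM by linarith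
      have "(cmod (V x))\<^sup>2 = (cmod \<kappa>)\<^sup>2 * ((cmod c)\<^sup>2 * (cmod (P x - Q x))\<^sup>2)"
        by (simp add: V_def norm_mult power_mult_distrib)
      also have "\<dots> \<le> (cmod \<kappa>)\<^sup>2 * ((cmod c)\<^sup>2 * (4 * (sq_norm R1 g / b)))"
        using cmod_add_square_le[of "P x" "- Q x"] P(4)[OF that] Q(4)[OF that] by (intro mult_left_mono) auto
      also have "\<dots> \<le> (cmod \<kappa>)\<^sup>2 * (M * sq_norm R1 g)"
        using MN by (intro mult_left_mono) auto
      finally show "(cmod (V x))\<^sup>2 \<le> C * sq_norm R1 g" using CM by linarith
    qed
    show "\<exists>v V. v \<in> L2_on R1 \<and> V \<in> L2_on R1 \<and>
      primitive_on {0..} v V \<and> primitive_on {0..} V (\<lambda>x. - \<kappa>\<^sup>2 * v x - g x) \<and>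
      sq_norm R1 v \<le> C * sq_norm R1 g \<and>
      (\<forall>x\<ge>0. (cmod (v x))\<^sup>2 \<le> C * sq_norm R1 g \<and> (cmod (V x))\<^sup>2 \<le> C * sq_norm R1 g)"
      using v V v2 V2 vN pt by blast
  qed
qed

section \<open>Homogeneous solutions\<close>

lemma exp_imaginary_L2_on_R1:
  assumes "Im \<kappa> > 0"
  shows "(\<lambda>x. exp (\<i> * \<kappa> * of_real x)) \<in> L2_on R1"
    "sq_norm R1 (\<lambda>x. exp (\<i> * \<kappa> * of_real x)) = 1 / (2 * Im \<kappa>)"
proof -
  have eq: "(cmod (exp (\<i> * \<kappa> * of_real x)))\<^sup>2 = exp (- (2 * Im \<kappa>) * x)" for x
    by (simp add: power2_eq_square exp_add[symmetric])
  have int: "((\<lambda>x. exp (- (2 * Im \<kappa>) * x)) has_integral exp (- (2 * Im \<kappa>) * 0) / (2 * Im \<kappa>)) {0..}"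
    by (rule has_integral_exp_minus_to_infinity) (use assms in simp)
  have "(\<lambda>x. exp (- (2 * Im \<kappa>) * x)) integrable_on R1"
    using int by (subst integrable_R1_iff) blast
  moreover have "(\<lambda>x. exp (\<i> * \<kappa> * of_real x)) \<in> borel_measurable (lebesgue_on R1)"
    by (rule continuous_imp_measurable_on_sets_lebesgue[OF continuous_on_exp_linear R1.lebesgue_I])
  ultimately show "(\<lambda>x. exp (\<i> * \<kappa> * of_real x)) \<in> L2_on R1"
    using L2_on_bound(1)[OF R1.lebesgue_I] eq by fastforce
  show "sq_norm R1 (\<lambda>x. exp (\<i> * \<kappa> * of_real x)) = 1 / (2 * Im \<kappa>)"
    unfolding sq_norm_def eq integral_R1_eq using integral_unique[OF int] by simp
qed

text \<open>
  The integrating factor turns \<open>Y\<close> into a primitive of zero.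
\<close>
lemma linear_ode_exp:
  fixes Y :: "real \<Rightarrow> complex"
  assumes Y: "primitive_on J Y (\<lambda>x. c * Y x)" and J: "is_interval J" "closed J" "0 \<in> J" "J \<subseteq> {0..}" and "x \<in> J"
  shows "Y x = Y 0 * exp (c * of_real x)"
proof -
  have "primitive_on J (\<lambda>x. exp (- c * of_real x) * Y x) (\<lambda>x. 0)"
    by (rule primitive_on_eq[OF primitive_on_mult_C1[OF Y J(1,2) has_vector_derivative_exp_linear, of "- c"]])
      (auto intro!: continuous_intros simp: algebra_simps)
  moreover have "0 \<le> x" using J(4) \<open>x \<in> J\<close> by auto
  moreover have "{0..x} \<subseteq> J"
    using mem_is_interval_1_I[OF J(1,3) \<open>x \<in> J\<close>] by auto
  ultimately have "exp (- c * of_real x) * Y x = Y 0"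
    using primitive_onD(3)[of J "\<lambda>x. exp (- c * of_real x) * Y x" "\<lambda>x. 0" 0 x] by simp
  then show ?thesis by (simp add: exp_minus field_simps)
qed

text \<open>
  The equation \<open>U'' = - \<kappa>\<^sup>2 U\<close> factors: for \<open>c = \<plusminus>\<i>\<kappa>\<close> the combination \<open>V + c U\<close> solves
  \<open>Y' = c Y\<close>, and \<open>U\<close> and \<open>V\<close> are recovered from the two combinations.
\<close>
lemma helmholtz_solutions:
  assumes U: "primitive_on J U V" and V: "primitive_on J V w"
    and N: "negligible N" "\<And>x. x \<in> J - N \<Longrightarrow> w x = - \<kappa>\<^sup>2 * U x"
    and J: "is_interval J" "closed J" "0 \<in> J" "J \<subseteq> {0..}" and "\<kappa> \<noteq> 0"
  obtains A B where
    "\<And>x. x \<in> J \<Longrightarrow> U x = A * exp (\<i> * \<kappa> * of_real x) + B * exp (- (\<i> * \<kappa>) * of_real x)"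
    "\<And>x. x \<in> J \<Longrightarrow> V x = \<i> * \<kappa> * (A * exp (\<i> * \<kappa> * of_real x) - B * exp (- (\<i> * \<kappa>) * of_real x))"
proof -
  have V': "primitive_on J V (\<lambda>x. - \<kappa>\<^sup>2 * U x)"
    by (rule primitive_on_cong[OF V refl N])
  have "primitive_on J (\<lambda>x. V x + c * U x) (\<lambda>x. c * (V x + c * U x))" if "c\<^sup>2 = - \<kappa>\<^sup>2" for c
  proof -
    have "primitive_on J V (\<lambda>x. c\<^sup>2 * U x)"
      using V' unfolding that .
    from primitive_on_add[OF this primitive_on_cmult[OF U, of c]] show ?thesis
      by (simp add: algebra_simps power2_eq_square)
  qed
  from linear_ode_exp[OF this J]
  have Y: "V x + c * U x = (V 0 + c * U 0) * exp (c * of_real x)" if "c\<^sup>2 = - \<kappa>\<^sup>2" "x \<in> J" for c x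
    using that by blast
  define c where "c = \<i> * \<kappa>"
  have c: "c\<^sup>2 = - \<kappa>\<^sup>2" "(- c)\<^sup>2 = - \<kappa>\<^sup>2" "c \<noteq> 0"
    using \<open>\<kappa> \<noteq> 0\<close> by (simp_all add: c_def power_mult_distrib)
  have solve: "u = p / (2 * c) * e1 + - r / (2 * c) * e2" "v = c * (p / (2 * c) * e1 - - r / (2 * c) * e2)"
    if "v + c * u = p * e1" "v - c * u = r * e2" for u v p r e1 e2 :: complex
  proof -
    have "2 * c * u = p * e1 - r * e2" "2 * v = p * e1 + r * e2"
      unfolding that[symmetric] by simp_all
    then show "u = p / (2 * c) * e1 + - r / (2 * c) * e2" "v = c * (p / (2 * c) * e1 - - r / (2 * c) * e2)"
      using c(3) by (simp_all add: field_simps)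
  qed
  have *: "V x + c * U x = (V 0 + c * U 0) * exp (c * of_real x)"
    "V x - c * U x = (V 0 - c * U 0) * exp (- c * of_real x)" if "x \<in> J" for x
    using Y[OF c(1) that] Y[OF c(2) that] by simp_all
  show ?thesis
    using that[of "(V 0 + c * U 0) / (2 * c)" "- (V 0 - c * U 0) / (2 * c)"] solve[OF *]
    unfolding c_def[symmetric] by blast
qed

text \<open>
  The modulus of the function is at least \<open>\<bar>B\<bar>\<close>, so its square integral over \<open>[0,T]\<close> is at least \<open>\<bar>B\<bar>\<^sup>2 T\<close>.
\<close>
lemma growing_exponential_not_L2:
  assumes "Im \<kappa> > 0" and L2: "(\<lambda>x. B * exp (- (\<i> * \<kappa>) * of_real x)) \<in> L2_on R1"
  shows "B = 0"
proof (rule ccontr)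
  assume "B \<noteq> 0"
  define f where "f x = (cmod (B * exp (- (\<i> * \<kappa>) * of_real x)))\<^sup>2" for x
  have f: "f integrable_on {0..}" "f integrable_on {0..T}" for T
    using L2_on_R1_square(1)[OF L2] L2_on_R1_square(4)[OF L2, of T]
    by (simp_all add: f_def[abs_def] absolutely_integrable_on_def)
  have le: "(cmod B)\<^sup>2 \<le> f x" if "x \<ge> 0" for x
  proof -
    have "1 \<le> exp (Im \<kappa> * x)" using assms(1) that by simp
    then have "cmod B * 1 \<le> cmod B * cmod (exp (- (\<i> * \<kappa>) * of_real x))"
      by (intro mult_left_mono) auto
    then show ?thesis unfolding f_def norm_mult by (intro power_mono) auto
  qed
  define T where "T = (integral {0..} f + 1) / (cmod B)\<^sup>2"
  have T: "T \<ge> 0"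
    using integral_nonneg[OF f(1)] by (simp add: T_def f_def)
  have "integral {0..} f + 1 = integral {0..T} (\<lambda>x. (cmod B)\<^sup>2)"
    using T \<open>B \<noteq> 0\<close> by (simp add: T_def)
  also have "\<dots> \<le> integral {0..T} f"
    using le f(2) by (intro integral_le) auto
  also have "\<dots> \<le> integral {0..} f"
    using f by (intro integral_subset_le) (auto simp: f_def)
  finally show False by simp
qed

section \<open>The operator on the tadpole graph\<close>

locale tadpole =
  fixes L \<alpha> :: real
  assumes L_pos: "L > 0" and \<alpha>_pos: "\<alpha> > 0"
begin

sublocale R2: open_interval "R2 L"
  using L_pos by (rule open_interval_R2)

lemma continuous_L2_on_R2:
  assumes "continuous_on {0..L} f" "\<And>x. x \<in> {0..L} \<Longrightarrow> cmod (f x) \<le> B"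
  shows "f \<in> L2_on (R2 L)" "sq_norm (R2 L) f \<le> B\<^sup>2 * L"
proof -
  have R2: "R2 L \<subseteq> {0..L}" by (auto simp: R2_def)
  have "f \<in> borel_measurable (lebesgue_on (R2 L))"
    using continuous_on_subset[OF assms(1) R2] R2.lebesgue_I by (rule continuous_imp_measurable_on_sets_lebesgue)
  moreover have "((\<lambda>x. B\<^sup>2) has_integral B\<^sup>2 * L) (R2 L)"
    using has_integral_const_real[of "B\<^sup>2" 0 L] L_pos
    by (simp add: R2_def has_integral_Icc_iff_Ioo mult.commute)
  moreover have "(cmod (f x))\<^sup>2 \<le> B\<^sup>2" if "x \<in> R2 L" for x
    using assms(2) that R2 by (intro power_mono) auto
  ultimately show "f \<in> L2_on (R2 L)" "sq_norm (R2 L) f \<le> B\<^sup>2 * L"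
    using L2_on_bound[OF R2.lebesgue_I, of f "\<lambda>x. B\<^sup>2"] by (auto simp: has_integral_iff)
qed

lemma continuous_imp_L2_on_R2:
  assumes "continuous_on {0..L} f"
  shows "f \<in> L2_on (R2 L)"
proof -
  have "bounded (f ` {0..L})"
    by (rule compact_imp_bounded[OF compact_continuous_image[OF assms compact_Icc]])
  then obtain B where "\<And>x. x \<in> {0..L} \<Longrightarrow> cmod (f x) \<le> B"
    unfolding bounded_iff by blast
  then show ?thesis using continuous_L2_on_R2[OF assms] by blast
qed

text \<open>
  The domain of \<open>H\<close> in terms of continuous representatives: the junction conditions become statements about values of the
  continuous functions \<open>U1\<close>, \<open>V1\<close>, \<open>U2\<close>, \<open>V2\<close>.
\<close>
definition dom_rep where
  "dom_rep u U1 V1 w1 U2 V2 w2 \<longleftrightarrow> R1.H2_rep (fst u) U1 V1 w1 \<and> R2.H2_rep (snd u) U2 V2 w2 \<and>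
     U1 0 = U2 0 \<and> U2 0 = U2 L \<and> V1 0 + V2 0 - V2 L = \<i> * of_real \<alpha> * U1 0"

lemma boundary_points: "0 \<in> closure R1" "0 \<in> closure (R2 L)" "L \<in> closure (R2 L)"
  using L_pos by (simp_all add: closure_R1 closure_R2)

lemma dom_rep_imp_dom:
  assumes "dom_rep u U1 V1 w1 U2 V2 w2"
  shows "u \<in> tadpole_dom L \<alpha>"
proof -
  obtain u1 u2 where u: "u = (u1, u2)" by fastforce
  have r: "R1.H2_rep u1 U1 V1 w1" "R2.H2_rep u2 U2 V2 w2"
    using assms by (simp_all add: dom_rep_def u)
  note b = R1.H2_repD(4,5)[OF r(1) boundary_points(1)] R2.H2_repD(4,5)[OF r(2) boundary_points(2)]
    R2.H2_repD(4,5)[OF r(2) boundary_points(3)]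
  show ?thesis
    using assms R1.H2_repD(1)[OF r(1)] R2.H2_repD(1)[OF r(2)]
    by (simp add: u tadpole_dom_def dom_rep_def b)
qed

lemma dom_imp_dom_rep:
  assumes "u \<in> tadpole_dom L \<alpha>"
  obtains U1 V1 w1 U2 V2 w2 where "dom_rep u U1 V1 w1 U2 V2 w2"
proof -
  obtain u1 u2 where u: "u = (u1, u2)" by fastforce
  have "u1 \<in> sobolev_H2 R1" "u2 \<in> sobolev_H2 (R2 L)"
    using assms by (simp_all add: tadpole_dom_def u)
  then obtain U1 V1 w1 U2 V2 w2 where r: "R1.H2_rep u1 U1 V1 w1" "R2.H2_rep u2 U2 V2 w2"
    using R1.sobolev_H2_rep R2.sobolev_H2_rep by metis
  note b = R1.H2_repD(4,5)[OF r(1) boundary_points(1)] R2.H2_repD(4,5)[OF r(2) boundary_points(2)]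
    R2.H2_repD(4,5)[OF r(2) boundary_points(3)]
  have "dom_rep u U1 V1 w1 U2 V2 w2"
    using assms r by (simp add: u tadpole_dom_def dom_rep_def b)
  then show ?thesis using that by blast
qed

lemma dom_rep_H:
  assumes "dom_rep u U1 V1 w1 U2 V2 w2"
  shows "AE x in lebesgue_on R1. fst (tadpole_H L u) x = - w1 x"
    "AE x in lebesgue_on (R2 L). snd (tadpole_H L u) x = - w2 x"
    "AE x in lebesgue_on R1. fst u x = U1 x" "AE x in lebesgue_on (R2 L). snd u x = U2 x"
    "AE x in lebesgue_on R1. fst (minus_scalar (tadpole_H L) z u) x = - w1 x - z * U1 x"
    "AE x in lebesgue_on (R2 L). snd (minus_scalar (tadpole_H L) z u) x = - w2 x - z * U2 x"
proof -
  have r: "R1.H2_rep (fst u) U1 V1 w1" "R2.H2_rep (snd u) U2 V2 w2"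
    using assms by (simp_all add: dom_rep_def)
  show 1: "AE x in lebesgue_on R1. fst (tadpole_H L u) x = - w1 x"
    using R1.H2_repD(3)[OF r(1)] by eventually_elim (simp add: tadpole_H_def)
  show 2: "AE x in lebesgue_on (R2 L). snd (tadpole_H L u) x = - w2 x"
    using R2.H2_repD(3)[OF r(2)] by eventually_elim (simp add: tadpole_H_def)
  show 3: "AE x in lebesgue_on R1. fst u x = U1 x" and 4: "AE x in lebesgue_on (R2 L). snd u x = U2 x"
    using r by (simp_all add: R1.H2_rep_def R2.H2_rep_def)
  show "AE x in lebesgue_on R1. fst (minus_scalar (tadpole_H L) z u) x = - w1 x - z * U1 x"
    using 1 3 by eventually_elim (simp add: minus_scalar_def)
  show "AE x in lebesgue_on (R2 L). snd (minus_scalar (tadpole_H L) z u) x = - w2 x - z * U2 x"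
    using 2 4 by eventually_elim (simp add: minus_scalar_def)
qed

lemma tadpole_norm_sq:
  assumes "fst v \<in> L2_on R1" "snd v \<in> L2_on (R2 L)"
  shows "tadpole_norm L v = sqrt (sq_norm R1 (fst v) + sq_norm (R2 L) (snd v))"
  unfolding tadpole_norm_def using sq_norm_eq[OF R1.lebesgue_I assms(1)] sq_norm_eq[OF R2.lebesgue_I assms(2)] by simp

lemma tadpole_norm_AE:
  assumes "f1 \<in> L2_on R1" "f2 \<in> L2_on (R2 L)"
    and 1: "AE x in lebesgue_on R1. fst v x = f1 x" and 2: "AE x in lebesgue_on (R2 L). snd v x = f2 x"
  shows "tadpole_norm L v = sqrt (sq_norm R1 f1 + sq_norm (R2 L) f2)"
proof -
  have "AE x in lebesgue_on R1. f1 x = fst v x" "AE x in lebesgue_on (R2 L). f2 x = snd v x"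
    using 1 by (eventually_elim, simp) (use 2 in \<open>eventually_elim, simp\<close>)
  then have "fst v \<in> L2_on R1" "snd v \<in> L2_on (R2 L)"
    using L2_on_cong_AE[OF R1.lebesgue_I assms(1)] L2_on_cong_AE[OF R2.lebesgue_I assms(2)] by blast+
  then show ?thesis
    using sq_norm_cong_AE[OF R1.lebesgue_I 1] sq_norm_cong_AE[OF R2.lebesgue_I 2] by (simp add: tadpole_norm_sq)
qed

lemma dom_rep_L2:
  assumes "dom_rep u U1 V1 w1 U2 V2 w2"
  shows "U1 \<in> L2_on R1" "U2 \<in> L2_on (R2 L)" "(\<lambda>x. - w1 x - z * U1 x) \<in> L2_on R1" "(\<lambda>x. - w2 x - z * U2 x) \<in> L2_on (R2 L)"
proof -
  show 1: "U1 \<in> L2_on R1" and 2: "U2 \<in> L2_on (R2 L)"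
    using assms by (simp_all add: dom_rep_def R1.H2_rep_def R2.H2_rep_def)
  have w: "w1 \<in> L2_on R1" "w2 \<in> L2_on (R2 L)"
    using assms by (simp_all add: dom_rep_def R1.H2_rep_def R2.H2_rep_def)
  show "(\<lambda>x. - w1 x - z * U1 x) \<in> L2_on R1"
    using L2_on_diff[OF R1.lebesgue_I L2_on_cmult(1)[OF R1.lebesgue_I w(1), of "-1"] L2_on_cmult(1)[OF R1.lebesgue_I 1, of z]] by simp
  show "(\<lambda>x. - w2 x - z * U2 x) \<in> L2_on (R2 L)"
    using L2_on_diff[OF R2.lebesgue_I L2_on_cmult(1)[OF R2.lebesgue_I w(2), of "-1"] L2_on_cmult(1)[OF R2.lebesgue_I 2, of z]] by simp
qed

lemma dom_rep_norms:
  assumes "dom_rep u U1 V1 w1 U2 V2 w2"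
  shows "tadpole_norm L u = sqrt (sq_norm R1 U1 + sq_norm (R2 L) U2)"
    "tadpole_norm L (minus_scalar (tadpole_H L) z u) =
      sqrt (sq_norm R1 (\<lambda>x. - w1 x - z * U1 x) + sq_norm (R2 L) (\<lambda>x. - w2 x - z * U2 x))"
  using tadpole_norm_AE[OF dom_rep_L2(1,2)[OF assms] dom_rep_H(3,4)[OF assms]]
    tadpole_norm_AE[OF dom_rep_L2(3,4)[OF assms] dom_rep_H(5,6)[OF assms]] by auto

lemma dom_rep_classical:
  assumes "primitive_on {0..} U1 V1" "primitive_on {0..} V1 w1" 
    and "U1 \<in> L2_on R1" "V1 \<in> L2_on R1" "w1 \<in> L2_on R1"
    and "primitive_on {0..L} U2 V2" "primitive_on {0..L} V2 w2" 
    and "w2 \<in> L2_on (R2 L)"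
    and "U1 0 = U2 0" "U2 0 = U2 L" "V1 0 + V2 0 - V2 L = \<i> * of_real \<alpha> * U1 0"
  shows "dom_rep (U1, U2) U1 V1 w1 U2 V2 w2"
proof -
  have "continuous_on {0..L} U2" "continuous_on {0..L} V2"
    using primitive_on_continuous assms(6,7) is_interval_cc by blast+
  then have "U2 \<in> L2_on (R2 L)" "V2 \<in> L2_on (R2 L)"
    by (simp_all add: continuous_imp_L2_on_R2)
  with assms show ?thesis
    by (simp add: dom_rep_def R1.H2_rep_def R2.H2_rep_def closure_R1 closure_R2 L_pos)
qed

text \<open>
  Up to a factor, the determinant of the junction conditions for the solutions of \<open>-u'' = \<kappa>\<^sup>2 u\<close> that decay on the
  half-line.
\<close>
definition characteristic :: "complex \<Rightarrow> complex" where
  "characteristic \<kappa> = exp (\<i> * \<kappa> * of_real L) * (\<kappa> + of_real \<alpha>) - (3 * \<kappa> - of_real \<alpha>)"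

section \<open>Eigenvectors\<close>

text \<open>
  A single point where one of the continuous representatives does not vanish excludes the zero element.
\<close>
lemma eigenvectorI:
  assumes u: "dom_rep u U1 V1 w1 U2 V2 w2"
    and 1: "\<And>x. x \<in> R1 \<Longrightarrow> w1 x = - z * U1 x" and 2: "\<And>x. x \<in> R2 L \<Longrightarrow> w2 x = - z * U2 x"
    and nz: "(x \<ge> 0 \<and> U1 x \<noteq> 0) \<or> (x \<in> {0..L} \<and> U2 x \<noteq> 0)"
  shows "is_eigenvector L (tadpole_dom L \<alpha>) (tadpole_H L) z u"
  unfolding is_eigenvector_def
proof (intro conjI)
  show "u \<in> tadpole_dom L \<alpha>" by (rule dom_rep_imp_dom[OF u])
  have cont: "continuous_on (closure R1) U1" "continuous_on (closure (R2 L)) U2"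
    using u R1.primitive_on_continuous_closure R2.primitive_on_continuous_closure
    by (auto simp: dom_rep_def R1.H2_rep_def R2.H2_rep_def)
  show "\<not> tadpole_eq L u (\<lambda>x. 0, \<lambda>x. 0)"
  proof
    assume "tadpole_eq L u (\<lambda>x. 0, \<lambda>x. 0)"
    then have z: "AE x in lebesgue_on R1. fst u x = 0" "AE x in lebesgue_on (R2 L). snd u x = 0"
      by (simp_all add: tadpole_eq_def)
    have 0: "AE x in lebesgue_on R1. U1 x = 0" "AE x in lebesgue_on (R2 L). U2 x = 0"
      using z(1) dom_rep_H(3)[OF u] by (eventually_elim, simp)
        (use z(2) dom_rep_H(4)[OF u] in \<open>eventually_elim, simp\<close>)
    have "U1 y = 0" if "y \<ge> 0" for y
      by (rule R1.continuous_AE_eq[OF cont(1) continuous_on_const 0(1)])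
        (use that in \<open>simp add: closure_R1\<close>)
    moreover have "U2 y = 0" if "y \<in> {0..L}" for y
      by (rule R2.continuous_AE_eq[OF cont(2) continuous_on_const 0(2)])
        (use that in \<open>simp add: closure_R2 L_pos\<close>)
    ultimately show False using nz by blast
  qed
  have "AE x in lebesgue_on R1. fst (tadpole_H L u) x = z * fst u x"
    using R1.AE_in_I dom_rep_H(1,3)[OF u] by eventually_elim (simp add: 1)
  moreover have "AE x in lebesgue_on (R2 L). snd (tadpole_H L u) x = z * snd u x"
    using R2.AE_in_I dom_rep_H(2,4)[OF u] by eventually_elim (simp add: 2)
  ultimately show "tadpole_eq L (tadpole_H L u) (\<lambda>x. z * fst u x, \<lambda>x. z * snd u x)"
    by (simp add: tadpole_eq_def)
qed

lemma primitive_on_exp_scaled: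
  "primitive_on S (\<lambda>x. a * exp (c * of_real x)) (\<lambda>x. a * c * exp (c * of_real x))" for a c :: complex
  using primitive_on_cmult[OF primitive_on_exp[of S c], of a] by (simp add: mult.assoc)

text \<open>
  On the loop the eigenvector is \<open>exp (\<i>\<kappa>x) + E exp (-\<i>\<kappa>x)\<close>, which is symmetric under \<open>x \<mapsto> L - x\<close>; the common
  value \<open>1 + E\<close> at the junction fixes the function on the half-line. It is nonzero since \<open>\<bar>E\<bar> < 1\<close>.
\<close>
lemma eigenvalue_if_characteristic_zero:
  assumes \<kappa>: "Im \<kappa> > 0" and zero: "characteristic \<kappa> = 0"
  shows "is_eigenvalue L (tadpole_dom L \<alpha>) (tadpole_H L) (\<kappa>\<^sup>2)"
proof -
  define E where "E = exp (\<i> * \<kappa> * of_real L)"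
  have E: "E \<noteq> 0" "exp (- (\<i> * \<kappa>) * of_real L) = 1 / E"
    by (simp_all add: E_def exp_minus inverse_eq_divide)
  define U1 where "U1 x = (1 + E) * exp (\<i> * \<kappa> * of_real x)" for x
  define V1 where "V1 x = (1 + E) * (\<i> * \<kappa>) * exp (\<i> * \<kappa> * of_real x)" for x
  define w1 where "w1 x = (1 + E) * (\<i> * \<kappa>) * (\<i> * \<kappa>) * exp (\<i> * \<kappa> * of_real x)" for x
  define U2 where "U2 x = 1 * exp (\<i> * \<kappa> * of_real x) + E * exp (- (\<i> * \<kappa>) * of_real x)" for x
  define V2 where "V2 x = 1 * (\<i> * \<kappa>) * exp (\<i> * \<kappa> * of_real x) + E * (- (\<i> * \<kappa>)) * exp (- (\<i> * \<kappa>) * of_real x)" for x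
  define w2 where "w2 x = 1 * (\<i> * \<kappa>) * (\<i> * \<kappa>) * exp (\<i> * \<kappa> * of_real x) 
    + E * (- (\<i> * \<kappa>)) * (- (\<i> * \<kappa>)) * exp (- (\<i> * \<kappa>) * of_real x)" for x
  have rep: "dom_rep (U1, U2) U1 V1 w1 U2 V2 w2"
  proof (rule dom_rep_classical)
    show "primitive_on {0..} U1 V1" "primitive_on {0..} V1 w1"
      unfolding U1_def[abs_def] V1_def[abs_def] w1_def[abs_def] by (rule primitive_on_exp_scaled)+
    show "primitive_on {0..L} U2 V2" "primitive_on {0..L} V2 w2"
      unfolding U2_def[abs_def] V2_def[abs_def] w2_def[abs_def]
      by (rule primitive_on_add[OF primitive_on_exp_scaled primitive_on_exp_scaled])+
    show "U1 \<in> L2_on R1" "V1 \<in> L2_on R1" "w1 \<in> L2_on R1"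
      unfolding U1_def[abs_def] V1_def[abs_def] w1_def[abs_def]
      using L2_on_cmult(1)[OF R1.lebesgue_I exp_imaginary_L2_on_R1(1)[OF \<kappa>]] by blast+
    show "w2 \<in> L2_on (R2 L)"
      unfolding w2_def[abs_def] by (intro continuous_imp_L2_on_R2 continuous_intros)
    show "U1 0 = U2 0" by (simp add: U1_def U2_def)
    show "U2 0 = U2 L"
      unfolding U2_def E(2) E_def[symmetric] using E(1) by simp
    have "V1 0 + V2 0 - V2 L - \<i> * of_real \<alpha> * U1 0 = - \<i> * characteristic \<kappa>"
      unfolding V1_def V2_def U1_def E(2) E_def[symmetric] characteristic_def using E(1)
      by (simp add: field_simps)
    then show "V1 0 + V2 0 - V2 L = \<i> * of_real \<alpha> * U1 0"
      using zero by simp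
  qed
  have "w1 x = - (\<kappa>\<^sup>2) * U1 x" "w2 x = - (\<kappa>\<^sup>2) * U2 x" for x
    by (simp_all add: w1_def U1_def w2_def U2_def algebra_simps power2_eq_square)
  moreover have "U1 0 \<noteq> 0"
  proof
    assume "U1 0 = 0"
    then have "E = - 1" by (simp add: U1_def add_eq_0_iff)
    then have "cmod E = 1" by simp
    then show False using \<kappa> L_pos by (simp add: E_def)
  qed
  ultimately have "is_eigenvector L (tadpole_dom L \<alpha>) (tadpole_H L) (\<kappa>\<^sup>2) (U1, U2)"
    by (intro eigenvectorI[OF rep, where x = 0]) auto
  then show ?thesis by (auto simp: is_eigenvalue_def)
qed

text \<open>
  A full number of periods on the loop makes the values at the junction vanish and the two derivatives cancel, so the
  half-line does not notice the oscillation.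
\<close>
lemma sine_eigenvector:
  fixes k :: nat
  assumes "k \<ge> 1"
  defines "m \<equiv> 2 * real k * pi / L"
  shows "is_eigenvector L (tadpole_dom L \<alpha>) (tadpole_H L) (of_real (m\<^sup>2))
             ((\<lambda>x. 0), (\<lambda>x. of_real (sqrt 2 / sqrt L * sin (m * x))))"
proof -
  define c where "c = sqrt 2 / sqrt L"
  have c: "c > 0" using L_pos by (simp add: c_def)
  have m: "m > 0" "m * L = 2 * pi * real k"
    using L_pos assms(1) by (simp_all add: m_def)
  have sin_cos: "sin (m * L) = 0" "cos (m * L) = 1"
    unfolding m(2) using sin_2npi[of k] cos_2npi[of k] by (simp_all add: mult.commute mult.left_commute)
  define U2 where "U2 x = complex_of_real (c * sin (m * x))" for x
  define V2 where "V2 x = complex_of_real (c * m * cos (m * x))" for x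
  define w2 where "w2 x = complex_of_real (- (c * m * m * sin (m * x)))" for x
  have "dom_rep (\<lambda>x. 0, U2) (\<lambda>x. 0) (\<lambda>x. 0) (\<lambda>x. 0) U2 V2 w2"
  proof (rule dom_rep_classical)
    show "primitive_on {0..} (\<lambda>x. 0::complex) (\<lambda>x. 0)" "primitive_on {0..} (\<lambda>x. 0::complex) (\<lambda>x. 0)"
      by (rule primitive_on_const)+
    have "((\<lambda>x. c * sin (m * x)) has_real_derivative c * m * cos (m * x)) (at x within {0..L})" 
      "((\<lambda>x. c * m * cos (m * x)) has_real_derivative - (c * m * m * sin (m * x))) (at x within {0..L})" for x
      by (auto intro!: derivative_eq_intros)
    then have "(U2 has_vector_derivative V2 x) (at x within {0..L})" "(V2 has_vector_derivative w2 x) (at x within {0..L})" for x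
      unfolding U2_def[abs_def] V2_def[abs_def] w2_def
      by (intro has_vector_derivative_of_real; simp add: has_real_derivative_iff_has_vector_derivative)+
    then show "primitive_on {0..L} U2 V2" "primitive_on {0..L} V2 w2"
      by (intro primitive_on_ftc; simp add: V2_def[abs_def] w2_def[abs_def] continuous_intros)+
    show "w2 \<in> L2_on (R2 L)"
      unfolding w2_def[abs_def] by (intro continuous_imp_L2_on_R2 continuous_intros)
    show "0 = U2 0" "U2 0 = U2 L" "0 + V2 0 - V2 L = \<i> * of_real \<alpha> * 0"
      using sin_cos by (simp_all add: U2_def V2_def)
    show "(\<lambda>x. 0) \<in> L2_on R1" "(\<lambda>x. 0) \<in> L2_on R1" "(\<lambda>x. 0) \<in> L2_on R1"
      by (simp_all add: L2_on_def)
  qed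
  moreover have "w2 x = - of_real (m\<^sup>2) * U2 x" for x
    by (simp add: w2_def U2_def power2_eq_square)
  moreover define x where "x = L / (4 * real k)"
  have "m * x = pi / 2" using L_pos assms(1) by (simp add: m_def x_def)
  then have "sin (m * x) = 1" by (simp only: sin_pi_half)
  then have "U2 x \<noteq> 0" using c by (simp add: U2_def)
  moreover have "x \<in> {0..L}"
    using L_pos assms(1) by (simp add: x_def field_simps)
  ultimately show ?thesis
    using eigenvectorI[of "(\<lambda>x. 0, U2)" "\<lambda>x. 0" "\<lambda>x. 0" "\<lambda>x. 0" U2 V2 w2 "of_real (m\<^sup>2)" x]
    by (simp add: U2_def[abs_def] c_def)
qed

section \<open>The half-line in the spectrum\<close>

text \<open>
  A singular family for \<open>s = k\<^sup>2\<close>. With \<open>\<kappa> = k + \<i>\<epsilon>\<close>, the function \<open>exp (\<i>\<kappa>x)\<close> has squared norm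
  \<open>1 / (2\<epsilon>)\<close>, and \<open>H - s\<close> multiplies it by \<open>\<kappa>\<^sup>2 - s = O(\<epsilon>)\<close>. On the loop it is completed by
  \<open>1 + d x (x - L)\<close>, which takes the value \<open>1\<close> at both ends; the coefficient \<open>d\<close> is fixed by the derivative condition and
  stays bounded. So a bounded inverse would bound \<open>1 / (2\<epsilon>)\<close>.
\<close>
lemma nonneg_in_spectrum:
  assumes "s \<ge> 0"
  shows "complex_of_real s \<in> op_spectrum L (tadpole_dom L \<alpha>) (tadpole_H L)"
proof (rule ccontr)
  assume "complex_of_real s \<notin> op_spectrum L (tadpole_dom L \<alpha>) (tadpole_H L)"
  then obtain C where C: "\<And>u. u \<in> tadpole_dom L \<alpha> \<Longrightarrow>
      tadpole_norm L u \<le> C * tadpole_norm L (minus_scalar (tadpole_H L) (of_real s) u)"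
    unfolding op_spectrum_def resolvent_set_def by blast
  define k where "k = sqrt s"
  have k: "k \<ge> 0" "k\<^sup>2 = s" using assms by (simp_all add: k_def)
  define D where "D = (k + 1 + \<alpha>) / (2 * L)"
  define B where "B = 2 * D + s * (1 + D * L\<^sup>2)"
  define M where "M = (2 * k + 1)\<^sup>2 / 2 + B\<^sup>2 * L"
  have M0: "M \<ge> 0" using L_pos by (simp add: M_def)
  have key: "1 / (2 * \<epsilon>) \<le> C\<^sup>2 * M" if e: "0 < \<epsilon>" "\<epsilon> \<le> 1" for \<epsilon>
  proof -
    define \<kappa> where "\<kappa> = Complex k \<epsilon>"
    have \<kappa>: "Im \<kappa> > 0" using e by (simp add: \<kappa>_def)
    define d where "d = \<i> * (\<kappa> - of_real \<alpha>) / (2 * of_real L)"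
    have d: "2 * d * of_real L = \<i> * (\<kappa> - of_real \<alpha>)" using L_pos by (simp add: d_def)
    have "cmod \<kappa> \<le> k + 1"
      using cmod_le[of \<kappa>] e k by (simp add: \<kappa>_def)
    then have "cmod (\<kappa> - of_real \<alpha>) \<le> k + 1 + \<alpha>"
      using norm_triangle_ineq4[of \<kappa> "of_real \<alpha>"] \<alpha>_pos by simp
    then have dD: "cmod d \<le> D"
      using L_pos unfolding d_def D_def by (simp add: norm_divide norm_mult divide_right_mono)
    define U1 where "U1 x = 1 * exp (\<i> * \<kappa> * of_real x)" for x
    define V1 where "V1 x = 1 * (\<i> * \<kappa>) * exp (\<i> * \<kappa> * of_real x)" for x
    define w1 where "w1 x = 1 * (\<i> * \<kappa>) * (\<i> * \<kappa>) * exp (\<i> * \<kappa> * of_real x)" for x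
    define U2 where "U2 x = 1 + d * of_real (x * (x - L))" for x
    define V2 where "V2 x = d * of_real (2 * x - L)" for x
    define w2 where "w2 = (\<lambda>x::real. d * of_real 2)"
    have rep: "dom_rep (U1, U2) U1 V1 w1 U2 V2 w2"
    proof (rule dom_rep_classical)
      show "primitive_on {0..} U1 V1" "primitive_on {0..} V1 w1"
        unfolding U1_def[abs_def] V1_def[abs_def] w1_def[abs_def] by (rule primitive_on_exp_scaled)+
      show "U1 \<in> L2_on R1" "V1 \<in> L2_on R1" "w1 \<in> L2_on R1"
        unfolding U1_def[abs_def] V1_def[abs_def] w1_def[abs_def]
        using L2_on_cmult(1)[OF R1.lebesgue_I exp_imaginary_L2_on_R1(1)[OF \<kappa>]] by blast+
      have "((\<lambda>x. x * (x - L)) has_real_derivative (2 * x - L)) (at x within {0..L})"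
        "((\<lambda>x. 2 * x - L) has_real_derivative 2) (at x within {0..L})" for x
        by (auto intro!: derivative_eq_intros)
      then have p: "primitive_on {0..L} (\<lambda>x. complex_of_real (x * (x - L))) (\<lambda>x. of_real (2 * x - L))"
        "primitive_on {0..L} (\<lambda>x. complex_of_real (2 * x - L)) (\<lambda>x. of_real 2)"
        by (intro primitive_on_ftc has_vector_derivative_of_real continuous_intros;
            simp add: has_real_derivative_iff_has_vector_derivative)+
      show "primitive_on {0..L} U2 V2"
        using primitive_on_add[OF primitive_on_const[of _ 1] primitive_on_cmult[OF p(1), of d]]
        by (simp add: U2_def[abs_def] V2_def[abs_def])
      show "primitive_on {0..L} V2 w2"
        unfolding V2_def[abs_def] w2_def by (rule primitive_on_cmult[OF p(2)])
      show "w2 \<in> L2_on (R2 L)"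
        unfolding w2_def by (intro continuous_imp_L2_on_R2 continuous_intros)
      show "U1 0 = U2 0" "U2 0 = U2 L" by (simp_all add: U1_def U2_def)
      have "V1 0 + V2 0 - V2 L = \<i> * \<kappa> - 2 * d * of_real L"
        by (simp add: V1_def V2_def algebra_simps)
      also have "\<dots> = \<i> * of_real \<alpha> * U1 0" unfolding d by (simp add: U1_def algebra_simps)
      finally show "V1 0 + V2 0 - V2 L = \<i> * of_real \<alpha> * U1 0" .
    qed
    have U1norm: "sq_norm R1 U1 = 1 / (2 * \<epsilon>)"
      using exp_imaginary_L2_on_R1(2)[OF \<kappa>] by (simp add: U1_def[abs_def] \<kappa>_def)
    have "\<kappa>\<^sup>2 - of_real s = of_real \<epsilon> * (2 * \<i> * of_real k - of_real \<epsilon>)"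
      unfolding k(2)[symmetric] by (simp add: \<kappa>_def complex_eq_iff power2_eq_square)
    moreover have "cmod (2 * \<i> * of_real k - of_real \<epsilon>) \<le> 2 * k + 1"
      using norm_triangle_ineq4[of "2 * \<i> * of_real k" "of_real \<epsilon>"] e k by (simp add: norm_mult)
    ultimately have "cmod (\<kappa>\<^sup>2 - of_real s) \<le> \<epsilon> * (2 * k + 1)"
      using e by (simp add: norm_mult)
    then have r: "(cmod (\<kappa>\<^sup>2 - of_real s))\<^sup>2 \<le> \<epsilon>\<^sup>2 * (2 * k + 1)\<^sup>2"
      unfolding power_mult_distrib[symmetric] by (intro power_mono) auto
    have eq1: "(\<lambda>x. - w1 x - of_real s * U1 x) = (\<lambda>x. (\<kappa>\<^sup>2 - of_real s) * U1 x)"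
      by (rule ext) (simp add: w1_def U1_def algebra_simps power2_eq_square)
    have "sq_norm R1 (\<lambda>x. - w1 x - of_real s * U1 x) \<le> (cmod (\<kappa>\<^sup>2 - of_real s))\<^sup>2 * sq_norm R1 U1"
      unfolding eq1 by (rule L2_on_cmult(2)[OF R1.lebesgue_I dom_rep_L2(1)[OF rep]])
    also have "\<dots> \<le> \<epsilon>\<^sup>2 * (2 * k + 1)\<^sup>2 * (1 / (2 * \<epsilon>))"
      unfolding U1norm using r e by (intro mult_right_mono) auto
    also have "\<dots> = \<epsilon> * ((2 * k + 1)\<^sup>2 / 2)"
      using e by (simp add: power2_eq_square)
    also have "\<dots> \<le> 1 * ((2 * k + 1)\<^sup>2 / 2)"
      using e by (intro mult_right_mono) auto
    finally have 1: "sq_norm R1 (\<lambda>x. - w1 x - of_real s * U1 x) \<le> (2 * k + 1)\<^sup>2 / 2" by simp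
    have 2: "sq_norm (R2 L) (\<lambda>x. - w2 x - of_real s * U2 x) \<le> B\<^sup>2 * L"
    proof (rule continuous_L2_on_R2(2))
      show "continuous_on {0..L} (\<lambda>x. - w2 x - of_real s * U2 x)"
        unfolding w2_def U2_def by (intro continuous_intros)
      fix x assume x: "x \<in> {0..L}"
      have "\<bar>x * (x - L)\<bar> \<le> L * L"
        unfolding abs_mult using x by (intro mult_mono) auto
      then have "cmod d * \<bar>x * (x - L)\<bar> \<le> D * L\<^sup>2"
        unfolding power2_eq_square using dD by (intro mult_mono) (auto intro: order_trans[OF norm_ge_zero])
      then have "cmod (U2 x) \<le> 1 + D * L\<^sup>2"
        using norm_triangle_ineq[of 1 "d * of_real (x * (x - L))"] 
        unfolding U2_def norm_mult norm_of_real by (simp del: of_real_mult)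
      then have "s * cmod (U2 x) \<le> s * (1 + D * L\<^sup>2)" using assms by (intro mult_left_mono) auto
      moreover have "cmod (- w2 x) \<le> 2 * D" using dD by (simp add: w2_def norm_mult)
      moreover have "cmod (- w2 x - of_real s * U2 x) \<le> cmod (- w2 x) + s * cmod (U2 x)"
        using norm_triangle_ineq4[of "- w2 x" "of_real s * U2 x"] assms unfolding norm_mult by simp
      ultimately show "cmod (- w2 x - of_real s * U2 x) \<le> B" by (simp add: B_def)
    qed
    note C' = C[OF dom_rep_imp_dom[OF rep], unfolded dom_rep_norms[OF rep]]
    have "1 / (2 * \<epsilon>) \<le> (sqrt (sq_norm R1 U1 + sq_norm (R2 L) U2))\<^sup>2"
      using sq_norm_nonneg[of R1 U1] sq_norm_nonneg[of "R2 L" U2] U1norm by simp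
    also have "\<dots> \<le> (C * sqrt (sq_norm R1 (\<lambda>x. - w1 x - of_real s * U1 x) + sq_norm (R2 L) (\<lambda>x. - w2 x - of_real s * U2 x)))\<^sup>2"
      using C' by (intro power_mono) (auto simp: sq_norm_nonneg)
    also have "\<dots> = C\<^sup>2 * (sq_norm R1 (\<lambda>x. - w1 x - of_real s * U1 x) + sq_norm (R2 L) (\<lambda>x. - w2 x - of_real s * U2 x))"
      by (simp add: power_mult_distrib sq_norm_nonneg)
    also have "\<dots> \<le> C\<^sup>2 * M"
      using 1 2 by (intro mult_left_mono) (auto simp: M_def)
    finally show ?thesis .
  qed
  \<comment> \<open>makes \<open>1 / (2 * \<epsilon>)\<close> exceed the bound by one\<close>
  define \<epsilon> where "\<epsilon> = 1 / (2 * (C\<^sup>2 * M + 1))"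
  have "C\<^sup>2 * M \<ge> 0" using M0 by simp
  then have "0 < \<epsilon>" "\<epsilon> \<le> 1" "1 / (2 * \<epsilon>) = C\<^sup>2 * M + 1"
    by (simp_all add: \<epsilon>_def)
  with key[of \<epsilon>] show False by simp
qed

section \<open>The resolvent\<close>

lemma abs_exp_less_1: "Im \<kappa> > 0 \<Longrightarrow> cmod (exp (\<i> * \<kappa> * of_real L)) < 1"
  using L_pos by simp

text \<open>
  Square integrability removes the growing exponential on the half-line, and the junction conditions leave one unknown
  \<open>A\<close> with \<open>A characteristic \<kappa> = 0\<close>.
\<close>
lemma kernel_trivial:
  assumes \<kappa>: "Im \<kappa> > 0" and nz: "characteristic \<kappa> \<noteq> 0" and u: "dom_rep u U1 V1 w1 U2 V2 w2"
    and eq: "AE x in lebesgue_on R1. - w1 x - \<kappa>\<^sup>2 * U1 x = 0" "AE x in lebesgue_on (R2 L). - w2 x - \<kappa>\<^sup>2 * U2 x = 0"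
  shows "\<And>x. x \<ge> 0 \<Longrightarrow> U1 x = 0" "\<And>x. x \<in> {0..L} \<Longrightarrow> U2 x = 0"
proof -
  have k0: "\<kappa> \<noteq> 0" using \<kappa> by auto
  have r1: "primitive_on {0..} U1 V1" "primitive_on {0..} V1 w1" "U1 \<in> L2_on R1"
    and r2: "primitive_on {0..L} U2 V2" "primitive_on {0..L} V2 w2"
    and bc: "U1 0 = U2 0" "U2 0 = U2 L" "V1 0 + V2 0 - V2 L = \<i> * of_real \<alpha> * U1 0"
    using u by (simp_all add: dom_rep_def R1.H2_rep_def R2.H2_rep_def closure_R1 closure_R2 L_pos)
  define N1 where "N1 = {x\<in>R1. - w1 x - \<kappa>\<^sup>2 * U1 x \<noteq> 0} \<union> ({0..} - R1)"
  have N1: "negligible N1"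
    using eq(1) R1.negligible_boundary unfolding N1_def
    by (intro negligible_Un) (simp_all add: AE_lebesgue_on_iff_negligible R1.lebesgue_I closure_R1)
  define N2 where "N2 = {x\<in>R2 L. - w2 x - \<kappa>\<^sup>2 * U2 x \<noteq> 0} \<union> ({0..L} - R2 L)"
  have N2: "negligible N2"
    using eq(2) R2.negligible_boundary unfolding N2_def
    by (intro negligible_Un) (simp_all add: AE_lebesgue_on_iff_negligible R2.lebesgue_I closure_R2 L_pos)
  have w: "w1 x = - \<kappa>\<^sup>2 * U1 x" if "x \<in> {0..} - N1" for x
  proof -
    have "- w1 x - \<kappa>\<^sup>2 * U1 x = 0" using that by (auto simp: N1_def)
    then show ?thesis by (metis add.inverse_inverse eq_iff_diff_eq_0 mult_minus_left)
  qed
  have w': "w2 x = - \<kappa>\<^sup>2 * U2 x" if "x \<in> {0..L} - N2" for x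
  proof -
    have "- w2 x - \<kappa>\<^sup>2 * U2 x = 0" using that by (auto simp: N2_def)
    then show ?thesis by (metis add.inverse_inverse eq_iff_diff_eq_0 mult_minus_left)
  qed
  obtain c d where U1: "\<And>x. x \<ge> 0 \<Longrightarrow> U1 x = c * exp (\<i> * \<kappa> * of_real x) + d * exp (- (\<i> * \<kappa>) * of_real x)"
    "\<And>x. x \<ge> 0 \<Longrightarrow> V1 x = \<i> * \<kappa> * (c * exp (\<i> * \<kappa> * of_real x) - d * exp (- (\<i> * \<kappa>) * of_real x))"
    using helmholtz_solutions[OF r1(1,2) N1 w _ _ _ _ k0] by (auto simp: is_interval_ci)
  obtain A B where U2: "\<And>x. x \<in> {0..L} \<Longrightarrow> U2 x = A * exp (\<i> * \<kappa> * of_real x) + B * exp (- (\<i> * \<kappa>) * of_real x)"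
    "\<And>x. x \<in> {0..L} \<Longrightarrow> V2 x = \<i> * \<kappa> * (A * exp (\<i> * \<kappa> * of_real x) - B * exp (- (\<i> * \<kappa>) * of_real x))"
    using helmholtz_solutions[OF r2 N2 w' _ _ _ _ k0] L_pos by (auto simp: is_interval_cc)
  have "(\<lambda>x. U1 x - c * exp (\<i> * \<kappa> * of_real x)) \<in> L2_on R1"
    by (intro L2_on_diff L2_on_cmult(1) r1(3) exp_imaginary_L2_on_R1(1)[OF \<kappa>] R1.lebesgue_I)
  then have "(\<lambda>x. d * exp (- (\<i> * \<kappa>) * of_real x)) \<in> L2_on R1"
  proof (rule L2_on_cong_AE[OF R1.lebesgue_I])
    show "AE x in lebesgue_on R1. U1 x - c * exp (\<i> * \<kappa> * of_real x) = d * exp (- (\<i> * \<kappa>) * of_real x)"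
      using R1.AE_in_I by eventually_elim (simp add: R1_def U1)
  qed
  from growing_exponential_not_L2[OF \<kappa> this] have d: "d = 0" .
  define E where "E = exp (\<i> * \<kappa> * of_real L)"
  have "cmod E < 1" unfolding E_def by (rule abs_exp_less_1[OF \<kappa>])
  then have "E \<noteq> 1" by auto
  then have E: "E \<noteq> 0" "exp (- (\<i> * \<kappa>) * of_real L) = 1 / E" "E \<noteq> 1"
    by (simp_all add: E_def exp_minus inverse_eq_divide)
  have vals: "U1 0 = c" "V1 0 = \<i> * \<kappa> * c" "U2 0 = A + B" "U2 L = A * E + B / E"
    "V2 0 = \<i> * \<kappa> * (A - B)" "V2 L = \<i> * \<kappa> * (A * E - B / E)"
    using U1[of 0] U2[of 0] U2[of L] L_pos d unfolding E(2) E_def[symmetric] by simp_all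
  have "(1 - E) * (B - A * E) = 0"
    using bc(2) E(1) unfolding vals by (simp add: field_simps)
  then have B: "B = A * E" using E(3) by simp
  have c: "c = A * (1 + E)" using bc(1) unfolding vals B by (simp add: algebra_simps)
  have "\<i> * (A * characteristic \<kappa>) = - (V1 0 + V2 0 - V2 L - \<i> * of_real \<alpha> * U1 0)"
    unfolding vals B c characteristic_def E_def[symmetric] using E(1) by (simp add: field_simps)
  then have "A * characteristic \<kappa> = 0" using bc(3) by simp
  then have "A = 0" using nz by simp
  then show "\<And>x. x \<ge> 0 \<Longrightarrow> U1 x = 0" "\<And>x. x \<in> {0..L} \<Longrightarrow> U2 x = 0"
    using U1 U2 B c d by simp_all
qed

text \<open>
  Extension by zero lets the half-line Green kernel serve the loop as well.
\<close>
lemma extend_by_zero: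
  assumes g: "g \<in> L2_on (R2 L)"
  defines "g' \<equiv> (\<lambda>x. if x \<in> R2 L then g x else 0)"
  shows "g' \<in> L2_on R1" "sq_norm R1 g' = sq_norm (R2 L) g"
proof -
  have sub: "R2 L \<inter> R1 = R2 L" by (auto simp: R1_def R2_def)
  have eq: "(\<lambda>x. (cmod (g' x))\<^sup>2) = (\<lambda>x. if x \<in> R2 L then (cmod (g x))\<^sup>2 else 0)"
    by (auto simp: g'_def)
  have "g' \<in> borel_measurable lebesgue"
    using g R2.lebesgue_I unfolding g'_def by (simp add: borel_measurable_if L2_on_iff)
  then have m: "g' \<in> borel_measurable (lebesgue_on R1)"
    by (rule measurable_restrict_space1)
  have int: "(\<lambda>x. (cmod (g' x))\<^sup>2) integrable_on R1"
    unfolding eq integrable_restrict_Int sub by (rule L2_on_integrable[OF R2.lebesgue_I g])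
  show "g' \<in> L2_on R1" by (rule L2_on_bound(1)[OF R1.lebesgue_I m int]) simp
  show "sq_norm R1 g' = sq_norm (R2 L) g"
    unfolding sq_norm_def eq Henstock_Kurzweil_Integration.integral_restrict_Int sub ..
qed

lemma restrict_to_R2:
  assumes v: "v \<in> L2_on R1"
  shows "v \<in> L2_on (R2 L)" "sq_norm (R2 L) v \<le> sq_norm R1 v"
proof -
  have sub: "R2 L \<subseteq> R1" by (auto simp: R1_def R2_def)
  have "(\<lambda>x. (cmod (v x))\<^sup>2) absolutely_integrable_on R1"
    using v by (simp add: L2_on_iff R1.lebesgue_I)
  then have "(\<lambda>x. (cmod (v x))\<^sup>2) absolutely_integrable_on (R2 L)"
    using R2.lebesgue_I sub by (rule set_integrable_subset)
  moreover have "v \<in> borel_measurable (lebesgue_on (R2 L))"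
    using v sub by (auto simp: L2_on_iff R1.lebesgue_I intro: measurable_restrict_mono)
  ultimately show "v \<in> L2_on (R2 L)" by (simp add: L2_on_iff R2.lebesgue_I)
  then show "sq_norm (R2 L) v \<le> sq_norm R1 v"
    unfolding sq_norm_def using L2_on_integrable[OF R1.lebesgue_I v] L2_on_integrable[OF R2.lebesgue_I] sub
    by (intro integral_subset_le) auto
qed

text \<open>
  Here \<open>a1, b1\<close> are the value and the derivative at the junction of the particular solution on the half-line, and
  \<open>a2, b2, a3, b3\<close> those on the loop at \<open>0\<close> and \<open>L\<close>; \<open>c, A, B\<close> are the coefficients of the exponentials that are added.
  Equality at the two ends of the loop gives \<open>B = E (A - q)\<close> with \<open>q = (a3 - a2) / (1 - E)\<close>. Inserting this in the
  derivative condition leaves a scalar equation \<open>\<i> A characteristic \<kappa> = r\<close> in which \<open>r\<close> depends linearly on the data.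
  The constants \<open>Q\<close>, \<open>R\<close>, \<open>S\<close> bound \<open>q\<close>, \<open>r\<close>, \<open>A\<close> relative to the size \<open>m\<close> of the data.
\<close>
lemma junction_system:
  assumes \<kappa>: "Im \<kappa> > 0" and nz: "characteristic \<kappa> \<noteq> 0"
  defines "E \<equiv> exp (\<i> * \<kappa> * of_real L)"
  obtains M where "M \<ge> 0" "\<And>a1 b1 a2 b2 a3 b3 m. cmod a1 \<le> m \<Longrightarrow> cmod b1 \<le> m \<Longrightarrow> cmod a2 \<le> m \<Longrightarrow> cmod b2 \<le> m \<Longrightarrow>
    cmod a3 \<le> m \<Longrightarrow> cmod b3 \<le> m \<Longrightarrow> \<exists>c A B. cmod c \<le> M * m \<and> cmod A \<le> M * m \<and> cmod B \<le> M * m \<and>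
      a1 + c = a2 + (A + B) \<and> a2 + (A + B) = a3 + (A * E + B / E) \<and>
      (b1 + \<i> * \<kappa> * c) + (b2 + \<i> * \<kappa> * (A - B)) - (b3 + \<i> * \<kappa> * (A * E - B / E)) = \<i> * of_real \<alpha> * (a1 + c)"
proof -
  have "cmod E < 1" unfolding E_def by (rule abs_exp_less_1[OF \<kappa>])
  then have "E \<noteq> 1" "cmod E \<le> 1" by auto
  moreover have "E \<noteq> 0" by (simp add: E_def)
  ultimately have E: "E \<noteq> 0" "E \<noteq> 1" "cmod E \<le> 1" by blast+
  define Q where "Q = 2 / cmod (1 - E)"
  define R where "R = 3 + cmod \<kappa> * (4 + Q) + \<alpha> * (1 + Q)"
  define S where "S = R / cmod (characteristic \<kappa>)"
  have pos: "Q \<ge> 0" "R \<ge> 0" "S \<ge> 0"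
    using \<alpha>_pos by (auto simp: Q_def R_def S_def)
  define M where "M = 2 + 2 * S + Q"
  show ?thesis
  proof (rule that[of M])
    show "M \<ge> 0" using pos by (simp add: M_def)
    fix a1 b1 a2 b2 a3 b3 :: complex and m :: real
    assume m: "cmod a1 \<le> m" "cmod b1 \<le> m" "cmod a2 \<le> m" "cmod b2 \<le> m" "cmod a3 \<le> m" "cmod b3 \<le> m"
    have m0: "m \<ge> 0" using order_trans[OF norm_ge_zero m(1)] .
    define p where "p = a3 - a2"
    define q where "q = p / (1 - E)"
    have q: "q * (1 - E) = p" using E(2) by (simp add: q_def)
    define r where "r = b1 + b2 - b3 + \<i> * \<kappa> * (a2 - a1 - E * q - p) - \<i> * of_real \<alpha> * (a2 - E * q)"
    define A where "A = r / (\<i> * characteristic \<kappa>)"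
    define B where "B = E * (A - q)"
    define c where "c = a2 - a1 + A + B"
    have A: "A * (\<i> * characteristic \<kappa>) = r" using nz by (simp add: A_def)
    have BE: "B / E = A - q" using E(1) by (simp add: B_def)
    have eq1: "a1 + c = a2 + (A + B)" by (simp add: c_def)
    have "a3 + (A * E + B / E) - (a2 + (A + B)) = p - q * (1 - E)"
      unfolding BE by (simp add: B_def p_def algebra_simps)
    then have eq2: "a2 + (A + B) = a3 + (A * E + B / E)" unfolding q by simp
    have "(b1 + \<i> * \<kappa> * c) + (b2 + \<i> * \<kappa> * (A - B)) - (b3 + \<i> * \<kappa> * (A * E - B / E)) - \<i> * of_real \<alpha> * (a1 + c)
        = r - A * (\<i> * characteristic \<kappa>) + \<i> * \<kappa> * (p - q * (1 - E))"
      unfolding BE unfolding c_def B_def r_def characteristic_def E_def[symmetric] by (simp add: algebra_simps)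
    then have eq3: "(b1 + \<i> * \<kappa> * c) + (b2 + \<i> * \<kappa> * (A - B)) - (b3 + \<i> * \<kappa> * (A * E - B / E)) = \<i> * of_real \<alpha> * (a1 + c)"
      unfolding A q by simp
    have tri: "cmod (x + y) \<le> cmod x + cmod y" "cmod (x - y) \<le> cmod x + cmod y" for x y
      using norm_triangle_ineq norm_triangle_ineq4 by blast+
    have np: "cmod p \<le> 2 * m" using tri(2)[of a3 a2] m unfolding p_def by linarith
    have nq: "cmod q \<le> Q * m"
      unfolding q_def Q_def norm_divide using divide_right_mono[OF np, of "cmod (1 - E)"] by simp
    have nEq: "cmod (E * q) \<le> Q * m"
      unfolding norm_mult using mult_mono[OF E(3) nq] by simp
    have "cmod (b1 + b2 - b3) \<le> 3 * m"
      using tri(1)[of b1 b2] tri(2)[of "b1 + b2" b3] m by linarith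
    moreover have "cmod (\<i> * \<kappa> * (a2 - a1 - E * q - p)) \<le> cmod \<kappa> * ((4 + Q) * m)"
    proof -
      have "cmod (a2 - a1 - E * q - p) \<le> (4 + Q) * m"
        using tri(2)[of a2 a1] tri(2)[of "a2 - a1" "E * q"] tri(2)[of "a2 - a1 - E * q" p] m nEq np
        unfolding distrib_right by linarith
      then show ?thesis by (simp add: norm_mult mult_left_mono)
    qed
    moreover have "cmod (\<i> * of_real \<alpha> * (a2 - E * q)) \<le> \<alpha> * ((1 + Q) * m)"
    proof -
      have "cmod (a2 - E * q) \<le> (1 + Q) * m"
        using tri(2)[of a2 "E * q"] m nEq unfolding distrib_right by linarith
      then show ?thesis using \<alpha>_pos by (simp add: norm_mult mult_left_mono)
    qed
    ultimately have "cmod r \<le> 3 * m + cmod \<kappa> * ((4 + Q) * m) + \<alpha> * ((1 + Q) * m)"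
      unfolding r_def using tri by (smt (verit, best))
    then have nr: "cmod r \<le> R * m" by (simp add: R_def algebra_simps)
    have nA: "cmod A \<le> S * m"
      unfolding A_def S_def using divide_right_mono[OF nr, of "cmod (characteristic \<kappa>)"]
      by (simp add: norm_divide norm_mult)
    have nB: "cmod B \<le> (S + Q) * m"
    proof -
      have "cmod B \<le> 1 * cmod (A - q)"
        unfolding B_def norm_mult using E(3) by (intro mult_right_mono) auto
      then show ?thesis using tri(2)[of A q] nA nq unfolding distrib_right by linarith
    qed
    have nc: "cmod c \<le> (2 + 2 * S + Q) * m"
    proof -
      have "cmod c \<le> m + m + S * m + (S + Q) * m"
        using tri(2)[of a2 a1] tri(1)[of "a2 - a1" A] tri(1)[of "a2 - a1 + A" B] m nA nB unfolding c_def by linarith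
      then show ?thesis by (simp add: algebra_simps)
    qed
    have "S * m \<le> M * m" "(S + Q) * m \<le> M * m" "(2 + 2 * S + Q) * m \<le> M * m"
      using pos m0 by (auto simp: M_def intro!: mult_right_mono)
    then have "cmod c \<le> M * m \<and> cmod A \<le> M * m \<and> cmod B \<le> M * m"
      using nA nB nc by linarith
    with eq1 eq2 eq3 show "\<exists>c A B. cmod c \<le> M * m \<and> cmod A \<le> M * m \<and> cmod B \<le> M * m \<and>
      a1 + c = a2 + (A + B) \<and> a2 + (A + B) = a3 + (A * E + B / E) \<and>
      (b1 + \<i> * \<kappa> * c) + (b2 + \<i> * \<kappa> * (A - B)) - (b3 + \<i> * \<kappa> * (A * E - B / E)) = \<i> * of_real \<alpha> * (a1 + c)"
      by blast
  qed
qed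

text \<open>
  Particular solutions on both edges corrected by exponentials. Pointwise bounds for the particular solutions bound the
  coefficients, hence the norm of the correction.
\<close>
lemma resolvent_solution:
  assumes \<kappa>: "Im \<kappa> > 0" and nz: "characteristic \<kappa> \<noteq> 0"
  obtains K where "K \<ge> 0" "\<And>g1 g2. g1 \<in> L2_on R1 \<Longrightarrow> g2 \<in> L2_on (R2 L) \<Longrightarrow>
    \<exists>u U1 V1 w1 U2 V2 w2. dom_rep u U1 V1 w1 U2 V2 w2 \<and>
      (\<forall>x\<in>R1. - w1 x - \<kappa>\<^sup>2 * U1 x = g1 x) \<and> (\<forall>x\<in>R2 L. - w2 x - \<kappa>\<^sup>2 * U2 x = g2 x) \<and>
      sq_norm R1 U1 + sq_norm (R2 L) U2 \<le> K * (sq_norm R1 g1 + sq_norm (R2 L) g2)"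
proof -
  define E where "E = exp (\<i> * \<kappa> * of_real L)"
  define e where "e x = exp (\<i> * \<kappa> * of_real x)" for x
  define e' where "e' x = exp (- (\<i> * \<kappa>) * of_real x)" for x
  have e: "e 0 = 1" "e' 0 = 1" "e L = E" "e' L = 1 / E"
    by (simp_all add: e_def e'_def E_def exp_minus inverse_eq_divide)
  have e_prim: "primitive_on S (\<lambda>x. a * e x) (\<lambda>x. a * (\<i> * \<kappa>) * e x)"
    "primitive_on S (\<lambda>x. a * e' x) (\<lambda>x. a * (- (\<i> * \<kappa>)) * e' x)" for a S
    unfolding e_def e'_def by (rule primitive_on_exp_scaled)+
  have e_L2: "e \<in> L2_on R1" "sq_norm R1 e = 1 / (2 * Im \<kappa>)"
    using exp_imaginary_L2_on_R1[OF \<kappa>] by (simp_all add: e_def[abs_def])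
  obtain C where C: "C \<ge> 0" "\<And>g. g \<in> L2_on R1 \<Longrightarrow> \<exists>v V. v \<in> L2_on R1 \<and> V \<in> L2_on R1 \<and>
      primitive_on {0..} v V \<and> primitive_on {0..} V (\<lambda>x. - \<kappa>\<^sup>2 * v x - g x) \<and>
      sq_norm R1 v \<le> C * sq_norm R1 g \<and>
      (\<forall>x\<ge>0. (cmod (v x))\<^sup>2 \<le> C * sq_norm R1 g \<and> (cmod (V x))\<^sup>2 \<le> C * sq_norm R1 g)"
    by (rule green_solution[OF \<kappa>]) (rule that)
  obtain M where M: "M \<ge> 0" "\<And>a1 b1 a2 b2 a3 b3 m. cmod a1 \<le> m \<Longrightarrow> cmod b1 \<le> m \<Longrightarrow> cmod a2 \<le> m \<Longrightarrow> cmod b2 \<le> m \<Longrightarrow>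
    cmod a3 \<le> m \<Longrightarrow> cmod b3 \<le> m \<Longrightarrow> \<exists>c A B. cmod c \<le> M * m \<and> cmod A \<le> M * m \<and> cmod B \<le> M * m \<and>
      a1 + c = a2 + (A + B) \<and> a2 + (A + B) = a3 + (A * E + B / E) \<and>
      (b1 + \<i> * \<kappa> * c) + (b2 + \<i> * \<kappa> * (A - B)) - (b3 + \<i> * \<kappa> * (A * E - B / E)) = \<i> * of_real \<alpha> * (a1 + c)"
    by (rule junction_system[OF \<kappa> nz, folded E_def]) (rule that)
  define D where "D = 1 + exp (Im \<kappa> * L)"
  \<comment> \<open>the summands bound the norm on the half-line and the norm on the loop\<close>
  define K where "K = 2 * C + 2 * (M\<^sup>2 * C * (1 / (2 * Im \<kappa>))) + (2 * C + 2 * (M\<^sup>2 * C * D\<^sup>2 * L))"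
  show ?thesis
  proof (rule that[of K])
    show "K \<ge> 0" using C(1) \<kappa> L_pos by (simp add: K_def)
    fix g1 g2 assume g: "g1 \<in> L2_on R1" "g2 \<in> L2_on (R2 L)"
    define N where "N = sq_norm R1 g1 + sq_norm (R2 L) g2"
    define g2' where "g2' = (\<lambda>x. if x \<in> R2 L then g2 x else 0)"
    note g2' = extend_by_zero[OF g(2), folded g2'_def]
    have N: "sq_norm R1 g1 \<le> N" "sq_norm R1 g2' \<le> N" "N \<ge> 0"
      using sq_norm_nonneg[of R1 g1] sq_norm_nonneg[of "R2 L" g2] g2'(2) by (simp_all add: N_def)
    have CN: "C * sq_norm R1 g1 \<le> C * N" "C * sq_norm R1 g2' \<le> C * N"
      using N C(1) by (auto intro: mult_left_mono)
    obtain v1 W1 where "v1 \<in> L2_on R1 \<and> W1 \<in> L2_on R1 \<and>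
      primitive_on {0..} v1 W1 \<and> primitive_on {0..} W1 (\<lambda>x. - \<kappa>\<^sup>2 * v1 x - g1 x) \<and>
      sq_norm R1 v1 \<le> C * sq_norm R1 g1 \<and>
      (\<forall>x\<ge>0. (cmod (v1 x))\<^sup>2 \<le> C * sq_norm R1 g1 \<and> (cmod (W1 x))\<^sup>2 \<le> C * sq_norm R1 g1)"
      using C(2)[OF g(1)] by (elim exE)
    then have v1: "v1 \<in> L2_on R1" "W1 \<in> L2_on R1"
      "primitive_on {0..} v1 W1" "primitive_on {0..} W1 (\<lambda>x. - \<kappa>\<^sup>2 * v1 x - g1 x)"
      "sq_norm R1 v1 \<le> C * N" "\<And>x. x \<ge> 0 \<Longrightarrow> (cmod (v1 x))\<^sup>2 \<le> C * N" "\<And>x. x \<ge> 0 \<Longrightarrow> (cmod (W1 x))\<^sup>2 \<le> C * N"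
      using CN(1) by (auto intro: order_trans)
    obtain v2 W2 where "v2 \<in> L2_on R1 \<and> W2 \<in> L2_on R1 \<and>
      primitive_on {0..} v2 W2 \<and> primitive_on {0..} W2 (\<lambda>x. - \<kappa>\<^sup>2 * v2 x - g2' x) \<and>
      sq_norm R1 v2 \<le> C * sq_norm R1 g2' \<and>
      (\<forall>x\<ge>0. (cmod (v2 x))\<^sup>2 \<le> C * sq_norm R1 g2' \<and> (cmod (W2 x))\<^sup>2 \<le> C * sq_norm R1 g2')"
      using C(2)[OF g2'(1)] by (elim exE)
    then have v2: "v2 \<in> L2_on R1" "W2 \<in> L2_on R1"
      "primitive_on {0..} v2 W2" "primitive_on {0..} W2 (\<lambda>x. - \<kappa>\<^sup>2 * v2 x - g2' x)"
      "sq_norm R1 v2 \<le> C * N" "\<And>x. x \<ge> 0 \<Longrightarrow> (cmod (v2 x))\<^sup>2 \<le> C * N" "\<And>x. x \<ge> 0 \<Longrightarrow> (cmod (W2 x))\<^sup>2 \<le> C * N"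
      using CN(2) by (auto intro: order_trans)
    define m where "m = sqrt (C * N)"
    have m2: "m\<^sup>2 = C * N" using C(1) N(3) by (simp add: m_def)
    have L0: "L \<ge> 0" using L_pos by simp
    have m: "cmod (v1 0) \<le> m" "cmod (W1 0) \<le> m" "cmod (v2 0) \<le> m" "cmod (W2 0) \<le> m"
      "cmod (v2 L) \<le> m" "cmod (W2 L) \<le> m"
      unfolding m_def using v1(6,7) v2(6,7) L0 by (simp_all add: real_le_rsqrt)
    obtain c A B where cAB: "cmod c \<le> M * m" "cmod A \<le> M * m" "cmod B \<le> M * m"
      "v1 0 + c = v2 0 + (A + B)" "v2 0 + (A + B) = v2 L + (A * E + B / E)"
      "(W1 0 + \<i> * \<kappa> * c) + (W2 0 + \<i> * \<kappa> * (A - B)) - (W2 L + \<i> * \<kappa> * (A * E - B / E)) = \<i> * of_real \<alpha> * (v1 0 + c)"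
      using M(2)[OF m] by (elim exE conjE)
    define U1 where "U1 x = v1 x + c * e x" for x
    define V1 where "V1 x = W1 x + c * (\<i> * \<kappa>) * e x" for x
    define w1 where "w1 x = (- \<kappa>\<^sup>2 * v1 x - g1 x) + c * (\<i> * \<kappa>) * (\<i> * \<kappa>) * e x" for x
    define U2 where "U2 x = v2 x + (A * e x + B * e' x)" for x
    define V2 where "V2 x = W2 x + (A * (\<i> * \<kappa>) * e x + B * (- (\<i> * \<kappa>)) * e' x)" for x
    define w2 where "w2 x = (- \<kappa>\<^sup>2 * v2 x - g2' x) + (A * (\<i> * \<kappa>) * (\<i> * \<kappa>) * e x + B * (- (\<i> * \<kappa>)) * (- (\<i> * \<kappa>)) * e' x)" for x
    have ee': "continuous_on S e" "continuous_on S e'" for S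
      unfolding e_def[abs_def] e'_def[abs_def] by (intro continuous_intros)+
    have rep: "dom_rep (U1, U2) U1 V1 w1 U2 V2 w2"
    proof (rule dom_rep_classical)
      show "primitive_on {0..} U1 V1" "primitive_on {0..} V1 w1"
        unfolding U1_def[abs_def] V1_def[abs_def] w1_def[abs_def]
        by (intro primitive_on_add v1 e_prim)+
      show "U1 \<in> L2_on R1" "V1 \<in> L2_on R1" "w1 \<in> L2_on R1"
        unfolding U1_def[abs_def] V1_def[abs_def] w1_def[abs_def]
        by (intro L2_on_add(1) L2_on_diff L2_on_cmult(1) v1 g e_L2 R1.lebesgue_I)+
      have sub: "{0..L} \<subseteq> {0..}" by auto
      show "primitive_on {0..L} U2 V2" "primitive_on {0..L} V2 w2"
        unfolding U2_def[abs_def] V2_def[abs_def] w2_def[abs_def]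
        by (intro primitive_on_add primitive_on_subset[OF v2(3) sub] primitive_on_subset[OF v2(4) sub] e_prim)+
      show "w2 \<in> L2_on (R2 L)"
        unfolding w2_def[abs_def]
        by (intro L2_on_add(1)[OF R2.lebesgue_I] L2_on_diff[OF R2.lebesgue_I] L2_on_cmult(1)[OF R2.lebesgue_I]
            restrict_to_R2(1) v2(1) g2'(1) continuous_imp_L2_on_R2 continuous_intros ee')
      show "U1 0 = U2 0" "U2 0 = U2 L" 
        using cAB(4,5) by (simp_all add: U1_def U2_def e)
      show "V1 0 + V2 0 - V2 L = \<i> * of_real \<alpha> * U1 0"
        using cAB(6) by (simp add: V1_def V2_def U1_def e algebra_simps)
    qed
    have r1: "- w1 x - \<kappa>\<^sup>2 * U1 x = g1 x" for x
      by (simp add: w1_def U1_def algebra_simps power2_eq_square)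
    have r2: "- w2 x - \<kappa>\<^sup>2 * U2 x = g2' x" for x
      by (simp add: w2_def U2_def algebra_simps power2_eq_square)
    have Mm: "(M * m)\<^sup>2 = M\<^sup>2 * C * N"
      by (simp add: power_mult_distrib m2)
    have n1: "sq_norm R1 U1 \<le> (2 * C + 2 * (M\<^sup>2 * C * (1 / (2 * Im \<kappa>)))) * N"
    proof -
      have "sq_norm R1 U1 \<le> 2 * sq_norm R1 v1 + 2 * sq_norm R1 (\<lambda>x. c * e x)"
        unfolding U1_def[abs_def] by (intro L2_on_add(2) v1 L2_on_cmult(1) e_L2 R1.lebesgue_I)
      moreover have "sq_norm R1 (\<lambda>x. c * e x) \<le> (cmod c)\<^sup>2 * (1 / (2 * Im \<kappa>))"
        using L2_on_cmult(2)[OF R1.lebesgue_I e_L2(1), of c] unfolding e_L2(2) .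
      moreover have "(cmod c)\<^sup>2 * (1 / (2 * Im \<kappa>)) \<le> (M * m)\<^sup>2 * (1 / (2 * Im \<kappa>))"
        using cAB(1) \<kappa> by (intro mult_right_mono power_mono) auto
      moreover have "(2 * C + 2 * (M\<^sup>2 * C * (1 / (2 * Im \<kappa>)))) * N = 2 * (C * N) + 2 * ((M * m)\<^sup>2 * (1 / (2 * Im \<kappa>)))"
        unfolding Mm by (simp add: algebra_simps)
      ultimately show ?thesis using v1(5) by linarith
    qed
    have n2: "sq_norm (R2 L) U2 \<le> (2 * C + 2 * (M\<^sup>2 * C * D\<^sup>2 * L)) * N"
    proof -
      have cont: "continuous_on {0..L} (\<lambda>x. A * e x + B * e' x)"
        by (intro continuous_intros ee')
      have bd: "cmod (A * e x + B * e' x) \<le> M * m * D" if x: "x \<in> {0..L}" for x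
      proof -
        have e1: "cmod (e x) \<le> 1" using x \<kappa> by (simp add: e_def)
        have e2: "cmod (e' x) \<le> exp (Im \<kappa> * L)" using x \<kappa> by (simp add: e'_def mult_left_mono)
        have Mm0: "0 \<le> M * m" using order_trans[OF norm_ge_zero cAB(1)] .
        have "cmod A * cmod (e x) \<le> M * m * 1" "cmod B * cmod (e' x) \<le> M * m * exp (Im \<kappa> * L)"
          by (rule mult_mono[OF cAB(2) e1 Mm0 norm_ge_zero] mult_mono[OF cAB(3) e2 Mm0 norm_ge_zero])+
        moreover have "cmod (A * e x + B * e' x) \<le> cmod A * cmod (e x) + cmod B * cmod (e' x)"
          using norm_triangle_ineq[of "A * e x" "B * e' x"] unfolding norm_mult .
        ultimately show ?thesis by (simp add: D_def algebra_simps)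
      qed
      note b = continuous_L2_on_R2[OF cont bd]
      have "sq_norm (R2 L) U2 \<le> 2 * sq_norm (R2 L) v2 + 2 * sq_norm (R2 L) (\<lambda>x. A * e x + B * e' x)"
        unfolding U2_def[abs_def] by (intro L2_on_add(2) restrict_to_R2(1) v2(1) b(1) R2.lebesgue_I)
      moreover have "(2 * C + 2 * (M\<^sup>2 * C * D\<^sup>2 * L)) * N = 2 * (C * N) + 2 * ((M * m * D)\<^sup>2 * L)"
        unfolding power_mult_distrib m2 by (simp add: algebra_simps)
      ultimately show ?thesis using b(2) restrict_to_R2(2)[OF v2(1)] v2(5) by linarith
    qed
    have "sq_norm R1 U1 + sq_norm (R2 L) U2 \<le> K * (sq_norm R1 g1 + sq_norm (R2 L) g2)"
      unfolding K_def N_def[symmetric] distrib_right using n1 n2 by (simp add: distrib_right)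
    then show "\<exists>u U1 V1 w1 U2 V2 w2. dom_rep u U1 V1 w1 U2 V2 w2 \<and>
      (\<forall>x\<in>R1. - w1 x - \<kappa>\<^sup>2 * U1 x = g1 x) \<and> (\<forall>x\<in>R2 L. - w2 x - \<kappa>\<^sup>2 * U2 x = g2 x) \<and>
      sq_norm R1 U1 + sq_norm (R2 L) U2 \<le> K * (sq_norm R1 g1 + sq_norm (R2 L) g2)"
      using rep r1 r2 by (intro exI[of _ "(U1, U2)"] exI[of _ U1] exI[of _ V1] exI[of _ w1] exI[of _ U2] exI[of _ V2] exI[of _ w2])
        (simp add: g2'_def)
  qed
qed

lemma dom_rep_diff:
  assumes "dom_rep u U1 V1 w1 U2 V2 w2" "dom_rep u' U1' V1' w1' U2' V2' w2'"
  shows "dom_rep (\<lambda>x. fst u x - fst u' x, \<lambda>x. snd u x - snd u' x) (\<lambda>x. U1 x - U1' x) (\<lambda>x. V1 x - V1' x) (\<lambda>x. w1 x - w1' x)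
    (\<lambda>x. U2 x - U2' x) (\<lambda>x. V2 x - V2' x) (\<lambda>x. w2 x - w2' x)"
  using assms unfolding dom_rep_def
  by (auto intro!: R1.H2_rep_diff R2.H2_rep_diff simp: algebra_simps)

text \<open>
  The difference of two elements of the domain is an element to which \<open>kernel_trivial\<close> applies.
\<close>
lemma resolvent_injective:
  assumes \<kappa>: "Im \<kappa> > 0" and nz: "characteristic \<kappa> \<noteq> 0"
    and u: "u \<in> tadpole_dom L \<alpha>" and v: "v \<in> tadpole_dom L \<alpha>"
    and eq: "tadpole_eq L (minus_scalar (tadpole_H L) (\<kappa>\<^sup>2) u) (minus_scalar (tadpole_H L) (\<kappa>\<^sup>2) v)"
  shows "tadpole_eq L u v"
proof -
  obtain U1 V1 w1 U2 V2 w2 where ru: "dom_rep u U1 V1 w1 U2 V2 w2" using dom_imp_dom_rep[OF u] .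
  obtain U1' V1' w1' U2' V2' w2' where rv: "dom_rep v U1' V1' w1' U2' V2' w2'" using dom_imp_dom_rep[OF v] .
  have eq': "AE x in lebesgue_on R1. fst (minus_scalar (tadpole_H L) (\<kappa>\<^sup>2) u) x = fst (minus_scalar (tadpole_H L) (\<kappa>\<^sup>2) v) x"
    "AE x in lebesgue_on (R2 L). snd (minus_scalar (tadpole_H L) (\<kappa>\<^sup>2) u) x = snd (minus_scalar (tadpole_H L) (\<kappa>\<^sup>2) v) x"
    using eq by (simp_all add: tadpole_eq_def)
  have e1: "AE x in lebesgue_on R1. - (w1 x - w1' x) - \<kappa>\<^sup>2 * (U1 x - U1' x) = 0"
    using eq'(1) dom_rep_H(5)[OF ru, of "\<kappa>\<^sup>2"] dom_rep_H(5)[OF rv, of "\<kappa>\<^sup>2"]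
    by eventually_elim (simp add: algebra_simps)
  have e2: "AE x in lebesgue_on (R2 L). - (w2 x - w2' x) - \<kappa>\<^sup>2 * (U2 x - U2' x) = 0"
    using eq'(2) dom_rep_H(6)[OF ru, of "\<kappa>\<^sup>2"] dom_rep_H(6)[OF rv, of "\<kappa>\<^sup>2"]
    by eventually_elim (simp add: algebra_simps)
  note k = kernel_trivial[OF \<kappa> nz dom_rep_diff[OF ru rv] e1 e2]
  have "AE x in lebesgue_on R1. fst u x = fst v x"
    using R1.AE_in_I dom_rep_H(3)[OF ru] dom_rep_H(3)[OF rv] by eventually_elim (use k(1) in \<open>simp add: R1_def\<close>)
  moreover have "AE x in lebesgue_on (R2 L). snd u x = snd v x"
    using R2.AE_in_I dom_rep_H(4)[OF ru] dom_rep_H(4)[OF rv] by eventually_elim (use k(2) in \<open>simp add: R2_def\<close>)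
  ultimately show ?thesis by (simp add: tadpole_eq_def)
qed

text \<open>
  The bound of \<open>resolvent_solution\<close> is available for one solution only, but solutions are unique, so it holds for every
  element of the domain.
\<close>
lemma in_resolvent_set:
  assumes \<kappa>: "Im \<kappa> > 0" and nz: "characteristic \<kappa> \<noteq> 0"
  shows "\<kappa>\<^sup>2 \<in> resolvent_set L (tadpole_dom L \<alpha>) (tadpole_H L)"
proof -
  let ?T = "minus_scalar (tadpole_H L) (\<kappa>\<^sup>2)"
  obtain K where K: "K \<ge> 0" "\<And>g1 g2. g1 \<in> L2_on R1 \<Longrightarrow> g2 \<in> L2_on (R2 L) \<Longrightarrow>
    \<exists>u U1 V1 w1 U2 V2 w2. dom_rep u U1 V1 w1 U2 V2 w2 \<and>
      (\<forall>x\<in>R1. - w1 x - \<kappa>\<^sup>2 * U1 x = g1 x) \<and> (\<forall>x\<in>R2 L. - w2 x - \<kappa>\<^sup>2 * U2 x = g2 x) \<and>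
      sq_norm R1 U1 + sq_norm (R2 L) U2 \<le> K * (sq_norm R1 g1 + sq_norm (R2 L) g2)"
    by (rule resolvent_solution[OF \<kappa> nz]) (rule that)
  have surj: "\<exists>u\<in>tadpole_dom L \<alpha>. tadpole_eq L (?T u) (g1, g2) \<and>
      tadpole_norm L u \<le> sqrt K * sqrt (sq_norm R1 g1 + sq_norm (R2 L) g2)"
    if g: "g1 \<in> L2_on R1" "g2 \<in> L2_on (R2 L)" for g1 g2
  proof -
    obtain u U1 V1 w1 U2 V2 w2 where u: "dom_rep u U1 V1 w1 U2 V2 w2"
      "\<And>x. x \<in> R1 \<Longrightarrow> - w1 x - \<kappa>\<^sup>2 * U1 x = g1 x" "\<And>x. x \<in> R2 L \<Longrightarrow> - w2 x - \<kappa>\<^sup>2 * U2 x = g2 x"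
      "sq_norm R1 U1 + sq_norm (R2 L) U2 \<le> K * (sq_norm R1 g1 + sq_norm (R2 L) g2)"
      using K(2)[OF g] by metis
    have "AE x in lebesgue_on R1. fst (?T u) x = g1 x"
      using R1.AE_in_I dom_rep_H(5)[OF u(1), of "\<kappa>\<^sup>2"] by eventually_elim (simp only: u(2))
    moreover have "AE x in lebesgue_on (R2 L). snd (?T u) x = g2 x"
      using R2.AE_in_I dom_rep_H(6)[OF u(1), of "\<kappa>\<^sup>2"] by eventually_elim (simp only: u(3))
    ultimately have "tadpole_eq L (?T u) (g1, g2)" by (simp add: tadpole_eq_def)
    moreover have "tadpole_norm L u \<le> sqrt K * sqrt (sq_norm R1 g1 + sq_norm (R2 L) g2)"
      unfolding dom_rep_norms(1)[OF u(1)] real_sqrt_mult[symmetric] using u(4) by (rule real_sqrt_le_mono)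
    ultimately show ?thesis using dom_rep_imp_dom[OF u(1)] by blast
  qed
  have bound: "tadpole_norm L u \<le> sqrt K * tadpole_norm L (?T u)" if ud: "u \<in> tadpole_dom L \<alpha>" for u
  proof -
    obtain U1 V1 w1 U2 V2 w2 where u: "dom_rep u U1 V1 w1 U2 V2 w2" using dom_imp_dom_rep[OF ud] .
    obtain v where v: "v \<in> tadpole_dom L \<alpha>"
      "tadpole_eq L (?T v) (\<lambda>x. - w1 x - \<kappa>\<^sup>2 * U1 x, \<lambda>x. - w2 x - \<kappa>\<^sup>2 * U2 x)"
      "tadpole_norm L v \<le> sqrt K * tadpole_norm L (?T u)"
      using surj[OF dom_rep_L2(3,4)[OF u]] unfolding dom_rep_norms(2)[OF u] by blast
    have a: "AE x in lebesgue_on R1. fst (?T v) x = - w1 x - \<kappa>\<^sup>2 * U1 x"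
      "AE x in lebesgue_on (R2 L). snd (?T v) x = - w2 x - \<kappa>\<^sup>2 * U2 x"
      using v(2) by (simp_all add: tadpole_eq_def)
    have "AE x in lebesgue_on R1. fst (?T u) x = fst (?T v) x"
      using a(1) dom_rep_H(5)[OF u, of "\<kappa>\<^sup>2"] by eventually_elim simp
    moreover have "AE x in lebesgue_on (R2 L). snd (?T u) x = snd (?T v) x"
      using a(2) dom_rep_H(6)[OF u, of "\<kappa>\<^sup>2"] by eventually_elim simp
    ultimately have "tadpole_eq L (?T u) (?T v)" by (simp add: tadpole_eq_def)
    then have uv: "tadpole_eq L u v" by (rule resolvent_injective[OF \<kappa> nz ud v(1)])
    obtain V1 V1' W1 V2 V2' W2 where v': "dom_rep v V1 V1' W1 V2 V2' W2" using dom_imp_dom_rep[OF v(1)] .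
    have "AE x in lebesgue_on R1. fst u x = V1 x" "AE x in lebesgue_on (R2 L). snd u x = V2 x"
      using uv dom_rep_H(3,4)[OF v'] by (auto simp: tadpole_eq_def)
    then have "tadpole_norm L u = tadpole_norm L v"
      using tadpole_norm_AE[OF dom_rep_L2(1,2)[OF v']] dom_rep_norms(1)[OF v'] by simp
    with v(3) show ?thesis by simp
  qed
  have "\<exists>u\<in>tadpole_dom L \<alpha>. tadpole_eq L (?T u) g" if "g \<in> tadpole_space L" for g
    using surj[of "fst g" "snd g"] that by (auto simp: tadpole_space_def)
  then show ?thesis
    unfolding resolvent_set_def using resolvent_injective[OF \<kappa> nz] bound by blast
qed

section \<open>The spectrum and the set of complex eigenvalues\<close>

lemma eigenvalue_in_spectrum:
  assumes "is_eigenvalue L (tadpole_dom L \<alpha>) (tadpole_H L) z"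
  shows "z \<in> op_spectrum L (tadpole_dom L \<alpha>) (tadpole_H L)"
proof (rule ccontr)
  let ?T = "minus_scalar (tadpole_H L) z"
  assume "z \<notin> op_spectrum L (tadpole_dom L \<alpha>) (tadpole_H L)"
  then have inj: "\<And>u v. u \<in> tadpole_dom L \<alpha> \<Longrightarrow> v \<in> tadpole_dom L \<alpha> \<Longrightarrow>
      tadpole_eq L (?T u) (?T v) \<Longrightarrow> tadpole_eq L u v"
    unfolding op_spectrum_def resolvent_set_def by blast
  obtain u where u: "u \<in> tadpole_dom L \<alpha>" "\<not> tadpole_eq L u (\<lambda>x. 0, \<lambda>x. 0)"
    "tadpole_eq L (tadpole_H L u) (\<lambda>x. z * fst u x, \<lambda>x. z * snd u x)"
    using assms by (auto simp: is_eigenvalue_def is_eigenvector_def)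
  have "(\<lambda>x. 0) \<in> L2_on S" for S by (simp add: L2_on_def)
  then have zero: "dom_rep (\<lambda>x. 0, \<lambda>x. 0) (\<lambda>x. 0) (\<lambda>x. 0) (\<lambda>x. 0) (\<lambda>x. 0) (\<lambda>x. 0) (\<lambda>x. 0)"
    by (intro dom_rep_classical primitive_on_const) auto
  have a: "AE x in lebesgue_on R1. fst (tadpole_H L u) x = z * fst u x"
    "AE x in lebesgue_on (R2 L). snd (tadpole_H L u) x = z * snd u x"
    using u(3) by (simp_all add: tadpole_eq_def)
  have "AE x in lebesgue_on R1. fst (?T u) x = fst (?T (\<lambda>x. 0, \<lambda>x. 0)) x"
    using a(1) dom_rep_H(5)[OF zero, of z] by eventually_elim (simp add: minus_scalar_def)
  moreover have "AE x in lebesgue_on (R2 L). snd (?T u) x = snd (?T (\<lambda>x. 0, \<lambda>x. 0)) x"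
    using a(2) dom_rep_H(6)[OF zero, of z] by eventually_elim (simp add: minus_scalar_def)
  ultimately have "tadpole_eq L (?T u) (?T (\<lambda>x. 0, \<lambda>x. 0))" by (simp add: tadpole_eq_def)
  with inj[OF u(1) dom_rep_imp_dom[OF zero]] u(2) show False by blast
qed

lemma characteristic_zero_iff:
  assumes "\<kappa> \<noteq> - of_real \<alpha>"
  shows "characteristic \<kappa> = 0 \<longleftrightarrow> exp (\<i> * \<kappa> * of_real L) = 3 - 4 * of_real \<alpha> / (\<kappa> + of_real \<alpha>)"
proof -
  have nz: "\<kappa> + of_real \<alpha> \<noteq> 0" using assms by (simp add: eq_neg_iff_add_eq_0)
  have eq: "3 - 4 * of_real \<alpha> / (\<kappa> + of_real \<alpha>) = (3 * \<kappa> - of_real \<alpha>) / (\<kappa> + of_real \<alpha>)"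
    using nz by (simp add: field_simps)
  show ?thesis unfolding eq using nz by (simp add: characteristic_def eq_divide_eq)
qed

text \<open>
  This is where dissipativity shows. A zero satisfies \<open>3\<kappa> - \<alpha> = E (\<kappa> + \<alpha>)\<close> with \<open>\<bar>E\<bar> < 1\<close>; comparing
  squared moduli gives \<open>\<bar>\<kappa>\<bar>\<^sup>2 < \<alpha> Re \<kappa>\<close>.
\<close>
lemma characteristic_zero_Re_pos:
  assumes \<kappa>: "Im \<kappa> > 0" and zero: "characteristic \<kappa> = 0"
  shows "Re \<kappa> > 0"
proof -
  have nz: "\<kappa> + of_real \<alpha> \<noteq> 0" using \<kappa> by (auto simp: complex_eq_iff)
  have "3 * \<kappa> - of_real \<alpha> = exp (\<i> * \<kappa> * of_real L) * (\<kappa> + of_real \<alpha>)"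
    using zero by (simp add: characteristic_def)
  then have "cmod (3 * \<kappa> - of_real \<alpha>) < 1 * cmod (\<kappa> + of_real \<alpha>)"
    unfolding norm_mult using abs_exp_less_1[OF \<kappa>] nz by (simp only: norm_mult) (intro mult_strict_right_mono, auto)
  then have "(cmod (3 * \<kappa> - of_real \<alpha>))\<^sup>2 < (cmod (\<kappa> + of_real \<alpha>))\<^sup>2"
    by (simp add: power_strict_mono)
  then have "(3 * Re \<kappa> - \<alpha>)\<^sup>2 + (3 * Im \<kappa>)\<^sup>2 < (Re \<kappa> + \<alpha>)\<^sup>2 + (Im \<kappa>)\<^sup>2"
    by (simp add: cmod_power2)
  then have "8 * ((Re \<kappa>)\<^sup>2 + (Im \<kappa>)\<^sup>2) < 8 * (\<alpha> * Re \<kappa>)"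
    by (simp add: power2_eq_square algebra_simps)
  then have "(Re \<kappa>)\<^sup>2 + (Im \<kappa>)\<^sup>2 < \<alpha> * Re \<kappa>" by (simp only: mult_less_cancel_left_pos zero_less_numeral)
  then have "\<alpha> * Re \<kappa> > 0"
    by (rule le_less_trans[OF sum_power2_ge_zero])
  then show ?thesis using \<alpha>_pos by (simp add: zero_less_mult_iff)
qed

lemma Sigma_p_minus_iff:
  "z \<in> Sigma_p_minus L \<alpha> \<longleftrightarrow> (\<exists>\<kappa>. Im \<kappa> > 0 \<and> characteristic \<kappa> = 0 \<and> z = \<kappa>\<^sup>2)"
proof -
  have "\<kappa> \<noteq> - of_real \<alpha>" if "Im \<kappa> > 0" for \<kappa> using that by auto
  then have "Re \<kappa> > 0 \<and> Im \<kappa> > 0 \<and> exp (\<i> * \<kappa> * of_real L) = 3 - 4 * of_real \<alpha> / (\<kappa> + of_real \<alpha>)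
      \<longleftrightarrow> Im \<kappa> > 0 \<and> characteristic \<kappa> = 0" for \<kappa>
    using characteristic_zero_iff characteristic_zero_Re_pos by blast
  then show ?thesis unfolding Sigma_p_minus_def by blast
qed

lemma Sigma_p_minus_csqrt:
  assumes "z \<in> Sigma_p_minus L \<alpha>"
  shows "Re (csqrt z) > 0" "Im (csqrt z) > 0" "characteristic (csqrt z) = 0"
proof -
  obtain \<kappa> where \<kappa>: "Im \<kappa> > 0" "characteristic \<kappa> = 0" "z = \<kappa>\<^sup>2"
    using assms Sigma_p_minus_iff by blast
  have "Re \<kappa> > 0" using characteristic_zero_Re_pos[OF \<kappa>(1,2)] .
  then have "csqrt z = \<kappa>" unfolding \<kappa>(3) by (intro csqrt_square) auto
  then show "Re (csqrt z) > 0" "Im (csqrt z) > 0" "characteristic (csqrt z) = 0"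
    using \<kappa> \<open>Re \<kappa> > 0\<close> by auto
qed

lemma Sigma_p_minus_Im_pos: "z \<in> Sigma_p_minus L \<alpha> \<Longrightarrow> Im z > 0"
  using Sigma_p_minus_csqrt[of z] power2_csqrt[of z]
  by (metis Im_power2 mult_pos_pos zero_less_numeral)

text \<open>
  The principal square root maps the set injectively and continuously to zeros of the characteristic function. These
  are isolated since that function is entire and takes the value \<open>4 \<alpha>\<close> at \<open>- \<alpha>\<close>.
\<close>
lemma discrete_Sigma_p_minus: "discrete (Sigma_p_minus L \<alpha>)"
  unfolding discrete_altdef
proof
  fix z assume z: "z \<in> Sigma_p_minus L \<alpha>"
  define \<kappa> where "\<kappa> = csqrt z"
  have "characteristic holomorphic_on UNIV"
    unfolding characteristic_def[abs_def] by (intro holomorphic_intros)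
  moreover have "characteristic (- of_real \<alpha>) \<noteq> 0"
    using \<alpha>_pos by (simp add: characteristic_def)
  ultimately obtain r where r: "r > 0" "\<And>w. w \<in> ball \<kappa> r - {\<kappa>} \<Longrightarrow> characteristic w \<noteq> 0"
    using isolated_zeros[of characteristic UNIV \<kappa> "- of_real \<alpha>"] Sigma_p_minus_csqrt(3)[OF z]
    by (auto simp: \<kappa>_def)
  have "z \<notin> \<real>\<^sub>\<le>\<^sub>0"
    using Sigma_p_minus_Im_pos[OF z] by (auto simp: complex_nonpos_Reals_iff)
  then have "isCont csqrt z" by (rule continuous_at_csqrt)
  then have "\<forall>\<^sub>F w in at z. csqrt w \<in> ball \<kappa> r"
    unfolding isCont_def \<kappa>_def using r(1) by (intro topological_tendstoD) auto
  moreover have "\<forall>\<^sub>F w in at z. w \<noteq> z" by (rule eventually_neq_at_within)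
  ultimately show "\<forall>\<^sub>F w in at z. w \<notin> Sigma_p_minus L \<alpha>"
  proof eventually_elim
    case (elim w)
    have "csqrt w \<noteq> \<kappa>" using elim(2) unfolding \<kappa>_def by (metis power2_csqrt)
    then show ?case using r(2) elim(1) Sigma_p_minus_csqrt(3)[of w] by auto
  qed
qed

text \<open>
  If the principal root is in the lower half-plane, its negative is taken.
\<close>
lemma square_root_upper_half_plane:
  assumes "z \<notin> complex_of_real ` {0..}"
  obtains \<kappa> where "Im \<kappa> > 0" "z = \<kappa>\<^sup>2"
proof -
  have "Im (csqrt z) \<noteq> 0"
  proof
    assume "Im (csqrt z) = 0"
    then have "csqrt z = of_real (Re (csqrt z))" by (simp add: complex_eq_iff)
    then have "z = of_real ((Re (csqrt z))\<^sup>2)" by (metis of_real_power power2_csqrt)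
    then show False using assms by (metis atLeast_iff imageI zero_le_power2)
  qed
  then consider "Im (csqrt z) > 0" | "Im (- csqrt z) > 0"
    by (simp only: uminus_complex.sel) linarith
  then show ?thesis
    using that by cases (metis power2_csqrt, metis power2_csqrt power2_minus)
qed

lemma Sigma_p_minus_eigenvalue:
  assumes "z \<in> Sigma_p_minus L \<alpha>"
  shows "is_eigenvalue L (tadpole_dom L \<alpha>) (tadpole_H L) z"
proof -
  obtain \<kappa> where "Im \<kappa> > 0" "characteristic \<kappa> = 0" "z = \<kappa>\<^sup>2"
    using assms Sigma_p_minus_iff by blast
  then show ?thesis using eigenvalue_if_characteristic_zero by simp
qed

lemma spectrum_eq:
  "op_spectrum L (tadpole_dom L \<alpha>) (tadpole_H L) = complex_of_real ` {0..} \<union> Sigma_p_minus L \<alpha>"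
proof (intro equalityI subsetI)
  fix z assume z: "z \<in> op_spectrum L (tadpole_dom L \<alpha>) (tadpole_H L)"
  show "z \<in> complex_of_real ` {0..} \<union> Sigma_p_minus L \<alpha>"
  proof (cases "z \<in> complex_of_real ` {0..}")
    case False
    then obtain \<kappa> where \<kappa>: "Im \<kappa> > 0" "z = \<kappa>\<^sup>2" using square_root_upper_half_plane by blast
    then have "characteristic \<kappa> = 0"
      using in_resolvent_set[OF \<kappa>(1)] z by (auto simp: op_spectrum_def)
    then show ?thesis using \<kappa> Sigma_p_minus_iff by blast
  qed simp
next
  fix z assume "z \<in> complex_of_real ` {0..} \<union> Sigma_p_minus L \<alpha>"
  then show "z \<in> op_spectrum L (tadpole_dom L \<alpha>) (tadpole_H L)"
    using nonneg_in_spectrum eigenvalue_in_spectrum[OF Sigma_p_minus_eigenvalue] by auto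
qed

end

theorem theorem2p2:
  fixes L \<alpha> :: real
  assumes "L > 0" and "\<alpha> > 0"
  shows
    "op_spectrum L (tadpole_dom L \<alpha>) (tadpole_H L) = complex_of_real ` {0..} \<union> Sigma_p_minus L \<alpha> \<and>
     complex_of_real ` {0..} \<inter> Sigma_p_minus L \<alpha> = {} \<and>
     (\<forall>k::nat. k \<ge> 1 \<longrightarrow>
        (let lam = 2 * real k * pi / L in
           lam\<^sup>2 = 4 * (real k)\<^sup>2 * pi\<^sup>2 / L\<^sup>2 \<and>
           is_eigenvalue L (tadpole_dom L \<alpha>) (tadpole_H L) (of_real (lam\<^sup>2)) \<and>
           is_eigenvector L (tadpole_dom L \<alpha>) (tadpole_H L) (of_real (lam\<^sup>2))
             ((\<lambda>x. 0), (\<lambda>x. of_real (sqrt 2 / sqrt L * sin (lam * x)))))) \<and>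
     (\<forall>z\<in>Sigma_p_minus L \<alpha>. is_eigenvalue L (tadpole_dom L \<alpha>) (tadpole_H L) z) \<and>
     discrete (Sigma_p_minus L \<alpha>)"
proof -
  interpret tadpole L \<alpha> by standard (fact assms)+
  have "complex_of_real ` {0..} \<inter> Sigma_p_minus L \<alpha> = {}"
    using Sigma_p_minus_Im_pos by fastforce
  moreover have "\<forall>k::nat. k \<ge> 1 \<longrightarrow>
        (let lam = 2 * real k * pi / L in
           lam\<^sup>2 = 4 * (real k)\<^sup>2 * pi\<^sup>2 / L\<^sup>2 \<and>
           is_eigenvalue L (tadpole_dom L \<alpha>) (tadpole_H L) (of_real (lam\<^sup>2)) \<and>
           is_eigenvector L (tadpole_dom L \<alpha>) (tadpole_H L) (of_real (lam\<^sup>2))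
             ((\<lambda>x. 0), (\<lambda>x. of_real (sqrt 2 / sqrt L * sin (lam * x)))))"
    unfolding Let_def
  proof (intro allI impI conjI)
    fix k :: nat assume k: "k \<ge> 1"
    show "(2 * real k * pi / L)\<^sup>2 = 4 * (real k)\<^sup>2 * pi\<^sup>2 / L\<^sup>2"
      by (simp add: power_divide power_mult_distrib)
    show *: "is_eigenvector L (tadpole_dom L \<alpha>) (tadpole_H L) (of_real ((2 * real k * pi / L)\<^sup>2))
        ((\<lambda>x. 0), (\<lambda>x. of_real (sqrt 2 / sqrt L * sin (2 * real k * pi / L * x))))"
      by (rule sine_eigenvector[OF k])
    show "is_eigenvalue L (tadpole_dom L \<alpha>) (tadpole_H L) (of_real ((2 * real k * pi / L)\<^sup>2))"
      unfolding is_eigenvalue_def by (rule exI) (rule *)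
  qed
  moreover have "\<forall>z\<in>Sigma_p_minus L \<alpha>. is_eigenvalue L (tadpole_dom L \<alpha>) (tadpole_H L) z"
    using Sigma_p_minus_eigenvalue by simp
  ultimately show ?thesis
    by (intro conjI spectrum_eq discrete_Sigma_p_minus)
qed

end
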